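(* Let $\mathcal A$ be an indexing collection on $\mathcal T$, $m$ a measure on $(\mathcal T,\sigma(\mathcal A))$ that is finite on $\mathcal A$ and such that $d_m$ is set-indexed compatible, and let $X=\{X_A:A\in\mathcal A\}$ be an $L^2(\Omega)$ set-indexed Lévy process with Lévy–Khintchine triplet $(b,\sigma^2,\nu)$ (see context). Then there exists a unique continuous linear map $$\mathbf X:L(X)\to L^2(\Omega),\qquad f\mapsto\mathbf X(f)=\int_{\mathcal T}f\,dX,$$ such that $\mathbf X(\mathbf 1_A)=X_A$ for all $A\in\mathcal A$.
   Context: Indexing collection. $\mathcal T$ is a non-empty set. $\mathcal A\subseteq\mathcal P(\mathcal T)$ is an indexing collection on $\mathcal T$ if: (1) $\varnothing\in\mathcal A$, and $\mathcal A$ and $\mathcal A\setminus\{\varnothing\}$ are closed under countable intersections; (2) there is an increasing sequence of finite subcollections $\mathcal A_n\subseteq\mathcal A$ ($n\in\mathbb N$), each closed under intersections, such that with $g_n(A)=\bigcap\{A'\in\mathcal A_n\cup\{\mathcal T\}:A\subseteq A'\}$ one has $A=\bigcap_n g_n(A)$ for all $A\in\mathcal A$; (3) (SHAPE) if $A,A_1,\dots,A_n\in\mathcal A$ and $A\subseteq\bigcup_{i\le n}A_i$ then $A\subseteq A_j$ for some $j$; (4) (TIP) the map $t\mapsto A(t)=\bigcap_nA_n(t)$, with $A_n(t)=\bigcap\{A\in\mathcal A_n\cup\{\mathcal T\}:t\in A\}$, is a bijection from $\mathcal T$ onto $\mathcal A\setminus\{\varnothing\}$. The sequence $(\mathcal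 A_n)$ is fixed, and $\varnothing$ and $\varnothing'=\bigcap_{A\in\mathcal A,A\ne\varnothing}A$ are assumed to belong to every $\mathcal A_n$. Classes. $\mathcal D(u)$ is the class of finite unions of elements of $\mathcal D$; $\mathcal C=\{A\setminus U:A\in\mathcal A,U\in\mathcal A(u)\}$; $\mathcal C^\ell(\mathcal A_n)$ is the collection of sets $A\setminus\bigcup_{A'\in\mathcal A_n,A'\subsetneq A}A'$, $A\in\mathcal A_n$. For $h:\mathcal A\to\mathbb R$ with $h(\varnothing)=0$, $\Delta h:\mathcal C(u)\to\mathbb R$ is its unique additive extension; $\Delta X$ is the increment process of $X$ ($X_\varnothing=0$). Compatibility. A pseudo-metric $d$ on $\mathcal A$, transported to $\mathcal T$ by $d_{\mathcal T}(s,t)=d(A(s),A(t))$, is compatible if: (i) $d(A\cap A'',A'\cap A'')\le d(A,A')$; (ii) $d(A_n,\bigcap_kA_k)\to0$ for every non-increasing sequence $(A_n)$ in $\mathcal A$; (iii) $\max_{C\in\mathcal C^\ell(\mathcal A_n)}\sup_{s,s'\in C}d_{\mathcal T}(s,s')\to0$ as $n\to\infty$; (iv) for $A\subseteq A'$ in $\mathcal A$ there is $A''\in\mathcal A$ with $A\subseteq A''\subseteq A'$ and $d(A,A'')=d(A'',A')=d(A,A')/2$. Here $d_m(A,A')=m(A\triangle A')$. $L^2$ set-indexed Lévy process: (0) $\mathbf E[X_A^2]<\infty$ for all $A\in\mathcal A$; (1) for pairwise disjoint $C_1,\dots,C_n\in\mathcal C$, $\Delta X_{C_1},\dots,\Delta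 X_{C_n}$ are independent; (2) if $C_1,C_2\in\mathcal C$ and $m(C_1)=m(C_2)$ then $\Delta X_{C_1}$ and $\Delta X_{C_2}$ have the same law; (3) for every non-increasing sequence $(A_n)$ in $\mathcal A$, $X_{A_n}\to X_{\bigcap_kA_k}$ in distribution. It is known that there is a triplet $(b,\sigma^2,\nu)$, $b\in\mathbb R$, $\sigma^2\ge0$, $\nu$ a Borel measure on $\mathbb R$ with $\nu(\{0\})=0$, $\int(1\wedge x^2)\nu(dx)<\infty$, such that for all $C\in\mathcal C$, $\mathbf E[e^{i\xi\Delta X_C}]=e^{m(C)\psi(\xi)}$ with $\psi(\xi)=ib\xi-\frac12\sigma^2\xi^2+\int(e^{i\xi x}-1-i\xi x\mathbf 1_{|x|\le1})\nu(dx)$. $L(X)$ is the linear space of measurable functions $f:\mathcal T\to\mathbb R$ (identified when $m$-a.e. equal) such that $$\|f\|_{L(X)}=\sqrt{\Big(b+\int_{|x|>1}x\,\nu(dx)\Big)^2\|f\|_{L^1(m)}^2+\Big(\sigma^2+\int_{\mathbb R}x^2\nu(dx)\Big)\|f\|_{L^2(m)}^2}$$ is finite (convention $0\times\infty=0$), with the topology of $\|\cdot\|_{L(X)}$. *)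

theory Defs
  imports "HOL-Probability.Probability"
begin

section \<open>Indexing collections\<close>

definition discr_hull :: "'t set \<Rightarrow> 't set set \<Rightarrow> 't set \<Rightarrow> 't set" where
  "discr_hull T D A = \<Inter>{A' \<in> D \<union> {T}. A \<subseteq> A'}"

definition discr_point :: "'t set \<Rightarrow> 't set set \<Rightarrow> 't \<Rightarrow> 't set" where
  "discr_point T D t = \<Inter>{A' \<in> D \<union> {T}. t \<in> A'}"

definition point_set :: "'t set \<Rightarrow> (nat \<Rightarrow> 't set set) \<Rightarrow> 't \<Rightarrow> 't set" where
  "point_set T \<A>n t = (\<Inter>n. discr_point T (\<A>n n) t)"

definition closed_countable_Inter :: "'t set set \<Rightarrow> bool" where
  "closed_countable_Inter D \<longleftrightarrow>
     (\<forall>F. F \<subseteq> D \<longrightarrow> countable F \<longrightarrow> F \<noteq> {} \<longrightarrow> \<Inter>F \<in> D)"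

text \<open>
  The discretizing sequence \<open>\<A>n\<close> is fixed together with the collection \<open>\<A>\<close>.
  Intersections of families of members of \<open>\<A>\<close> are over non-empty families: \<open>T\<close> itself need not
  belong to \<open>\<A>\<close>. In \<open>shape\<close> the covering family is likewise non-empty.
\<close>

locale indexing_collection =
  fixes T :: "'t set" and \<A> :: "'t set set" and \<A>n :: "nat \<Rightarrow> 't set set"
  assumes nonempty: "T \<noteq> {}"
    and subsets: "\<A> \<subseteq> Pow T"
    and empty_mem: "{} \<in> \<A>"
    and Inter_closed: "closed_countable_Inter \<A>"
    and Inter_closed_nonempty: "closed_countable_Inter (\<A> - {{}})"
    and discr_finite: "\<And>n. finite (\<A>n n)"
    and discr_subset: "\<And>n. \<A>n n \<subseteq> \<A>"
    and discr_incseq: "incseq \<A>n"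
    and discr_Int: "\<And>n A B. A \<in> \<A>n n \<Longrightarrow> B \<in> \<A>n n \<Longrightarrow> A \<inter> B \<in> \<A>n n"
    and discr_dense: "\<And>A. A \<in> \<A> \<Longrightarrow> A = (\<Inter>n. discr_hull T (\<A>n n) A)"
    and shape: "\<And>A F. A \<in> \<A> \<Longrightarrow> F \<subseteq> \<A> \<Longrightarrow> finite F \<Longrightarrow> F \<noteq> {} \<Longrightarrow> A \<subseteq> \<Union>F \<Longrightarrow> \<exists>B\<in>F. A \<subseteq> B"
    and tip: "bij_betw (point_set T \<A>n) T (\<A> - {{}})"
    and discr_empty: "\<And>n. {} \<in> \<A>n n"
    and discr_empty': "\<And>n. \<Inter>(\<A> - {{}}) \<in> \<A>n n"

section \<open>Derived classes and the increment map\<close>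

definition finite_unions :: "'t set set \<Rightarrow> 't set set" where
  "finite_unions D = {\<Union>F | F. finite F \<and> F \<subseteq> D}"

definition incr_class :: "'t set set \<Rightarrow> 't set set" where
  "incr_class \<A> = {A - U | A U. A \<in> \<A> \<and> U \<in> finite_unions \<A>}"

definition left_class :: "'t set set \<Rightarrow> 't set set" where
  "left_class D = {A - \<Union>{A' \<in> D. A' \<subset> A} | A. A \<in> D}"

text \<open>
  The value off \<open>finite_unions (incr_class \<A>)\<close> is pinned to \<open>undefined\<close> only to make the
  description definite.
\<close>

definition increment :: "'t set set \<Rightarrow> ('t set \<Rightarrow> real) \<Rightarrow> 't set \<Rightarrow> real" where
  "increment \<A> h =
     (THE g. g \<in> extensional (finite_unions (incr_class \<A>)) \<and>
             Measure_Space.additive (finite_unions (incr_class \<A>)) g \<and>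
             (\<forall>A\<in>\<A>. g A = h A))"

definition incr_process ::
    "'t set set \<Rightarrow> ('t set \<Rightarrow> 'w \<Rightarrow> real) \<Rightarrow> 't set \<Rightarrow> 'w \<Rightarrow> real" where
  "incr_process \<A> X C w = increment \<A> (\<lambda>A. X A w) C"

section \<open>Compatible pseudo-metrics\<close>

locale pseudo_metric_on =
  fixes S :: "'a set" and d :: "'a \<Rightarrow> 'a \<Rightarrow> real"
  assumes dist_nonneg: "\<And>x y. x \<in> S \<Longrightarrow> y \<in> S \<Longrightarrow> 0 \<le> d x y"
    and dist_refl: "\<And>x. x \<in> S \<Longrightarrow> d x x = 0"
    and dist_sym: "\<And>x y. x \<in> S \<Longrightarrow> y \<in> S \<Longrightarrow> d x y = d y x"
    and dist_triangle: "\<And>x y z. x \<in> S \<Longrightarrow> y \<in> S \<Longrightarrow> z \<in> S \<Longrightarrow> d x z \<le> d x y + d y z"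

text \<open>
  Suprema are taken in \<^typ>\<open>ennreal\<close>, so that they exist unconditionally and vanish on the
  empty members of \<open>left_class\<close>.
\<close>

locale compatible_metric = pseudo_metric_on \<A> d
  for T :: "'t set" and \<A> :: "'t set set" and \<A>n :: "nat \<Rightarrow> 't set set"
    and d :: "'t set \<Rightarrow> 't set \<Rightarrow> real" +
  assumes contractive:
      "\<And>A A' A''. A \<in> \<A> \<Longrightarrow> A' \<in> \<A> \<Longrightarrow> A'' \<in> \<A> \<Longrightarrow> d (A \<inter> A'') (A' \<inter> A'') \<le> d A A'"
    and outer_continuous:
      "\<And>B. range B \<subseteq> \<A> \<Longrightarrow> decseq B \<Longrightarrow> (\<lambda>n. d (B n) (\<Inter>k. B k)) \<longlonglongrightarrow> 0"
    and vanishing_diameter: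
      "(\<lambda>n. SUP C\<in>left_class (\<A>n n). SUP s\<in>C. SUP s'\<in>C.
              ennreal (d (point_set T \<A>n s) (point_set T \<A>n s'))) \<longlonglongrightarrow> 0"
    and midpoint:
      "\<And>A A'. A \<in> \<A> \<Longrightarrow> A' \<in> \<A> \<Longrightarrow> A \<subseteq> A' \<Longrightarrow>
         \<exists>A''\<in>\<A>. A \<subseteq> A'' \<and> A'' \<subseteq> A' \<and> d A A'' = d A A' / 2 \<and> d A'' A' = d A A' / 2"

definition measure_dist :: "'t measure \<Rightarrow> 't set \<Rightarrow> 't set \<Rightarrow> real" where
  "measure_dist m A A' = measure m (sym_diff A A')"

section \<open>Square-integrable set-indexed Levy processes\<close>

locale L2_levy_process = prob_space P
  for \<A> :: "'t set set" and m :: "'t measure" and P :: "'w measure"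
    and X :: "'t set \<Rightarrow> 'w \<Rightarrow> real" +
  assumes random_variable: "\<And>A. A \<in> \<A> \<Longrightarrow> X A \<in> borel_measurable P"
    and null_at_empty: "\<And>w. w \<in> space P \<Longrightarrow> X {} w = 0"
    and square_integrable: "\<And>A. A \<in> \<A> \<Longrightarrow> integrable P (\<lambda>w. (X A w)\<^sup>2)"
    and indep_increments:
      "\<And>n C. (\<forall>i<n. C i \<in> incr_class \<A>) \<Longrightarrow> disjoint_family_on C {..<n} \<Longrightarrow>
         indep_vars (\<lambda>_. borel) (\<lambda>i. incr_process \<A> X (C i)) {..<n::nat}"
    and stationary_increments:
      "\<And>C C'. C \<in> incr_class \<A> \<Longrightarrow> C' \<in> incr_class \<A> \<Longrightarrow> measure m C = measure m C' \<Longrightarrow>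
         distr P borel (incr_process \<A> X C) = distr P borel (incr_process \<A> X C')"
    and continuous_in_distribution:
      "\<And>B. range B \<subseteq> \<A> \<Longrightarrow> decseq B \<Longrightarrow>
         weak_conv_m (\<lambda>n. distr P borel (X (B n))) (distr P borel (X (\<Inter>n. B n)))"

definition levy_exponent :: "real \<Rightarrow> real \<Rightarrow> real measure \<Rightarrow> real \<Rightarrow> complex" where
  "levy_exponent b \<sigma>2 \<nu> \<xi> =
     \<i> * of_real (b * \<xi>) - of_real (\<sigma>2 * \<xi>\<^sup>2 / 2) +
     (CLINT x|\<nu>. iexp (\<xi> * x) - 1 - \<i> * of_real (\<xi> * x * indicator {x. \<bar>x\<bar> \<le> 1} x))"

locale levy_triplet =
  fixes \<A> :: "'t set set" and m :: "'t measure" and P :: "'w measure"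
    and X :: "'t set \<Rightarrow> 'w \<Rightarrow> real" and b \<sigma>2 :: real and \<nu> :: "real measure"
  assumes gauss_nonneg: "0 \<le> \<sigma>2"
    and sets_levy: "sets \<nu> = sets borel"
    and levy_zero: "emeasure \<nu> {0} = 0"
    and levy_finite: "(\<integral>\<^sup>+x. ennreal (min 1 (x\<^sup>2)) \<partial>\<nu>) < \<infinity>"
    and levy_khintchine:
      "\<And>C \<xi>. C \<in> incr_class \<A> \<Longrightarrow>
         (CLINT w|P. iexp (\<xi> * incr_process \<A> X C w)) =
         exp (of_real (measure m C) * levy_exponent b \<sigma>2 \<nu> \<xi>)"

section \<open>Function spaces modulo almost everywhere equality\<close>

definition ae_class :: "'a measure \<Rightarrow> ('a \<Rightarrow> real) \<Rightarrow> ('a \<Rightarrow> real) set" where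
  "ae_class M f = {g \<in> borel_measurable M. AE x in M. g x = f x}"

definition class_lincomb ::
    "'a measure \<Rightarrow> real \<Rightarrow> ('a \<Rightarrow> real) set \<Rightarrow> real \<Rightarrow> ('a \<Rightarrow> real) set \<Rightarrow> ('a \<Rightarrow> real) set" where
  "class_lincomb M a F c G =
     {h \<in> borel_measurable M. \<exists>f\<in>F. \<exists>g\<in>G. AE x in M. h x = a * f x + c * g x}"

text \<open>
  The square of the norm of \<open>L(X)\<close>, with values in \<^typ>\<open>ennreal\<close>, where \<open>0 * \<infinity> = 0\<close>. If
  \<open>x\<close> is not \<open>\<nu>\<close>-integrable on \<open>{x. 1 < \<bar>x\<bar>}\<close>, its Bochner integral is 0 by convention; for the
  triplet of a square-integrable process this can only happen when \<open>m\<close> is the null measure, and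
  then the norm is identically 0 anyway.
\<close>

definition LX_norm_sq ::
    "'t measure \<Rightarrow> real \<Rightarrow> real \<Rightarrow> real measure \<Rightarrow> ('t \<Rightarrow> real) \<Rightarrow> ennreal" where
  "LX_norm_sq m b \<sigma>2 \<nu> f =
     ennreal ((b + (LINT x:{x. 1 < \<bar>x\<bar>}|\<nu>. x))\<^sup>2) * (\<integral>\<^sup>+t. ennreal \<bar>f t\<bar> \<partial>m)\<^sup>2 +
     (ennreal \<sigma>2 + (\<integral>\<^sup>+x. ennreal (x\<^sup>2) \<partial>\<nu>)) * (\<integral>\<^sup>+t. ennreal ((f t)\<^sup>2) \<partial>m)"

definition LX_norm ::
    "'t measure \<Rightarrow> real \<Rightarrow> real \<Rightarrow> real measure \<Rightarrow> ('t \<Rightarrow> real) \<Rightarrow> real" where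
  "LX_norm m b \<sigma>2 \<nu> f = sqrt (enn2real (LX_norm_sq m b \<sigma>2 \<nu> f))"

definition LX_space ::
    "'t measure \<Rightarrow> real \<Rightarrow> real \<Rightarrow> real measure \<Rightarrow> ('t \<Rightarrow> real) set set" where
  "LX_space m b \<sigma>2 \<nu> = ae_class m ` {f \<in> borel_measurable m. LX_norm_sq m b \<sigma>2 \<nu> f < \<infinity>}"

definition L2_norm :: "'w measure \<Rightarrow> ('w \<Rightarrow> real) \<Rightarrow> real" where
  "L2_norm P u = sqrt (LINT w|P. (u w)\<^sup>2)"

definition L2_space :: "'w measure \<Rightarrow> ('w \<Rightarrow> real) set set" where
  "L2_space P = ae_class P ` {u \<in> borel_measurable P. integrable P (\<lambda>w. (u w)\<^sup>2)}"

definition linear_map_classes ::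
    "'a measure \<Rightarrow> ('a \<Rightarrow> real) set set \<Rightarrow> 'b measure \<Rightarrow>
     (('a \<Rightarrow> real) set \<Rightarrow> ('b \<Rightarrow> real) set) \<Rightarrow> bool" where
  "linear_map_classes M V N \<Phi> \<longleftrightarrow>
     (\<forall>F\<in>V. \<forall>G\<in>V. \<forall>a c. \<Phi> (class_lincomb M a F c G) = class_lincomb N a (\<Phi> F) c (\<Phi> G))"

text \<open>
  Continuity for the topologies given by (semi-)norms of representatives; \<open>LX_norm\<close> is only a
  seminorm when both of its coefficients vanish.
\<close>

definition continuous_map_classes ::
    "('a set set) \<Rightarrow> ('a \<Rightarrow> 'a \<Rightarrow> real) \<Rightarrow> ('b \<Rightarrow> 'b \<Rightarrow> real) \<Rightarrow> ('a set \<Rightarrow> 'b set) \<Rightarrow> bool" where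
  "continuous_map_classes V dV dW \<Phi> \<longleftrightarrow>
     (\<forall>F\<in>V. \<forall>e>0. \<exists>r>0. \<forall>G\<in>V. \<forall>f\<in>F. \<forall>g\<in>G. dV f g < r \<longrightarrow>
        (\<forall>u\<in>\<Phi> F. \<forall>v\<in>\<Phi> G. dW u v < e))"

definition is_stochastic_integral ::
    "'t set set \<Rightarrow> 't measure \<Rightarrow> 'w measure \<Rightarrow> ('t set \<Rightarrow> 'w \<Rightarrow> real) \<Rightarrow>
     real \<Rightarrow> real \<Rightarrow> real measure \<Rightarrow> (('t \<Rightarrow> real) set \<Rightarrow> ('w \<Rightarrow> real) set) \<Rightarrow> bool" where
  "is_stochastic_integral \<A> m P X b \<sigma>2 \<nu> \<Phi> \<longleftrightarrow>
     \<Phi> \<in> LX_space m b \<sigma>2 \<nu> \<rightarrow>\<^sub>E L2_space P \<and>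
     linear_map_classes m (LX_space m b \<sigma>2 \<nu>) P \<Phi> \<and>
     continuous_map_classes (LX_space m b \<sigma>2 \<nu>)
       (\<lambda>f g. LX_norm m b \<sigma>2 \<nu> (\<lambda>t. f t - g t)) (\<lambda>u v. L2_norm P (\<lambda>w. u w - v w)) \<Phi> \<and>
     (\<forall>A\<in>\<A>. \<Phi> (ae_class m (indicator A)) = ae_class P (X A))"

end

theory Submission
  imports Defs
begin

text \<open>
  Write \<open>\<mu> = b + \<integral>\<^bsub>|x|>1\<^esub> x \<nu>(dx)\<close> and \<open>s\<^sup>2 = \<sigma>\<^sup>2 + \<integral> x\<^sup>2 \<nu>(dx)\<close>. Expanding the Levy-Khintchine formula at 0 to
  second order gives \<open>E[\<Delta>X\<^sub>C] = \<mu> m(C)\<close> and \<open>Var[\<Delta>X\<^sub>C] = s\<^sup>2 m(C)\<close>, where \<open>s\<^sup>2\<close> is finite by Fatou's lemma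
  unless \<open>m\<close> is null. Splitting \<open>A\<close> and \<open>B\<close> along \<open>A \<inter> B\<close> into independent increments yields
  \<open>E[X\<^sub>A X\<^sub>B] = \<mu>\<^sup>2 m(A) m(B) + s\<^sup>2 m(A \<inter> B)\<close>. By bilinearity, \<open>E[X(f)\<^sup>2] = \<mu>\<^sup>2 (\<integral>f dm)\<^sup>2 + s\<^sup>2 \<integral>f\<^sup>2 dm\<close> for
  linear combinations \<open>f\<close> of indicators of members of \<open>\<A>\<close>, which is at most \<open>\<parallel>f\<parallel>\<^sup>2\<close> in \<open>L(X)\<close>. Such \<open>f\<close> are
  dense, because \<open>\<A>\<close> is an intersection-stable generator with a countable subfamily covering
  \<open>T\<close>, so the map extends to \<open>L(X)\<close> by completeness of \<open>L\<^sup>2\<close>, in only one continuous way.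
\<close>

section \<open>Elementary integrands\<close>

text \<open>The hypotheses speak of increments over \<open>incr_class \<A>\<close>, and
  \<open>increment\<close> is a definite description: nothing follows from them until an additive
  extension is shown to exist. SHAPE provides it, since it makes the indicators of nonempty members
  of \<open>\<A>\<close> linearly independent.

  The elementary integral is a relation, not a function, because one integrand has many
  representations. No choice has to be justified: the difference of two values is a value for the
  zero integrand, and the second-moment bound makes it vanish almost surely. The same device carries
  over to limits.

  For an integrand f of changing sign and nonzero drift, E[X(f)^2] involves the square of the
  integral of f, the norm that of the integral of |f|. Hence the extension rests on a bound, not on
  an isometry.

  The degenerate case is a null \<open>m\<close>: \<open>\<nu>\<close> may then have infinite second
  moment, so moments, finiteness and density need a separate argument there. Squared norms are kept
  in \<open>ennreal\<close> and compared by (x + y)^2 \<le> 2 x^2 + 2 y^2, which spares side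
  conditions on finiteness; the price is a constant that continuity does not see.\<close>

inductive elementary_integral ::
    "'t set set \<Rightarrow> ('t set \<Rightarrow> 'w \<Rightarrow> real) \<Rightarrow> ('t \<Rightarrow> real) \<Rightarrow> ('w \<Rightarrow> real) \<Rightarrow> bool"
  for \<A> X where
    zero: "elementary_integral \<A> X (\<lambda>_. 0) (\<lambda>_. 0)"
  | add_indicator: "elementary_integral \<A> X s v \<Longrightarrow> A \<in> \<A> \<Longrightarrow>
      elementary_integral \<A> X (\<lambda>t. s t + c * indicator A t) (\<lambda>w. v w + c * X A w)"

text \<open>The introduction rules only produce functions of one syntactic shape; with this lemma a
  derivation may end in any pointwise equal form.\<close>

lemma elementary_integral_cong:
  assumes "elementary_integral \<A> X s v" "\<And>t. s t = s' t" "\<And>w. v w = v' w"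
  shows "elementary_integral \<A> X s' v'"
proof -
  have "s = s'" "v = v'" using assms(2,3) by auto
  with assms(1) show ?thesis by simp
qed

lemma elementary_integral_indicator:
  assumes "A \<in> \<A>"
  shows "elementary_integral \<A> X (indicator A) (X A)"
  by (rule elementary_integral_cong[OF add_indicator[OF zero assms, where c=1]]) auto

lemma elementary_integral_scale:
  "elementary_integral \<A> X s v \<Longrightarrow> elementary_integral \<A> X (\<lambda>t. a * s t) (\<lambda>w. a * v w)"
proof (induction rule: elementary_integral.induct)
  case zero
  show ?case by (rule elementary_integral_cong[OF elementary_integral.zero]) auto
next
  case (add_indicator s v A c)
  show ?case
    by (rule elementary_integral_cong[OF elementary_integral.add_indicator[OF add_indicator.IH
          add_indicator.hyps(2), of "a * c"]]) (auto simp: algebra_simps)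
qed

lemma elementary_integral_add:
  assumes "elementary_integral \<A> X s v" "elementary_integral \<A> X s' v'"
  shows "elementary_integral \<A> X (\<lambda>t. s t + s' t) (\<lambda>w. v w + v' w)"
  using assms(2)
proof (induction rule: elementary_integral.induct)
  case zero
  show ?case using assms(1) by simp
next
  case (add_indicator s' v' A c)
  show ?case
    by (rule elementary_integral_cong[OF elementary_integral.add_indicator[OF add_indicator.IH
          add_indicator.hyps(2), of c]]) (auto simp: algebra_simps)
qed

lemma elementary_integral_lincomb:
  assumes "elementary_integral \<A> X s v" "elementary_integral \<A> X s' v'"
  shows "elementary_integral \<A> X (\<lambda>t. a * s t + c * s' t) (\<lambda>w. a * v w + c * v' w)"
  by (intro elementary_integral_add elementary_integral_scale assms)

lemma elementary_integral_diff:
  assumes "elementary_integral \<A> X s v" "elementary_integral \<A> X s' v'"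
  shows "elementary_integral \<A> X (\<lambda>t. s t - s' t) (\<lambda>w. v w - v' w)"
  by (rule elementary_integral_cong[OF elementary_integral_lincomb[OF assms, of 1 "-1"]]) auto

text \<open>Collecting repeated sets turns a derivation into a sum over a set of distinct members,
  the form in which linear independence of indicators can be applied.\<close>

lemma elementary_integral_sum_form:
  assumes "elementary_integral \<A> X s v"
  shows "\<exists>F c. finite F \<and> F \<subseteq> \<A> \<and> (\<forall>t. s t = (\<Sum>A\<in>F. c A * indicator A t)) \<and>
    (\<forall>w. v w = (\<Sum>A\<in>F. c A * X A w))"
  using assms
proof (induction rule: elementary_integral.induct)
  case zero
  show ?case by (intro exI[of _ "{}"]) auto
next
  case (add_indicator s v A a)
  then obtain F c where F: "finite F" "F \<subseteq> \<A>" "\<And>t. s t = (\<Sum>A\<in>F. c A * indicator A t)"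
    "\<And>w. v w = (\<Sum>A\<in>F. c A * X A w)" by auto
  \<comment> \<open>If \<open>A\<close> already occurs in \<open>F\<close>, the new coefficient is
    added to the old one; otherwise it stands alone.\<close>
  define d where "d = (\<lambda>B. (if B \<in> F then c B else 0) + (if B = A then a else 0))"
  have *: "(\<Sum>B\<in>insert A F. d B * g B) = (\<Sum>B\<in>F. c B * g B) + a * g A" for g :: "'a set \<Rightarrow> real"
  proof -
    have "(\<Sum>B\<in>insert A F. d B * g B) =
        (\<Sum>B\<in>insert A F. if B \<in> F then c B * g B else 0) +
        (\<Sum>B\<in>insert A F. if B = A then a * g B else 0)"
      unfolding sum.distrib[symmetric] d_def by (intro sum.cong) (auto simp: algebra_simps)
    also have "(\<Sum>B\<in>insert A F. if B \<in> F then c B * g B else 0) = (\<Sum>B\<in>F. c B * g B)"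
      using F(1) by (intro sum.mono_neutral_cong_right) auto
    also have "(\<Sum>B\<in>insert A F. if B = A then a * g B else 0) = a * g A"
      using F(1) by simp
    finally show ?thesis .
  qed
  show ?case
    using F add_indicator.hyps(2)
    by (intro exI[of _ "insert A F"] exI[of _ d]) (auto simp only: * finite_insert insert_subset)
qed

text \<open>Indicators multiply by intersecting, so the elementary integrands form an algebra as
  soon as \<open>\<A>\<close> is intersection-stable. The value \<open>u\<close> is left
  unspecified: existence suffices to reach indicators of unions and differences.\<close>

lemma elementary_integral_mult:
  assumes "\<And>A B. A \<in> \<A> \<Longrightarrow> B \<in> \<A> \<Longrightarrow> A \<inter> B \<in> \<A>"
    and "elementary_integral \<A> X s v" "elementary_integral \<A> X s' v'"
  shows "\<exists>u. elementary_integral \<A> X (\<lambda>t. s t * s' t) u"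
proof -
  have indic: "\<exists>u. elementary_integral \<A> X (\<lambda>t. s t * indicator B t) u"
    if "B \<in> \<A>" "elementary_integral \<A> X s v" for B s v
    using that(2)
  proof (induction rule: elementary_integral.induct)
    case zero
    show ?case using elementary_integral.zero[of \<A> X] by auto
  next
    case (add_indicator s v A c)
    then obtain u where "elementary_integral \<A> X (\<lambda>t. s t * indicator B t) u" by blast
    from elementary_integral.add_indicator[OF this assms(1)[OF add_indicator.hyps(2) that(1)], of c]
    show ?case
      by (intro exI, rule elementary_integral_cong) (auto simp: algebra_simps indicator_inter_arith)
  qed
  from assms(3) show ?thesis
  proof (induction rule: elementary_integral.induct)
    case zero
    show ?case using elementary_integral.zero[of \<A> X] by auto
  next
    case (add_indicator s' v' A c)
    then obtain u where u: "elementary_integral \<A> X (\<lambda>t. s t * s' t) u" by blast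
    obtain u' where u': "elementary_integral \<A> X (\<lambda>t. s t * indicator A t) u'"
      using indic[OF add_indicator.hyps(2) assms(2)] by blast
    show ?case
      by (intro exI, rule elementary_integral_cong[OF elementary_integral_lincomb[OF u u', of 1 c]])
        (auto simp: algebra_simps)
  qed
qed

section \<open>The increment map\<close>

lemma finite_unionsI: "finite F \<Longrightarrow> F \<subseteq> D \<Longrightarrow> \<Union>F \<in> finite_unions D"
  unfolding finite_unions_def by blast

lemma finite_unions_base: "A \<in> D \<Longrightarrow> A \<in> finite_unions D"
  using finite_unionsI[of "{A}" D] by simp

lemma finite_unions_Un:
  assumes "A \<in> finite_unions D" "B \<in> finite_unions D"
  shows "A \<union> B \<in> finite_unions D"
proof -
  obtain F G where "A = \<Union>F" "finite F" "F \<subseteq> D" "B = \<Union>G" "finite G" "G \<subseteq> D"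
    using assms unfolding finite_unions_def by blast
  then show ?thesis using finite_unionsI[of "F \<union> G" D] by (simp add: Union_Un_distrib)
qed

lemma finite_unions_UN:
  assumes "finite I" "\<And>i. i \<in> I \<Longrightarrow> A i \<in> finite_unions D"
  shows "(\<Union>i\<in>I. A i) \<in> finite_unions D"
  using assms
proof (induction rule: finite_induct)
  case empty
  show ?case using finite_unionsI[of "{}" D] by simp
next
  case (insert x F)
  then show ?case by (auto intro: finite_unions_Un)
qed

text \<open>\<open>A - \<Union>F\<close> is the disjoint union of
  \<open>A - \<Union>(insert B F)\<close> and \<open>A \<inter> B - \<Union>F\<close>. The induction
  hypothesis covers the whole and the second piece, which forces agreement on the first. The second
  piece starts from \<open>A \<inter> B\<close>, so \<open>A\<close> must be arbitrary in the
  induction and \<open>G\<close> intersection-stable.\<close>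

lemma additive_agree_Diff_Union:
  fixes g g' :: "'t set \<Rightarrow> real"
  assumes "Measure_Space.additive M g" "Measure_Space.additive M g'"
    and "\<And>A. A \<in> G \<Longrightarrow> g A = g' A"
    and "\<And>A B. A \<in> G \<Longrightarrow> B \<in> G \<Longrightarrow> A \<inter> B \<in> G"
    and "\<And>A F. A \<in> G \<Longrightarrow> finite F \<Longrightarrow> F \<subseteq> G \<Longrightarrow> A - \<Union>F \<in> M"
    and "finite F" "F \<subseteq> G" "A \<in> G"
  shows "g (A - \<Union>F) = g' (A - \<Union>F)"
  using assms(6-)
proof (induction F arbitrary: A rule: finite_induct)
  case empty
  then show ?case using assms(3) by simp
next
  case (insert B F)
  have AB: "A \<inter> B \<in> G" using insert.prems assms(4) by auto
  have mem: "A - \<Union>(insert B F) \<in> M" "A \<inter> B - \<Union>F \<in> M"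
    using insert.prems insert.hyps(1) AB assms(5)[of A "insert B F"] assms(5)[of "A \<inter> B" F] by auto
  have dec: "(A - \<Union>(insert B F)) \<union> (A \<inter> B - \<Union>F) = A - \<Union>F"
    "(A - \<Union>(insert B F)) \<inter> (A \<inter> B - \<Union>F) = {}" by auto
  have "g (A - \<Union>F) = g (A - \<Union>(insert B F)) + g (A \<inter> B - \<Union>F)"
    "g' (A - \<Union>F) = g' (A - \<Union>(insert B F)) + g' (A \<inter> B - \<Union>F)"
    using assms(1,2) mem dec unfolding Measure_Space.additive_def by metis+
  moreover have "g (A - \<Union>F) = g' (A - \<Union>F)" "g (A \<inter> B - \<Union>F) = g' (A \<inter> B - \<Union>F)"
    using insert.IH AB insert.prems by auto
  ultimately show ?case by simp
qed

text \<open>Each further set \<open>B\<close> adds the disjoint piece \<open>B - \<Union>F\<close>,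
  whose value is already determined by \<open>additive_agree_Diff_Union\<close>.\<close>

lemma additive_agree_Union:
  fixes g g' :: "'t set \<Rightarrow> real"
  assumes "Measure_Space.additive M g" "Measure_Space.additive M g'"
    and "\<And>A. A \<in> G \<Longrightarrow> g A = g' A"
    and "\<And>A B. A \<in> G \<Longrightarrow> B \<in> G \<Longrightarrow> A \<inter> B \<in> G"
    and "\<And>A F. A \<in> G \<Longrightarrow> finite F \<Longrightarrow> F \<subseteq> G \<Longrightarrow> A - \<Union>F \<in> M"
    and "\<And>F. finite F \<Longrightarrow> F \<subseteq> G \<Longrightarrow> \<Union>F \<in> M"
    and "finite F" "F \<subseteq> G"
  shows "g (\<Union>F) = g' (\<Union>F)"
  using assms(7-)
proof (induction F rule: finite_induct)
  case empty
  \<comment> \<open>Additivity on two empty sets gives x = x + x, so both functions vanish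
    there.\<close>
  have "{} \<in> M" using assms(6)[of "{}"] by simp
  then have "g ({} \<union> {}) = g {} + g {}" "g' ({} \<union> {}) = g' {} + g' {}"
    using assms(1,2) unfolding Measure_Space.additive_def by blast+
  then show ?case by simp
next
  case (insert B F)
  have mem: "\<Union>F \<in> M" "B - \<Union>F \<in> M" using insert assms(5,6) by auto
  have dec: "\<Union>(insert B F) = \<Union>F \<union> (B - \<Union>F)" "\<Union>F \<inter> (B - \<Union>F) = {}" by auto
  have "g (\<Union>(insert B F)) = g (\<Union>F) + g (B - \<Union>F)"
    "g' (\<Union>(insert B F)) = g' (\<Union>F) + g' (B - \<Union>F)"
    unfolding dec(1) using assms(1,2) mem dec(2) unfolding Measure_Space.additive_def by blast+
  moreover have "g (B - \<Union>F) = g' (B - \<Union>F)"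
    using additive_agree_Diff_Union[OF assms(1-5), of F B] insert by auto
  ultimately show ?case using insert by auto
qed

context indexing_collection
begin

lemma Int_mem: "A \<in> \<A> \<Longrightarrow> B \<in> \<A> \<Longrightarrow> A \<inter> B \<in> \<A>"
  using Inter_closed unfolding closed_countable_Inter_def
  by (drule_tac spec[of _ "{A, B}"]) auto

lemma incr_classI: "A \<in> \<A> \<Longrightarrow> finite F \<Longrightarrow> F \<subseteq> \<A> \<Longrightarrow> A - \<Union>F \<in> incr_class \<A>"
  unfolding incr_class_def using finite_unionsI by blast

lemma incr_classE:
  assumes "C \<in> incr_class \<A>"
  obtains A F where "A \<in> \<A>" "finite F" "F \<subseteq> \<A>" "C = A - \<Union>F"
  using assms unfolding incr_class_def finite_unions_def by blast

lemma incr_class_base: "A \<in> \<A> \<Longrightarrow> A \<in> incr_class \<A>"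
  using incr_classI[of A "{}"] by simp

lemma incr_class_Diff: "A \<in> \<A> \<Longrightarrow> B \<in> \<A> \<Longrightarrow> A - B \<in> incr_class \<A>"
  using incr_classI[of A "{B}"] by simp

lemma incr_class_Int:
  assumes "C \<in> incr_class \<A>" "D \<in> incr_class \<A>"
  shows "C \<inter> D \<in> incr_class \<A>"
proof -
  from assms obtain A F B G where *: "A \<in> \<A>" "finite F" "F \<subseteq> \<A>" "C = A - \<Union>F"
    "B \<in> \<A>" "finite G" "G \<subseteq> \<A>" "D = B - \<Union>G" by (elim incr_classE)
  have "C \<inter> D = A \<inter> B - \<Union>(F \<union> G)" using * by auto
  then show ?thesis using * incr_classI[of "A \<inter> B" "F \<union> G"] Int_mem by auto
qed

text \<open>A point avoids \<open>B - \<Union>G\<close> either by lying outside \<open>B\<close> or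
  by lying in some member of \<open>G\<close>; each alternative cuts a set of
  \<open>incr_class \<A>\<close> out of \<open>C\<close>.\<close>

lemma incr_class_Diff_incr_class:
  assumes "C \<in> incr_class \<A>" "D \<in> incr_class \<A>"
  shows "C - D \<in> finite_unions (incr_class \<A>)"
proof -
  from assms obtain A F B G where *: "A \<in> \<A>" "finite F" "F \<subseteq> \<A>" "C = A - \<Union>F"
    "B \<in> \<A>" "finite G" "G \<subseteq> \<A>" "D = B - \<Union>G" by (elim incr_classE)
  have "C - D = (A - \<Union>(insert B F)) \<union> (\<Union>E\<in>G. A \<inter> E - \<Union>F)"
    using * by auto
  also have "\<dots> \<in> finite_unions (incr_class \<A>)"
    using * by (intro finite_unions_Un finite_unions_UN finite_unions_base incr_classI Int_mem) auto
  finally show ?thesis .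
qed

lemma finite_unions_incr_class_Diff:
  assumes "R \<in> finite_unions (incr_class \<A>)" "finite F" "F \<subseteq> incr_class \<A>"
  shows "R - \<Union>F \<in> finite_unions (incr_class \<A>)"
  using assms(2,3,1)
proof (induction F arbitrary: R rule: finite_induct)
  case (insert D F)
  then obtain G where G: "finite G" "G \<subseteq> incr_class \<A>" "R = \<Union>G"
    unfolding finite_unions_def by blast
  have "R - D = (\<Union>C\<in>G. C - D)" using G by auto
  also have "\<dots> \<in> finite_unions (incr_class \<A>)"
    using G insert.prems by (intro finite_unions_UN incr_class_Diff_incr_class) auto
  finally have "(R - D) - \<Union>F \<in> finite_unions (incr_class \<A>)"
    using insert by auto
  moreover have "(R - D) - \<Union>F = R - \<Union>(insert D F)" by auto
  ultimately show ?case by simp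
qed auto

text \<open>Two passes: agreement spreads from \<open>\<A>\<close> to \<open>incr_class \<A>\<close>
  through differences, and then to finite unions, because \<open>incr_class \<A>\<close> is again
  intersection-stable.\<close>

lemma additive_agree:
  fixes g g' :: "'t set \<Rightarrow> real"
  assumes "Measure_Space.additive (finite_unions (incr_class \<A>)) g"
    "Measure_Space.additive (finite_unions (incr_class \<A>)) g'"
    and "\<And>A. A \<in> \<A> \<Longrightarrow> g A = g' A" and "C \<in> finite_unions (incr_class \<A>)"
  shows "g C = g' C"
proof -
  obtain F where F: "finite F" "F \<subseteq> incr_class \<A>" "C = \<Union>F"
    using assms(4) unfolding finite_unions_def by blast
  have "g D = g' D" if "D \<in> incr_class \<A>" for D
    using that
    by (elim incr_classE)
      (auto intro!: additive_agree_Diff_Union[OF assms(1-3), of \<A>] finite_unions_base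
        intro: incr_classI Int_mem)
  then show ?thesis
    unfolding F(3)
    by (intro additive_agree_Union[OF assms(1,2), of "incr_class \<A>"] F finite_unionsI
        finite_unions_incr_class_Diff finite_unions_base incr_class_Int)
qed

section \<open>Existence of the additive extension by linear extension on indicators\<close>

text \<open>
  The indicators of distinct non-empty members of \<open>\<A>\<close> are linearly independent: by \<open>shape\<close> a
  maximal one is not covered by the others.
\<close>

lemma indicator_independent:
  fixes h :: "'t set \<Rightarrow> real"
  assumes "finite F" "F \<subseteq> \<A>" "h {} = 0" "\<And>t. (\<Sum>A\<in>F. c A * indicator A t) = (0::real)"
  shows "(\<Sum>A\<in>F. c A * h A) = 0"
  using assms(1,2,4)
proof (induction "card F" arbitrary: F)
  case 0
  then show ?case by simp
next
  case (Suc n)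
  show ?case
  \<comment> \<open>The empty set has indicator 0, so its coefficient is unconstrained and only
    \<open>h {} = 0\<close> removes its term. A maximal set is therefore sought among the nonempty
    ones.\<close>
  proof (cases "F \<subseteq> {{}}")
    case True
    then show ?thesis using assms(3) by (auto intro!: sum.neutral)
  next
    case False
    then have "finite (F - {{}})" "F - {{}} \<noteq> {}" using Suc.prems by auto
    then obtain A where A: "A \<in> F - {{}}" "\<And>B. B \<in> F - {{}} \<Longrightarrow> A \<subseteq> B \<Longrightarrow> A = B"
      by (meson finite_has_maximal)
    have "\<not> A \<subseteq> \<Union>(F - {A})"
    proof
      assume cov: "A \<subseteq> \<Union>(F - {A})"
      then have "F - {A} \<noteq> {}" using A(1) by auto
      then obtain B where "B \<in> F - {A}" "A \<subseteq> B"
        using shape[of A "F - {A}"] cov A(1) Suc.prems by auto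
      then show False using A by auto
    qed
    then obtain t where t: "t \<in> A" "t \<notin> \<Union>(F - {A})" by auto
    have "0 = (\<Sum>B\<in>F. c B * indicator B t)" using Suc.prems by simp
    also have "\<dots> = c A * indicator A t + (\<Sum>B\<in>F - {A}. c B * indicator B t)"
      using A(1) Suc.prems by (intro sum.remove) auto
    also have "(\<Sum>B\<in>F - {A}. c B * indicator B t) = 0"
      using t by (intro sum.neutral) (auto simp: indicator_def)
    finally have cA: "c A = 0" using t by simp
    have *: "(\<Sum>B\<in>F. c B * g B) = (\<Sum>B\<in>F - {A}. c B * g B)" for g :: "'t set \<Rightarrow> real"
      using sum.remove[of F A "\<lambda>B. c B * g B"] A(1) Suc.prems cA by auto
    have "(\<Sum>B\<in>F - {A}. c B * h B) = 0"
      using Suc A(1) by (intro Suc.hyps(1)) (auto simp: *[symmetric])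
    then show ?thesis using * by simp
  qed
qed

text \<open>The difference of the two derivations represents the zero function, so
  \<open>indicator_independent\<close> annihilates it. This makes the linear extension of
  \<open>h\<close> well defined.\<close>

lemma elementary_integral_unique:
  assumes "h {} = 0" "elementary_integral \<A> (\<lambda>A _. h A) s v" "elementary_integral \<A> (\<lambda>A _. h A) s v'"
  shows "v = v'"
proof -
  obtain F c where F: "finite F" "F \<subseteq> \<A>" "\<forall>t. s t - s t = (\<Sum>A\<in>F. c A * indicator A t)"
    "\<forall>w. v w - v' w = (\<Sum>A\<in>F. c A * h A)"
    using elementary_integral_sum_form[OF elementary_integral_diff[OF assms(2,3)]] by blast
  have "(\<Sum>A\<in>F. c A * h A) = 0"
      proof (rule indicator_independent[where h=h, OF F(1,2) assms(1)])
      show "(\<Sum>A\<in>F. c A * indicator A t) = 0" for t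
        using F(3)[rule_format, of t, symmetric] by (simp only: diff_self)
    qed
  then have "v w - v' w = 0" for w using F(4) by simp
  then have "v w = v' w" for w by (subst eq_iff_diff_eq_0) blast
  then show ?thesis by (rule ext)
qed

text \<open>Inclusion-exclusion inside the algebra of elementary integrands: the indicator of a
  union of two sets is their sum minus their product, that of \<open>A - U\<close> is the indicator
  of \<open>A\<close> minus its product with that of \<open>U\<close>.\<close>

lemma elementary_integral_incr_class:
  assumes "C \<in> finite_unions (incr_class \<A>)"
  shows "\<exists>v. elementary_integral \<A> X (indicator C) v"
proof -
  note mult = elementary_integral_mult[of \<A>, OF Int_mem]
  \<comment> \<open>Stated for any finite family with elementary indicators, since it serves twice:
    for unions of members of \<open>\<A>\<close> and for unions of members of
    \<open>incr_class \<A>\<close>.\<close>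
  have un: "\<exists>v. elementary_integral \<A> X (indicator (\<Union>F)) v"
    if "finite F" "\<And>C. C \<in> F \<Longrightarrow> \<exists>v. elementary_integral \<A> X (indicator C) v" for F
    using that
  proof (induction F rule: finite_induct)
    case empty
    show ?case using zero[of \<A> X] by auto
  next
    case (insert D F)
    obtain v where v1: "elementary_integral \<A> X (indicator (\<Union>F)) v"
      using insert.IH insert.prems by blast
    obtain v' where v2: "elementary_integral \<A> X (indicator D) v'" using insert.prems by blast
    note v = v1 v2
    obtain u where u: "elementary_integral \<A> X (\<lambda>t. indicator (\<Union>F) t * indicator D t) u"
      using mult[OF _ _ v] by blast
    show ?case
      by (intro exI, rule elementary_integral_cong[OF elementary_integral_diff[OF
          elementary_integral_add[OF v] u]]) (auto simp: indicator_def)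
  qed
  have "\<exists>v. elementary_integral \<A> X (indicator D) v" if D: "D \<in> incr_class \<A>" for D
  proof -
    obtain A F where A: "A \<in> \<A>" "finite F" "F \<subseteq> \<A>" "D = A - \<Union>F"
      using D by (rule incr_classE)
    have "\<exists>v. elementary_integral \<A> X (indicator C) v" if "C \<in> F" for C
      using elementary_integral_indicator[of C] that A(3) by blast
    then obtain v where v: "elementary_integral \<A> X (indicator (\<Union>F)) v"
      using un[OF A(2)] by blast
    note a = elementary_integral_indicator[OF A(1), of X]
    obtain u where u: "elementary_integral \<A> X (\<lambda>t. indicator A t * indicator (\<Union>F) t) u"
      using mult[OF _ _ a v] by blast
    show ?thesis
      by (intro exI, rule elementary_integral_cong[OF elementary_integral_diff[OF a u]])
        (auto simp: indicator_def A(4))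
  qed
  note 1 = this
  obtain F where F: "finite F" "F \<subseteq> incr_class \<A>" "C = \<Union>F"
    using assms unfolding finite_unions_def by blast
  show ?thesis unfolding F(3) using 1 F(2) by (intro un[OF F(1)]) blast
qed

text \<open>Gives the definite description in \<open>increment\<close> its meaning: existence by
  evaluating the linear extension of \<open>h\<close> at indicators, uniqueness by
  \<open>additive_agree\<close> together with extensionality.\<close>

lemma increment_extends:
  assumes "h {} = 0"
  shows "Measure_Space.additive (finite_unions (incr_class \<A>)) (increment \<A> h)"
    and "A \<in> \<A> \<Longrightarrow> increment \<A> h A = h A"
proof -
  let ?M = "finite_unions (incr_class \<A>)"
  let ?I = "elementary_integral \<A> (\<lambda>A (_::unit). h A)"
  \<comment> \<open>Over the one-point space the elementary integral is the linear extension of \<open>h\<close>.\<close>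
  define g where "g = restrict (\<lambda>C. (THE v. ?I (indicator C) v) ()) ?M"
  have val: "g C = v ()" if "C \<in> ?M" "?I (indicator C) v" for C v
  proof -
    have "(THE v. ?I (indicator C) v) = v"
    proof (rule the_equality)
      fix v' assume "?I (indicator C) v'"
      from elementary_integral_unique[where h=h, OF assms this that(2)] show "v' = v" .
    qed (rule that(2))
    then show ?thesis using that(1) unfolding g_def by simp
  qed
  have "Measure_Space.additive ?M g"
    unfolding Measure_Space.additive_def
  proof (intro ballI impI)
    fix C D assume CD: "C \<in> ?M" "D \<in> ?M" "C \<inter> D = {}"
    obtain v v' where v: "?I (indicator C) v" "?I (indicator D) v'"
      using elementary_integral_incr_class CD by blast
    have "?I (indicator (C \<union> D)) (\<lambda>w. v w + v' w)"
      using CD(3) by (intro elementary_integral_cong[OF elementary_integral_add[OF v]])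
        (auto simp: indicator_def)
    then have "g (C \<union> D) = v () + v' ()"
      by (rule val[OF finite_unions_Un[OF CD(1,2)]])
    also have "v () = g C" by (rule val[OF CD(1) v(1), symmetric])
    also have "v' () = g D" by (rule val[OF CD(2) v(2), symmetric])
    finally show "g (C \<union> D) = g C + g D" .
  qed
  moreover have "g A = h A" if "A \<in> \<A>" for A
    by (rule val[OF finite_unions_base[OF incr_class_base[OF that]]
        elementary_integral_indicator[OF that]])
  moreover have "g \<in> extensional ?M" unfolding g_def by (rule restrict_extensional)
  ultimately have g: "g \<in> extensional ?M \<and> Measure_Space.additive ?M g \<and> (\<forall>A\<in>\<A>. g A = h A)"
    by blast
  have "\<exists>!g. g \<in> extensional ?M \<and> Measure_Space.additive ?M g \<and> (\<forall>A\<in>\<A>. g A = h A)"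
  proof (rule ex1I)
    show "g \<in> extensional ?M \<and> Measure_Space.additive ?M g \<and> (\<forall>A\<in>\<A>. g A = h A)" by (rule g)
  next
    fix g' assume g': "g' \<in> extensional ?M \<and> Measure_Space.additive ?M g' \<and> (\<forall>A\<in>\<A>. g' A = h A)"
    show "g' = g"
    proof (rule extensionalityI[of _ ?M])
      show "g' C = g C" if "C \<in> ?M" for C
      proof (rule additive_agree[OF _ _ _ that])
        show "g' A = g A" if "A \<in> \<A>" for A
        proof -
          have "g' A = h A" using g' that by blast
          also have "h A = g A" using g that by simp
          finally show ?thesis .
        qed
      qed (use g g' in blast)+
    qed (use g g' in blast)+
  qed
  from theI'[OF this] have "Measure_Space.additive ?M (increment \<A> h) \<and> (\<forall>A\<in>\<A>. increment \<A> h A = h A)"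
    unfolding increment_def by (rule conjunct2)
  then show "Measure_Space.additive ?M (increment \<A> h)"
    and "A \<in> \<A> \<Longrightarrow> increment \<A> h A = h A"
    by simp_all
qed

lemma increment_Diff:
  assumes "h {} = 0" "A \<in> \<A>" "B \<in> \<A>"
  shows "increment \<A> h (A - B) = h A - h (A \<inter> B)"
proof -
  have "A - B \<in> finite_unions (incr_class \<A>)" "A \<inter> B \<in> finite_unions (incr_class \<A>)"
    using assms(2,3) finite_unions_base[OF incr_class_Diff] finite_unions_base[OF incr_class_base[OF Int_mem]]
    by blast+
  moreover have "(A - B) \<inter> (A \<inter> B) = {}" by blast
  ultimately have "increment \<A> h ((A - B) \<union> (A \<inter> B)) = increment \<A> h (A - B) + increment \<A> h (A \<inter> B)"
    using increment_extends(1)[where h=h, OF assms(1)]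
    unfolding Measure_Space.additive_def by blast
  moreover have "(A - B) \<union> (A \<inter> B) = A" by auto
  ultimately show ?thesis
    using increment_extends(2)[where h=h, OF assms(1)] Int_mem assms(2,3) by simp
qed

end

section \<open>Moments from the Levy-Khintchine formula\<close>

lemma tendsto_if_norm_diff_le:
  fixes f :: "nat \<Rightarrow> 'a::real_normed_vector"
  assumes "\<And>n. norm (f n - l) \<le> g n" "g \<longlonglongrightarrow> 0"
  shows "f \<longlonglongrightarrow> l"
  by (rule LIM_zero_cancel, rule Lim_null_comparison[OF _ assms(2)]) (simp add: assms(1))

lemma iexp_second_order_bound: "cmod (iexp x - 1 - \<i> * of_real x) \<le> x\<^sup>2 / 2"
  using iexp_approx1[of x 1] by (simp add: power2_eq_square algebra_simps)

lemma iexp_third_order_bound: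
  "cmod (iexp x - 1 - \<i> * of_real x + of_real (x\<^sup>2 / 2)) \<le> \<bar>x\<bar> ^ 3 / 6"
  using iexp_approx1[of x 2]
  by (simp add: numeral_2_eq_2 numeral_3_eq_3 fact_Suc power_mult_distrib algebra_simps)

text \<open>Dominated convergence: the third-order bound gives the pointwise limit, the second-order
  bound the majorant \<open>(u x)\<^sup>2 / 2\<close>. The compensator stays inside the integral
  because \<open>M\<close> may be infinite, as a Levy measure can be, and the separate terms need
  not be integrable.\<close>

lemma second_order_limit:
  fixes u :: "'a \<Rightarrow> real"
  assumes u[measurable]: "u \<in> borel_measurable M" and sq: "integrable M (\<lambda>x. (u x)\<^sup>2)"
    and r: "r \<longlonglongrightarrow> 0" "\<And>n. r n \<noteq> (0::real)"
  shows "(\<lambda>n. (CLINT x|M. iexp (r n * u x) - 1 - \<i> * of_real (r n * u x)) / of_real ((r n)\<^sup>2))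
    \<longlonglongrightarrow> - of_real ((LINT x|M. (u x)\<^sup>2) / 2)"
proof -
  let ?f = "\<lambda>n x. (iexp (r n * u x) - 1 - \<i> * of_real (r n * u x)) / of_real ((r n)\<^sup>2)"
  have "(\<lambda>n. CLINT x|M. ?f n x) \<longlonglongrightarrow> (CLINT x|M. - of_real ((u x)\<^sup>2 / 2))"
  proof (rule integral_dominated_convergence)
    show "integrable M (\<lambda>x. (u x)\<^sup>2 / 2)" using sq by simp
    show "AE x in M. (\<lambda>n. ?f n x) \<longlonglongrightarrow> - of_real ((u x)\<^sup>2 / 2)"
    proof (intro AE_I2)
      fix x
      have "norm (?f n x - (- of_real ((u x)\<^sup>2 / 2))) \<le> \<bar>r n\<bar> * \<bar>u x\<bar> ^ 3 / 6" for n
      proof -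
        have "?f n x - (- of_real ((u x)\<^sup>2 / 2)) =
            (iexp (r n * u x) - 1 - \<i> * of_real (r n * u x) + of_real ((r n * u x)\<^sup>2 / 2)) /
            of_real ((r n)\<^sup>2)"
          using r(2)[of n] by (simp add: field_simps power_mult_distrib)
        then have "norm (?f n x - (- of_real ((u x)\<^sup>2 / 2))) =
            norm (iexp (r n * u x) - 1 - \<i> * of_real (r n * u x) + of_real ((r n * u x)\<^sup>2 / 2)) /
            (r n)\<^sup>2"
          by (simp add: norm_divide norm_power)
        also have "\<dots> \<le> (\<bar>r n * u x\<bar> ^ 3 / 6) / (r n)\<^sup>2"
          by (intro divide_right_mono iexp_third_order_bound) simp
        also have "\<dots> = \<bar>r n\<bar> * \<bar>u x\<bar> ^ 3 / 6"
          using r(2)[of n] by (simp add: abs_mult power_mult_distrib field_simps power2_eq_square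
              power3_eq_cube)
        finally show ?thesis .
      qed
      moreover have "(\<lambda>n. \<bar>r n\<bar> * \<bar>u x\<bar> ^ 3 / 6) \<longlonglongrightarrow> 0"
        using r(1) by (auto intro!: tendsto_eq_intros)
      ultimately show "(\<lambda>n. ?f n x) \<longlonglongrightarrow> - of_real ((u x)\<^sup>2 / 2)"
        by (rule tendsto_if_norm_diff_le)
    qed
    show "AE x in M. norm (?f n x) \<le> (u x)\<^sup>2 / 2" for n
    proof (intro AE_I2)
      fix x
      have "norm (?f n x) = norm (iexp (r n * u x) - 1 - \<i> * of_real (r n * u x)) / (r n)\<^sup>2"
        by (simp add: norm_divide norm_power)
      also have "\<dots> \<le> ((r n * u x)\<^sup>2 / 2) / (r n)\<^sup>2"
        by (intro divide_right_mono iexp_second_order_bound) simp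
      also have "\<dots> = (u x)\<^sup>2 / 2" using r(2)[of n] by (simp add: power_mult_distrib)
      finally show "norm (?f n x) \<le> (u x)\<^sup>2 / 2" .
    qed
  qed measurable
  moreover have "(CLINT x|M. - of_real ((u x)\<^sup>2 / 2)) = - of_real ((LINT x|M. (u x)\<^sup>2) / 2)"
    using integral_complex_of_real[of M "\<lambda>x. - ((u x)\<^sup>2 / 2)"] by simp
  moreover have "(CLINT x|M. ?f n x) =
      (CLINT x|M. iexp (r n * u x) - 1 - \<i> * of_real (r n * u x)) / of_real ((r n)\<^sup>2)" for n
    by (rule integral_divide_zero)
  ultimately show ?thesis by simp
qed

text \<open>Comparison of coefficients along a null sequence. \<open>B\<close> and \<open>Q\<close>
  are only convergent, not constant, because the exponent and the characteristic function are
  themselves known only up to second order.\<close>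

lemma exp_second_order_match:
  fixes \<alpha> \<beta> \<gamma> p :: complex
  assumes r: "r \<longlonglongrightarrow> 0" "\<And>n. r n \<noteq> (0::complex)" and B: "B \<longlonglongrightarrow> \<beta>" and Q: "Q \<longlonglongrightarrow> p"
    and eq: "\<And>n. exp (\<alpha> * r n + B n * (r n)\<^sup>2) = 1 + \<gamma> * r n + Q n * (r n)\<^sup>2"
  shows "\<gamma> = \<alpha>" "p = \<beta> + \<alpha>\<^sup>2 / 2"
proof -
  define w where "w n = \<alpha> + B n * r n" for n
  define R where "R n = (exp (w n * r n) - 1 - w n * r n - (w n * r n)\<^sup>2 / 2) / (r n)\<^sup>2" for n
  have w: "w \<longlonglongrightarrow> \<alpha>" unfolding w_def using r(1) B by (auto intro!: tendsto_eq_intros)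
  have wr: "(\<lambda>n. w n * r n) \<longlonglongrightarrow> 0" using w r(1) by (auto intro!: tendsto_eq_intros)
  have eq': "exp (w n * r n) = 1 + \<gamma> * r n + Q n * (r n)\<^sup>2" for n
    using eq[of n] by (simp add: w_def algebra_simps power2_eq_square)
  have "norm (R n) \<le> exp \<bar>Re (w n * r n)\<bar> * norm (w n) ^ 3 * norm (r n) / 2" for n
  proof -
    have "norm (exp (w n * r n) - 1 - w n * r n - (w n * r n)\<^sup>2 / 2) \<le>
        exp \<bar>Re (w n * r n)\<bar> * norm (w n * r n) ^ 3 / 2"
      using Taylor_exp[of "w n * r n" 2]
      by (simp add: numeral_2_eq_2 numeral_3_eq_3 fact_Suc algebra_simps)
    then have "norm (R n) \<le> (exp \<bar>Re (w n * r n)\<bar> * norm (w n * r n) ^ 3 / 2) / norm (r n) ^ 2"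
      unfolding R_def norm_divide norm_power by (intro divide_right_mono) auto
    also have "\<dots> = exp \<bar>Re (w n * r n)\<bar> * norm (w n) ^ 3 * norm (r n) / 2"
      using r(2)[of n] by (simp add: norm_mult power_mult_distrib field_simps power2_eq_square
          power3_eq_cube)
    finally show ?thesis .
  qed
  moreover have "(\<lambda>n. exp \<bar>Re (w n * r n)\<bar> * norm (w n) ^ 3 * norm (r n) / 2) \<longlonglongrightarrow> 0"
  proof -
    have "(\<lambda>n. exp \<bar>Re (w n * r n)\<bar> * norm (w n) ^ 3 * norm (r n) / 2) \<longlonglongrightarrow>
        exp \<bar>Re 0\<bar> * norm \<alpha> ^ 3 * norm (0::complex) / 2"
      by (intro tendsto_intros wr w r(1)) auto
    then show ?thesis by simp
  qed
  ultimately have R: "R \<longlonglongrightarrow> 0"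
    by (intro tendsto_if_norm_diff_le[of R 0]) (simp_all only: diff_zero)
  \<comment> \<open>\<open>S\<close> gathers all second-order terms, so that
    \<open>\<gamma> - \<alpha> = r n * S n\<close> holds exactly. As \<open>S\<close> converges, the
    left side is 0; then \<open>S\<close> is identically 0, and its limit yields the second
    identity.\<close>
  define S where "S n = R n + (w n)\<^sup>2 / 2 + B n - Q n" for n
  have S: "S \<longlonglongrightarrow> \<alpha>\<^sup>2 / 2 + \<beta> - p"
    unfolding S_def using R w B Q by (auto intro!: tendsto_eq_intros)
  have id: "\<gamma> - \<alpha> = r n * S n" for n
  proof -
    have "R n * (r n)\<^sup>2 = \<gamma> * r n + Q n * (r n)\<^sup>2 - w n * r n - (w n * r n)\<^sup>2 / 2"
      unfolding R_def eq' using r(2)[of n] by simp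
    then have "(\<gamma> - \<alpha>) * r n = (r n * S n) * r n"
      unfolding S_def w_def by (simp add: field_simps power2_eq_square)
    then show ?thesis using r(2)[of n] by simp
  qed
  have "(\<lambda>n. r n * S n) \<longlonglongrightarrow> 0" using tendsto_mult[OF r(1) S] by simp
  then have "(\<lambda>n::nat. \<gamma> - \<alpha>) \<longlonglongrightarrow> 0" by (simp only: id[symmetric])
  then show \<gamma>: "\<gamma> = \<alpha>" by (simp add: LIMSEQ_const_iff)
  then have "S n = 0" for n using id[of n] r(2)[of n] by simp
  then have "S = (\<lambda>n. 0)" by (rule ext)
  with S have "(\<lambda>n::nat. 0) \<longlonglongrightarrow> \<alpha>\<^sup>2 / 2 + \<beta> - p" by simp
  then have "\<alpha>\<^sup>2 / 2 + \<beta> - p = 0" by (simp add: LIMSEQ_const_iff)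
  then show "p = \<beta> + \<alpha>\<^sup>2 / 2" by (simp add: algebra_simps)
qed

text \<open>The estimate -ln(1 - x) \<le> 2 x on [0, 1/2], read off from 1 + y \<le> e^y \<le> 1/(1
  - x) \<le> 1 + 2 x. It converts a lower bound on the modulus of a characteristic function into an
  upper bound on its exponent.\<close>

lemma le_double_if_exp_minus_ge:
  fixes x y :: real
  assumes "0 \<le> x" "x \<le> 1 / 2" "1 - x \<le> exp (- y)"
  shows "y \<le> 2 * x"
proof -
  have "1 + y \<le> exp y" by (rule exp_ge_add_one_self)
  also have "exp y = 1 / exp (- y)" by (simp add: exp_minus field_simps)
  also have "\<dots> \<le> 1 / (1 - x)" using assms by (intro divide_left_mono) auto
  also have "\<dots> \<le> 1 + 2 * x"
  proof -
    have "x * (2 * x) \<le> x * 1" using assms by (intro mult_left_mono) auto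
    then have "1 \<le> (1 + 2 * x) * (1 - x)" by (simp add: algebra_simps)
    then show ?thesis using assms by (simp add: field_simps)
  qed
  finally show ?thesis by simp
qed

section \<open>The second moment of the Levy measure and the moments of the process\<close>

context
  fixes \<nu> :: "real measure"
  assumes sets_nu[measurable_cong]: "sets \<nu> = sets borel"
    and nu_finite: "(\<integral>\<^sup>+x. ennreal (min 1 (x\<^sup>2)) \<partial>\<nu>) < \<infinity>"
begin

lemma integrable_min_one_square: "integrable \<nu> (\<lambda>x. min 1 (x\<^sup>2))"
  using nu_finite by (intro integrableI_bounded) auto

text \<open>Small jumps are controlled by the second-order Taylor bound, large ones by the modulus
  bound 2; the factor \<open>2 + \<xi>\<^sup>2\<close> serves both ranges.\<close>

lemma integrable_levy_integrand:
  "complex_integrable \<nu>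
    (\<lambda>x. iexp (\<xi> * x) - 1 - \<i> * of_real (\<xi> * x * indicator {x. \<bar>x\<bar> \<le> 1} x))"
proof (rule Bochner_Integration.integrable_bound)
  show "integrable \<nu> (\<lambda>x. (2 + \<xi>\<^sup>2) * min 1 (x\<^sup>2))"
    using integrable_min_one_square by simp
  show "AE x in \<nu>. cmod (iexp (\<xi> * x) - 1 - \<i> * of_real (\<xi> * x * indicator {x. \<bar>x\<bar> \<le> 1} x))
      \<le> norm ((2 + \<xi>\<^sup>2) * min 1 (x\<^sup>2))"
  proof (intro AE_I2)
    fix x :: real
    show "cmod (iexp (\<xi> * x) - 1 - \<i> * of_real (\<xi> * x * indicator {x. \<bar>x\<bar> \<le> 1} x))
      \<le> norm ((2 + \<xi>\<^sup>2) * min 1 (x\<^sup>2))"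
    proof (cases "\<bar>x\<bar> \<le> 1")
      case True
      then have x1: "x\<^sup>2 \<le> 1" by (simp add: abs_square_le_1)
      have "cmod (iexp (\<xi> * x) - 1 - \<i> * of_real (\<xi> * x)) \<le> (\<xi> * x)\<^sup>2 / 2"
        by (rule iexp_second_order_bound)
      also have "\<dots> \<le> (2 + \<xi>\<^sup>2) * x\<^sup>2"
        by (simp add: power_mult_distrib algebra_simps)
      finally show ?thesis using True x1 by (simp add: min_def)
    next
      case False
      then have x1: "1 \<le> x\<^sup>2" using abs_square_le_1[of x] by linarith
      have "cmod (iexp (\<xi> * x) - 1) \<le> 2"
        using norm_triangle_ineq4[of "iexp (\<xi> * x)" 1] by simp
      also have "\<dots> \<le> 2 + \<xi>\<^sup>2" by simp
      finally show ?thesis using False x1 by (simp add: min_def)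
    qed
  qed
qed measurable

text \<open>Drift and compensator are purely imaginary and drop out. What remains has a nonnegative
  integrand, to which Fatou's lemma applies before any moment of \<open>\<nu>\<close> is
  known.\<close>

lemma Re_levy_exponent:
  "integrable \<nu> (\<lambda>x. 1 - cos (\<xi> * x))"
  "Re (levy_exponent b \<sigma>2 \<nu> \<xi>) = - (\<sigma>2 * \<xi>\<^sup>2 / 2) - (LINT x|\<nu>. 1 - cos (\<xi> * x))"
proof -
  note i = integrable_levy_integrand[of \<xi>]
  have re: "Re (iexp (\<xi> * x) - 1 - \<i> * of_real (\<xi> * x * indicator {x. \<bar>x\<bar> \<le> 1} x)) =
      - (1 - cos (\<xi> * x))" for x
    by (simp add: Re_exp)
  have "integrable \<nu> (\<lambda>x. - (1 - cos (\<xi> * x)))"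
    using integrable_Re[OF i] unfolding re .
  then show "integrable \<nu> (\<lambda>x. 1 - cos (\<xi> * x))"
    using Bochner_Integration.integrable_minus[of \<nu> "\<lambda>x. - (1 - cos (\<xi> * x))"] by simp
  show "Re (levy_exponent b \<sigma>2 \<nu> \<xi>) = - (\<sigma>2 * \<xi>\<^sup>2 / 2) - (LINT x|\<nu>. 1 - cos (\<xi> * x))"
    using integral_Re[OF i] unfolding re Bochner_Integration.integral_minus levy_exponent_def
    by (simp only: plus_complex.sel minus_complex.sel) simp
qed

text \<open>Let q be the second moment of \<open>Y\<close>. The real part of the characteristic
  function is at least 1 - \<xi>^2 q / 2, and its modulus is governed by the real part of the
  exponent. Hence the integral of 1 - cos(\<xi> x) against \<open>\<nu>\<close> is at most \<xi>^2 q
  / c for small \<xi>; after division by \<xi>^2, Fatou's lemma bounds the integral of x^2 / 2 by q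
  / c.\<close>

lemma levy_measure_second_moment_finite:
  fixes M :: "'a measure" and Y :: "'a \<Rightarrow> real"
  assumes M: "prob_space M" and [measurable]: "Y \<in> borel_measurable M" and sq: "integrable M (\<lambda>w. (Y w)\<^sup>2)"
    and c: "0 < c" and \<sigma>: "0 \<le> \<sigma>2"
    and chf: "\<And>\<xi>. (CLINT w|M. iexp (\<xi> * Y w)) = exp (of_real c * levy_exponent b \<sigma>2 \<nu> \<xi>)"
  shows "(\<integral>\<^sup>+x. ennreal (x\<^sup>2) \<partial>\<nu>) < \<infinity>"
proof -
  interpret prob_space M by (rule M)
  define q where "q = (LINT w|M. (Y w)\<^sup>2)"
  have q: "0 \<le> q" unfolding q_def by simp
  \<comment> \<open>The restriction keeps \<xi>^2 q / 2 within [0, 1/2], the range of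
    \<open>le_double_if_exp_minus_ge\<close>.\<close>
  have main: "(LINT x|\<nu>. 1 - cos (\<xi> * x)) \<le> \<xi>\<^sup>2 * q / c" if "\<xi>\<^sup>2 * q \<le> 1" for \<xi>
  proof -
    let ?J = "LINT x|\<nu>. 1 - cos (\<xi> * x)"
    have int: "complex_integrable M (\<lambda>w. iexp (\<xi> * Y w))"
      by (intro integrable_const_bound[where B=1]) auto
    have cosint: "integrable M (\<lambda>w. cos (\<xi> * Y w))"
      by (intro integrable_const_bound[where B=1]) auto
    have "1 - \<xi>\<^sup>2 * q / 2 = (LINT w|M. 1 - \<xi>\<^sup>2 * (Y w)\<^sup>2 / 2)"
      using sq by (simp add: q_def prob_space)
    also have "\<dots> \<le> (LINT w|M. cos (\<xi> * Y w))"
    proof (intro integral_mono cosint)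
      show "integrable M (\<lambda>w. 1 - \<xi>\<^sup>2 * (Y w)\<^sup>2 / 2)" using sq by simp
      show "1 - \<xi>\<^sup>2 * (Y w)\<^sup>2 / 2 \<le> cos (\<xi> * Y w)" for w
        using abs_Re_le_cmod[of "iexp (\<xi> * Y w) - 1 - \<i> * of_real (\<xi> * Y w)"]
          iexp_second_order_bound[of "\<xi> * Y w"]
        by (simp add: Re_exp power_mult_distrib)
    qed
    also have "\<dots> = Re (CLINT w|M. iexp (\<xi> * Y w))"
      using integral_Re[OF int] by (simp add: Re_exp)
    also have "\<dots> \<le> cmod (CLINT w|M. iexp (\<xi> * Y w))"
      by (rule complex_Re_le_cmod)
    also have "\<dots> = exp (- (c * (\<sigma>2 * \<xi>\<^sup>2 / 2 + ?J)))"
      unfolding chf by (simp add: Re_levy_exponent(2) algebra_simps)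
    finally have "c * (\<sigma>2 * \<xi>\<^sup>2 / 2 + ?J) \<le> 2 * (\<xi>\<^sup>2 * q / 2)"
      using q that by (intro le_double_if_exp_minus_ge) auto
    moreover have "c * ?J \<le> c * (\<sigma>2 * \<xi>\<^sup>2 / 2 + ?J)"
      using c \<sigma> by (intro mult_left_mono) auto
    ultimately show ?thesis using c by (simp add: field_simps)
  qed
  \<comment> \<open>The factor \<open>1 / sqrt (1 + q)\<close> puts the whole sequence into the
    range of \<open>main\<close> and is harmless for \<open>q = 0\<close>.\<close>
  define r where "r n = inverse (real (Suc n)) / sqrt (1 + q)" for n
  have r0: "0 < r n" for n using q by (simp add: r_def)
  have rlim: "r \<longlonglongrightarrow> 0"
    unfolding r_def using tendsto_divide[OF LIMSEQ_inverse_real_of_nat tendsto_const[of "sqrt (1 + q)"]] q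
    by simp
  have rq: "(r n)\<^sup>2 * q \<le> 1" for n
  proof -
    have "(r n)\<^sup>2 = (inverse (real (Suc n)))\<^sup>2 / (1 + q)" using q by (simp add: r_def power_divide)
    also have "\<dots> \<le> 1 / (1 + q)" using q by (intro divide_right_mono) (auto simp: field_simps)
    finally have "(r n)\<^sup>2 * q \<le> 1 / (1 + q) * q" using q by (intro mult_right_mono)
    also have "\<dots> \<le> 1" using q by simp
    finally show ?thesis .
  qed
  let ?u = "\<lambda>n x. ennreal ((1 - cos (r n * x)) / (r n)\<^sup>2)"
  have lim: "(\<lambda>n. ?u n x) \<longlonglongrightarrow> ennreal (x\<^sup>2 / 2)" for x
  proof (intro tendsto_ennrealI)
    have "norm ((1 - cos (r n * x)) / (r n)\<^sup>2 - x\<^sup>2 / 2) \<le> r n * \<bar>x\<bar> ^ 3 / 6" for n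
    proof -
      have "\<bar>cos (r n * x) - 1 + (r n * x)\<^sup>2 / 2\<bar> \<le> \<bar>r n * x\<bar> ^ 3 / 6"
        using order_trans[OF abs_Re_le_cmod iexp_third_order_bound[of "r n * x"]]
        by (simp add: Re_exp)
      then have "\<bar>cos (r n * x) - 1 + (r n * x)\<^sup>2 / 2\<bar> / (r n)\<^sup>2 \<le> (\<bar>r n * x\<bar> ^ 3 / 6) / (r n)\<^sup>2"
        by (intro divide_right_mono) auto
      moreover have "norm ((1 - cos (r n * x)) / (r n)\<^sup>2 - x\<^sup>2 / 2) =
          \<bar>cos (r n * x) - 1 + (r n * x)\<^sup>2 / 2\<bar> / (r n)\<^sup>2"
      proof -
        have "(1 - cos (r n * x)) / (r n)\<^sup>2 - x\<^sup>2 / 2 =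
            - ((cos (r n * x) - 1 + (r n * x)\<^sup>2 / 2) / (r n)\<^sup>2)"
          using r0[of n] by (simp add: field_simps power_mult_distrib)
        then show ?thesis by (simp only: real_norm_def abs_minus_cancel abs_divide abs_power2)
      qed
      moreover have "(\<bar>r n * x\<bar> ^ 3 / 6) / (r n)\<^sup>2 = r n * \<bar>x\<bar> ^ 3 / 6"
        using r0[of n] by (simp add: abs_mult power_mult_distrib field_simps power2_eq_square
              power3_eq_cube)
      ultimately show ?thesis by linarith
    qed
    moreover have "(\<lambda>n. r n * \<bar>x\<bar> ^ 3 / 6) \<longlonglongrightarrow> 0"
      using rlim by (auto intro!: tendsto_eq_intros)
    ultimately show "(\<lambda>n. (1 - cos (r n * x)) / (r n)\<^sup>2) \<longlonglongrightarrow> x\<^sup>2 / 2"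
      by (rule tendsto_if_norm_diff_le)
  qed
  have "(\<integral>\<^sup>+x. ennreal (x\<^sup>2 / 2) \<partial>\<nu>) = (\<integral>\<^sup>+x. liminf (\<lambda>n. ?u n x) \<partial>\<nu>)"
    by (intro nn_integral_cong lim_imp_Liminf[OF sequentially_bot lim, symmetric])
  also have "\<dots> \<le> liminf (\<lambda>n. \<integral>\<^sup>+x. ?u n x \<partial>\<nu>)"
    by (intro nn_integral_liminf) measurable
  also have "\<dots> \<le> liminf (\<lambda>n::nat. ennreal (q / c))"
  proof (intro Liminf_mono always_eventually allI)
    fix n
    have "(\<integral>\<^sup>+x. ?u n x \<partial>\<nu>) = ennreal (LINT x|\<nu>. (1 - cos (r n * x)) / (r n)\<^sup>2)"
      using Re_levy_exponent(1)[of "r n"] by (intro nn_integral_eq_integral) auto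
    also have "(LINT x|\<nu>. (1 - cos (r n * x)) / (r n)\<^sup>2) \<le> ((r n)\<^sup>2 * q / c) / (r n)\<^sup>2"
      by (simp only: integral_divide_zero) (intro divide_right_mono main rq zero_le_power2)
    also have "\<dots> = q / c" using r0[of n] by simp
    finally show "(\<integral>\<^sup>+x. ?u n x \<partial>\<nu>) \<le> ennreal (q / c)" by (simp add: ennreal_leI)
  qed
  also have "\<dots> = ennreal (q / c)" by (simp add: Liminf_const)
  finally have fin: "(\<integral>\<^sup>+x. ennreal (x\<^sup>2 / 2) \<partial>\<nu>) < \<infinity>"
    by (rule le_less_trans) simp
  have "(\<integral>\<^sup>+x. ennreal (x\<^sup>2) \<partial>\<nu>) = (\<integral>\<^sup>+x. 2 * ennreal (x\<^sup>2 / 2) \<partial>\<nu>)"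
    by (intro nn_integral_cong) (simp add: ennreal_mult'[symmetric] flip: ennreal_numeral)
  also have "\<dots> = 2 * (\<integral>\<^sup>+x. ennreal (x\<^sup>2 / 2) \<partial>\<nu>)"
    by (intro nn_integral_cmult) measurable
  also have "\<dots> < \<infinity>" using fin by (simp add: ennreal_mult_less_top)
  finally show ?thesis .
qed

text \<open>Since |x| \<le> x^2 for |x| > 1, the large jumps are now integrable, and compensating
  them as well moves their mean into the drift. The integrand then has the form required by
  \<open>second_order_limit\<close>.\<close>

lemma levy_exponent_centred:
  assumes sq: "integrable \<nu> (\<lambda>x. x\<^sup>2)"
  shows "levy_exponent b \<sigma>2 \<nu> \<xi> =
    \<i> * of_real ((b + (LINT x:{x. 1 < \<bar>x\<bar>}|\<nu>. x)) * \<xi>) - of_real (\<sigma>2 * \<xi>\<^sup>2 / 2) +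
    (CLINT x|\<nu>. iexp (\<xi> * x) - 1 - \<i> * of_real (\<xi> * x))"
proof -
  have large: "integrable \<nu> (\<lambda>x. indicator {x. 1 < \<bar>x\<bar>} x * x)"
  proof (rule Bochner_Integration.integrable_bound[OF sq])
    show "AE x in \<nu>. norm (indicator {x. 1 < \<bar>x\<bar>} x * x) \<le> norm (x\<^sup>2)"
    proof (intro AE_I2)
      fix x :: real
      have "\<bar>x\<bar> * 1 \<le> \<bar>x\<bar> * \<bar>x\<bar>" if "1 < \<bar>x\<bar>" using that by (intro mult_left_mono) auto
      then show "norm (indicator {x. 1 < \<bar>x\<bar>} x * x) \<le> norm (x\<^sup>2)"
        by (auto simp: indicator_def power2_eq_square abs_mult)
    qed
  qed measurable
  have "(CLINT x|\<nu>. iexp (\<xi> * x) - 1 - \<i> * of_real (\<xi> * x)) =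
      (CLINT x|\<nu>. (iexp (\<xi> * x) - 1 - \<i> * of_real (\<xi> * x * indicator {x. \<bar>x\<bar> \<le> 1} x)) -
        \<i> * of_real \<xi> * of_real (indicator {x. 1 < \<bar>x\<bar>} x * x))"
    by (intro Bochner_Integration.integral_cong) (auto simp: indicator_def algebra_simps)
  also have "\<dots> = (CLINT x|\<nu>. iexp (\<xi> * x) - 1 - \<i> * of_real (\<xi> * x * indicator {x. \<bar>x\<bar> \<le> 1} x)) -
      (CLINT x|\<nu>. \<i> * of_real \<xi> * of_real (indicator {x. 1 < \<bar>x\<bar>} x * x))"
    by (intro Bochner_Integration.integral_diff integrable_levy_integrand integrable_mult_right
        integrable_of_real large)
  also have "(CLINT x|\<nu>. \<i> * of_real \<xi> * of_real (indicator {x. 1 < \<bar>x\<bar>} x * x)) =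
      \<i> * of_real \<xi> * of_real (LINT x|\<nu>. indicator {x. 1 < \<bar>x\<bar>} x * x)"
    by (subst integral_mult_right_zero, subst integral_complex_of_real) (rule refl)
  also have "(LINT x|\<nu>. indicator {x. 1 < \<bar>x\<bar>} x * x) = (LINT x:{x. 1 < \<bar>x\<bar>}|\<nu>. x)"
    unfolding set_lebesgue_integral_def by simp
  finally show ?thesis unfolding levy_exponent_def by (simp add: algebra_simps)
qed

text \<open>\<open>second_order_limit\<close> is applied twice, on \<open>M\<close> to the
  characteristic function and on \<open>\<nu>\<close> to the centred exponent;
  \<open>exp_second_order_match\<close> then reads the mean off the first-order terms and the second
  moment off the second-order ones.\<close>

lemma levy_moments:
  fixes M :: "'a measure" and Y :: "'a \<Rightarrow> real" and b c \<sigma>2 :: real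
  defines "\<mu> \<equiv> b + (LINT x:{x. 1 < \<bar>x\<bar>}|\<nu>. x)"
  assumes M: "prob_space M" and [measurable]: "Y \<in> borel_measurable M" and sq: "integrable M (\<lambda>w. (Y w)\<^sup>2)"
    and nu_sq: "integrable \<nu> (\<lambda>x. x\<^sup>2)"
    and chf: "\<And>\<xi>. (CLINT w|M. iexp (\<xi> * Y w)) = exp (of_real c * levy_exponent b \<sigma>2 \<nu> \<xi>)"
  shows "(LINT w|M. Y w) = c * \<mu>"
    and "(LINT w|M. (Y w)\<^sup>2) = c * (\<sigma>2 + (LINT x|\<nu>. x\<^sup>2)) + (c * \<mu>)\<^sup>2"
proof -
  interpret prob_space M by (rule M)
  define r where "r n = inverse (real (Suc n))" for n
  have r: "r \<longlonglongrightarrow> 0" "r n \<noteq> 0" for n unfolding r_def by (rule LIMSEQ_inverse_real_of_nat) auto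
  define K where "K = (LINT x|\<nu>. x\<^sup>2)"
  define q where "q = (LINT w|M. (Y w)\<^sup>2)"
  define D where "D n = (CLINT x|\<nu>. iexp (r n * x) - 1 - \<i> * of_real (r n * x)) / of_real ((r n)\<^sup>2)" for n
  define Q where "Q n = (CLINT w|M. iexp (r n * Y w) - 1 - \<i> * of_real (r n * Y w)) / of_real ((r n)\<^sup>2)" for n
  have D: "D \<longlonglongrightarrow> - of_real (K / 2)"
    unfolding D_def K_def by (intro second_order_limit nu_sq r) auto
  have Q: "Q \<longlonglongrightarrow> - of_real (q / 2)"
    unfolding Q_def q_def by (intro second_order_limit sq r) auto
  have Y: "integrable M Y" using square_integrable_imp_integrable[of Y] sq by simp
  define B where "B n = of_real c * (- of_real (\<sigma>2 / 2) + D n)" for n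
  have eq: "exp ((\<i> * of_real (c * \<mu>)) * of_real (r n) + B n * (of_real (r n))\<^sup>2) =
      1 + (\<i> * of_real (expectation Y)) * of_real (r n) + Q n * (of_real (r n))\<^sup>2" for n
  proof -
    have "of_real c * levy_exponent b \<sigma>2 \<nu> (r n) =
        (\<i> * of_real (c * \<mu>)) * of_real (r n) + B n * (of_real (r n))\<^sup>2"
      unfolding levy_exponent_centred[OF nu_sq] B_def D_def \<mu>_def using r(2)[of n]
      by (simp add: field_simps)
    moreover have "(CLINT w|M. iexp (r n * Y w)) =
        1 + (\<i> * of_real (expectation Y)) * of_real (r n) + Q n * (of_real (r n))\<^sup>2"
    proof -
      have int: "complex_integrable M (\<lambda>w. iexp (r n * Y w))"
        by (intro integrable_const_bound[where B=1]) auto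
      have i1: "complex_integrable M (\<lambda>w. \<i> * of_real (r n) * of_real (Y w))"
        using Y by (intro integrable_mult_right integrable_of_real)
      have "(CLINT w|M. iexp (r n * Y w) - 1 - \<i> * of_real (r n * Y w)) =
          (CLINT w|M. iexp (r n * Y w) - 1 - \<i> * of_real (r n) * of_real (Y w))"
        by (intro Bochner_Integration.integral_cong) auto
      also have "\<dots> = (CLINT w|M. iexp (r n * Y w)) - 1 - \<i> * of_real (r n) * of_real (expectation Y)"
        using int i1 by (simp add: prob_space integral_of_real)
      finally show ?thesis unfolding Q_def using r(2)[of n] by (simp add: field_simps)
    qed
    ultimately show ?thesis using chf[of "r n"] by simp
  qed
  have B: "B \<longlonglongrightarrow> of_real c * (- of_real (\<sigma>2 / 2) + - of_real (K / 2))"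
    unfolding B_def by (intro tendsto_intros D)
  have rc: "(\<lambda>n. complex_of_real (r n)) \<longlonglongrightarrow> 0" "complex_of_real (r n) \<noteq> 0" for n
    using tendsto_of_real[OF r(1), where 'a=complex] r(2)[of n] by auto
  note match = exp_second_order_match[OF rc B Q eq]
  from match(1) show "(LINT w|M. Y w) = c * \<mu>"
    by (simp add: complex_eq_iff)
  have "complex_of_real (- (q / 2)) = of_real (c * (- (\<sigma>2 / 2) + - (K / 2)) - (c * \<mu>)\<^sup>2 / 2)"
    using match(2) by (simp add: power_mult_distrib)
  then have "- (q / 2) = c * (- (\<sigma>2 / 2) + - (K / 2)) - (c * \<mu>)\<^sup>2 / 2"
    by (rule of_real_eq_iff[THEN iffD1])
  then show "(LINT w|M. (Y w)\<^sup>2) = c * (\<sigma>2 + (LINT x|\<nu>. x\<^sup>2)) + (c * \<mu>)\<^sup>2"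
    unfolding q_def[symmetric] K_def[symmetric] by (simp add: algebra_simps)
qed

end

section \<open>The isometry on elementary integrands\<close>

lemma integrable_mult_if_square_integrable:
  fixes u v :: "'a \<Rightarrow> real"
  assumes [measurable]: "u \<in> borel_measurable M" "v \<in> borel_measurable M"
    and "integrable M (\<lambda>x. (u x)\<^sup>2)" "integrable M (\<lambda>x. (v x)\<^sup>2)"
  shows "integrable M (\<lambda>x. u x * v x)"
proof (rule Bochner_Integration.integrable_bound)
  show "integrable M (\<lambda>x. (u x)\<^sup>2 + (v x)\<^sup>2)" using assms by simp
  show "AE x in M. norm (u x * v x) \<le> norm ((u x)\<^sup>2 + (v x)\<^sup>2)"
  proof (intro AE_I2)
    fix x
    have "2 * \<bar>u x\<bar> * \<bar>v x\<bar> \<le> \<bar>u x\<bar>\<^sup>2 + \<bar>v x\<bar>\<^sup>2" by (rule sum_squares_bound)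
    moreover have "0 \<le> \<bar>u x\<bar> * \<bar>v x\<bar>" by simp
    ultimately have "\<bar>u x\<bar> * \<bar>v x\<bar> \<le> (u x)\<^sup>2 + (v x)\<^sup>2" unfolding power2_abs by linarith
    then show "norm (u x * v x) \<le> norm ((u x)\<^sup>2 + (v x)\<^sup>2)" by (simp add: abs_mult)
  qed
qed measurable

text \<open>A point missed by every member of every \<open>\<A>n n\<close> would have
  \<open>point_set\<close> equal to \<open>T\<close>, and TIP puts that set into
  \<open>\<A>\<close>. So either \<open>T\<close> itself is a member or the countably many
  discretizing sets cover it.\<close>

lemma (in indexing_collection) countable_cover:
  "\<exists>V :: nat \<Rightarrow> 't set. range V \<subseteq> \<A> \<and> (\<Union>i. V i) = T"
proof (cases "T \<in> \<A>")
  case True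
  then show ?thesis by (intro exI[of _ "\<lambda>_. T"]) auto
next
  case False
  let ?D = "\<Union>n. \<A>n n"
  have D: "countable ?D" "?D \<noteq> {}" using discr_finite discr_empty by (auto intro: countable_finite)
  have "t \<in> \<Union>?D" if "t \<in> T" for t
  proof (rule ccontr)
    assume "t \<notin> \<Union>?D"
    then have "{A' \<in> \<A>n n \<union> {T}. t \<in> A'} = {T}" for n using that by auto
    then have "point_set T \<A>n t = T" unfolding point_set_def discr_point_def by simp
    then show False using tip that False unfolding bij_betw_def by auto
  qed
  then have "\<Union>?D = T" using discr_subset subsets by blast
  moreover have "range (from_nat_into ?D) = ?D" using D by (rule range_from_nat_into[rotated])
  moreover have "?D \<subseteq> \<A>" using discr_subset by auto
  ultimately show ?thesis by (intro exI[of _ "from_nat_into ?D"]) auto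
qed

locale levy_integrator =
  indexing_collection T \<A> \<A>n + L2_levy_process \<A> m P X + levy_triplet \<A> m P X b \<sigma>2 \<nu>
  for T :: "'t set" and \<A> :: "'t set set" and \<A>n :: "nat \<Rightarrow> 't set set"
    and m :: "'t measure" and P :: "'w measure" and X :: "'t set \<Rightarrow> 'w \<Rightarrow> real"
    and b \<sigma>2 :: real and \<nu> :: "real measure" +
  assumes space_m: "space m = T" and sets_m: "sets m = sigma_sets T \<A>"
    and finite_m: "\<And>A. A \<in> \<A> \<Longrightarrow> emeasure m A < \<infinity>"
begin

definition drift :: real where
  "drift = b + (LINT x:{x. 1 < \<bar>x\<bar>}|\<nu>. x)"

text \<open>Extended-valued, because an infinite second moment of \<open>\<nu>\<close> is not
  excluded when \<open>m\<close> is null.\<close>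

definition volatility :: ennreal where
  "volatility = ennreal \<sigma>2 + (\<integral>\<^sup>+x. ennreal (x\<^sup>2) \<partial>\<nu>)"

section \<open>Moments and covariances of the increments\<close>

lemma sets_A: "A \<in> \<A> \<Longrightarrow> A \<in> sets m"
  unfolding sets_m by (rule sigma_sets.Basic)

lemma fmeasurable_A: "A \<in> \<A> \<Longrightarrow> A \<in> fmeasurable m"
  using finite_m sets_A by (auto intro: fmeasurableI)

lemma measure_Diff_A: "A \<in> \<A> \<Longrightarrow> B \<in> \<A> \<Longrightarrow> measure m (A - B) = measure m A - measure m (A \<inter> B)"
  using measure_Diff[of m A "A \<inter> B"] fmeasurable_A[of A] sets_A Int_mem
  by (auto simp: Diff_Int fmeasurable_def less_top)

lemma incr_process_base: "A \<in> \<A> \<Longrightarrow> w \<in> space P \<Longrightarrow> incr_process \<A> X A w = X A w"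
  unfolding incr_process_def by (rule increment_extends(2)) (auto simp: null_at_empty)

lemma incr_process_Diff:
  "A \<in> \<A> \<Longrightarrow> B \<in> \<A> \<Longrightarrow> w \<in> space P \<Longrightarrow> incr_process \<A> X (A - B) w = X A w - X (A \<inter> B) w"
  unfolding incr_process_def by (rule increment_Diff) (auto simp: null_at_empty)

text \<open>One member of positive measure is enough: the law of its \<open>X A\<close> determines
  the second moment of \<open>\<nu>\<close> to be finite. If there is none, the countable cover
  makes \<open>T\<close> null.\<close>

lemma null_or_finite_volatility:
  "emeasure m T = 0 \<or> (volatility < \<infinity> \<and> integrable \<nu> (\<lambda>x. x\<^sup>2))"
proof (cases "\<exists>A\<in>\<A>. 0 < measure m A")
  case True
  then obtain A where A: "A \<in> \<A>" "0 < measure m A" by blast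
  have "(\<integral>\<^sup>+x. ennreal (x\<^sup>2) \<partial>\<nu>) < \<infinity>"
  proof (rule levy_measure_second_moment_finite[OF sets_levy levy_finite prob_space_axioms _ _ A(2)
        gauss_nonneg])
    show "X A \<in> borel_measurable P" "integrable P (\<lambda>w. (X A w)\<^sup>2)"
      using A random_variable square_integrable by auto
    show "(CLINT w|P. iexp (\<xi> * X A w)) = exp (of_real (measure m A) * levy_exponent b \<sigma>2 \<nu> \<xi>)" for \<xi>
      unfolding levy_khintchine[OF incr_class_base[OF A(1)], symmetric]
      by (intro Bochner_Integration.integral_cong) (auto simp: incr_process_base A)
  qed
  moreover have "(\<lambda>x. x\<^sup>2) \<in> borel_measurable \<nu>"
    by (subst measurable_cong_sets[OF sets_levy refl]) measurable
  ultimately show ?thesis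
    unfolding volatility_def by (auto intro!: integrableI_bounded)
next
  case False
  obtain V :: "nat \<Rightarrow> 't set" where V: "range V \<subseteq> \<A>" "(\<Union>i. V i) = T" using countable_cover by blast
  have "V i \<in> null_sets m" for i
  proof -
    have "measure m (V i) = 0" "emeasure m (V i) < \<infinity>" "V i \<in> sets m"
      using False V(1) finite_m[of "V i"] sets_A by (auto simp: less_le dest: range_subsetD)
    then show ?thesis by (auto simp: measure_def enn2real_eq_0_iff)
  qed
  then have "(\<Union>i. V i) \<in> null_sets m" by (rule null_sets_UN)
  then show ?thesis using V by auto
qed

text \<open>\<open>Y\<close> is an explicit expression in \<open>X\<close>, which supplies
  measurability and integrability. It is compared with \<open>incr_process\<close> only on
  \<open>space P\<close>, where \<open>X {}\<close> is known to vanish and the additive extension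
  exists.\<close>

lemma increment_moments:
  assumes C: "C \<in> incr_class \<A>" and [measurable]: "Y \<in> borel_measurable P"
    and sq: "integrable P (\<lambda>w. (Y w)\<^sup>2)"
    and eq: "\<And>w. w \<in> space P \<Longrightarrow> incr_process \<A> X C w = Y w"
  shows "expectation Y = measure m C * drift"
    and "expectation (\<lambda>w. (Y w)\<^sup>2) = measure m C * enn2real volatility + (measure m C * drift)\<^sup>2"
proof -
  have chf: "(CLINT w|P. iexp (\<xi> * Y w)) = exp (of_real (measure m C) * levy_exponent b \<sigma>2 \<nu> \<xi>)" for \<xi>
    unfolding levy_khintchine[OF C, symmetric]
    by (intro Bochner_Integration.integral_cong) (auto simp: eq)
  have "expectation Y = measure m C * drift \<and>
    expectation (\<lambda>w. (Y w)\<^sup>2) = measure m C * enn2real volatility + (measure m C * drift)\<^sup>2"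
  proof (cases "measure m C = 0")
    case True
    \<comment> \<open>As \<open>\<nu>\<close> may lack a second moment here, use the zero triplet, which gives the same trivial law.\<close>
    have *: "(CLINT w|P. iexp (\<xi> * Y w)) =
        exp (of_real 0 * levy_exponent 0 0 (null_measure borel) \<xi>)" for \<xi>
      unfolding chf True by simp
    have "expectation Y = 0" "expectation (\<lambda>w. (Y w)\<^sup>2) = 0"
      using levy_moments[OF _ _ prob_space_axioms _ sq _ *] by auto
    then show ?thesis using True by simp
  next
    case False
    have "emeasure m T \<noteq> 0"
    proof
      assume "emeasure m T = 0"
      then have "measure m C = 0"
        using emeasure_space[of m C] unfolding space_m by (simp add: measure_def)
      with False show False by simp
    qed
    then have sq\<nu>: "integrable \<nu> (\<lambda>x. x\<^sup>2)" using null_or_finite_volatility by blast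
    have "enn2real volatility = \<sigma>2 + (LINT x|\<nu>. x\<^sup>2)"
      using gauss_nonneg sq\<nu> unfolding volatility_def
      by (subst nn_integral_eq_integral) (auto simp flip: ennreal_plus)
    then show ?thesis
      using levy_moments[OF sets_levy levy_finite prob_space_axioms _ sq sq\<nu> chf]
      unfolding drift_def by auto
  qed
  then show "expectation Y = measure m C * drift"
    "expectation (\<lambda>w. (Y w)\<^sup>2) = measure m C * enn2real volatility + (measure m C * drift)\<^sup>2" by auto
qed

lemma expectation_mult_disjoint:
  assumes C: "C \<in> incr_class \<A>" "D \<in> incr_class \<A>" "C \<inter> D = {}"
    and int: "integrable P Y" "integrable P Z"
    and eq: "\<And>w. w \<in> space P \<Longrightarrow> incr_process \<A> X C w = Y w"
       "\<And>w. w \<in> space P \<Longrightarrow> incr_process \<A> X D w = Z w"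
  shows "expectation (\<lambda>w. Y w * Z w) = expectation Y * expectation Z"
proof -
  \<comment> \<open>Independence is assumed for families over an initial segment of the naturals, so
    the pair is encoded as a family over \<open>{..<2}\<close>.\<close>
  define E where "E = (\<lambda>i::nat. if i = 0 then C else D)"
  define W where "W = (\<lambda>i::nat. if i = 0 then Y else Z)"
  have "disjoint_family_on E {..<2}"
    using C(3) by (auto simp: disjoint_family_on_def E_def)
  moreover have "\<forall>i<2. E i \<in> incr_class \<A>" using C by (auto simp: E_def)
  ultimately have "indep_vars (\<lambda>_. borel) (\<lambda>i. incr_process \<A> X (E i)) {..<2}"
    by (rule indep_increments[rotated])
  moreover have W: "incr_process \<A> X (E i) w = W i w" if "w \<in> space P" for i w
    using that eq by (auto simp: E_def W_def)
  moreover have "integrable P (incr_process \<A> X (E i))" for i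
    using int by (subst Bochner_Integration.integrable_cong[OF refl W]) (auto simp: W_def)
  ultimately have "expectation (\<lambda>w. \<Prod>i\<in>{..<2::nat}. incr_process \<A> X (E i) w) =
      (\<Prod>i\<in>{..<2}. expectation (incr_process \<A> X (E i)))"
    by (intro indep_vars_lebesgue_integral) auto
  also have "expectation (\<lambda>w. \<Prod>i\<in>{..<2::nat}. incr_process \<A> X (E i) w) = expectation (\<lambda>w. \<Prod>i\<in>{..<2::nat}. W i w)"
    by (intro Bochner_Integration.integral_cong refl) (simp add: W)
  also have "(\<Prod>i\<in>{..<2}. expectation (incr_process \<A> X (E i))) = (\<Prod>i\<in>{..<2}. expectation (W i))"
    by (intro prod.cong refl Bochner_Integration.integral_cong) (simp add: W)
  finally show ?thesis by (simp add: W_def numeral_2_eq_2)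
qed

text \<open>In (Y + Y1)(Y + Y2), with Y the value on \<open>A \<inter> B\<close>, only the square of
  Y carries a variance. The three mixed products are products of means and combine with the squared
  mean of Y to the product of the full means.\<close>

lemma covariance:
  assumes A: "A \<in> \<A>" and B: "B \<in> \<A>"
  shows "expectation (\<lambda>w. X A w * X B w) =
    drift\<^sup>2 * (measure m A * measure m B) + enn2real volatility * measure m (A \<inter> B)"
proof -
  note AB = Int_mem[OF A B]
  let ?Y = "X (A \<inter> B)" and ?Y1 = "\<lambda>w. X A w - X (A \<inter> B) w" and ?Y2 = "\<lambda>w. X B w - X (A \<inter> B) w"
  have meas[measurable]: "X A \<in> borel_measurable P" "X B \<in> borel_measurable P" "?Y \<in> borel_measurable P"
    using A B AB random_variable by auto
  have sqs: "integrable P (\<lambda>w. (X A w)\<^sup>2)" "integrable P (\<lambda>w. (X B w)\<^sup>2)" "integrable P (\<lambda>w. (?Y w)\<^sup>2)"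
    using A B AB square_integrable by auto
  note prods = integrable_mult_if_square_integrable[OF meas(1) meas(3) sqs(1,3)]
    integrable_mult_if_square_integrable[OF meas(2) meas(3) sqs(2,3)]
    integrable_mult_if_square_integrable[OF meas(1) meas(2) sqs(1,2)]
  have sq: "integrable P (\<lambda>w. (?Y1 w)\<^sup>2)" "integrable P (\<lambda>w. (?Y2 w)\<^sup>2)"
    unfolding power2_diff using sqs prods by (auto simp: algebra_simps)
  have int: "integrable P ?Y" "integrable P ?Y1" "integrable P ?Y2"
    using sq sqs(3) by (auto intro!: square_integrable_imp_integrable)
  have eq: "incr_process \<A> X (A \<inter> B) w = ?Y w" "incr_process \<A> X (A - B) w = ?Y1 w"
    "incr_process \<A> X (B - A) w = ?Y2 w" if "w \<in> space P" for w
    using that incr_process_base[OF AB] incr_process_Diff[OF A B] incr_process_Diff[OF B A]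
    by (auto simp: Int_commute)
  note cls = incr_class_base[OF AB] incr_class_Diff[OF A B] incr_class_Diff[OF B A]
  let ?c = "measure m (A \<inter> B)"
  have m1: "measure m (A - B) = measure m A - ?c" "measure m (B - A) = measure m B - ?c"
    using measure_Diff_A[OF A B] measure_Diff_A[OF B A] by (auto simp: Int_commute)
  have E: "expectation ?Y = ?c * drift" "expectation ?Y1 = (measure m A - ?c) * drift"
    "expectation ?Y2 = (measure m B - ?c) * drift"
    "expectation (\<lambda>w. (?Y w)\<^sup>2) = ?c * enn2real volatility + (?c * drift)\<^sup>2"
    using increment_moments[OF cls(1) _ sqs(3) eq(1)] increment_moments[OF cls(2) _ sq(1) eq(2)]
      increment_moments[OF cls(3) _ sq(2) eq(3)] by (auto simp: m1)
  have I: "expectation (\<lambda>w. ?Y w * ?Y2 w) = expectation ?Y * expectation ?Y2"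
    "expectation (\<lambda>w. ?Y1 w * ?Y w) = expectation ?Y1 * expectation ?Y"
    "expectation (\<lambda>w. ?Y1 w * ?Y2 w) = expectation ?Y1 * expectation ?Y2"
    using expectation_mult_disjoint[OF cls(1,3) _ int(1,3) eq(1,3)]
      expectation_mult_disjoint[OF cls(2,1) _ int(2,1) eq(2,1)]
      expectation_mult_disjoint[OF cls(2,3) _ int(2,3) eq(2,3)] by blast+
  have pint: "integrable P (\<lambda>w. ?Y w * ?Y2 w)" "integrable P (\<lambda>w. ?Y1 w * ?Y w)"
    "integrable P (\<lambda>w. ?Y1 w * ?Y2 w)"
    by (intro integrable_mult_if_square_integrable sq sqs; measurable)+
  have "expectation (\<lambda>w. X A w * X B w) =
      expectation (\<lambda>w. (?Y w)\<^sup>2 + ?Y w * ?Y2 w + ?Y1 w * ?Y w + ?Y1 w * ?Y2 w)"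
    by (intro Bochner_Integration.integral_cong refl) (simp add: algebra_simps power2_eq_square)
  also have "\<dots> = expectation (\<lambda>w. (?Y w)\<^sup>2) + expectation (\<lambda>w. ?Y w * ?Y2 w) +
      expectation (\<lambda>w. ?Y1 w * ?Y w) + expectation (\<lambda>w. ?Y1 w * ?Y2 w)"
    using sqs(3) pint by (simp del: power2_eq_iff)
  also have "\<dots> = drift\<^sup>2 * (measure m A * measure m B) + enn2real volatility * ?c"
    unfolding I E by (simp add: algebra_simps power2_eq_square)
  finally show ?thesis .
qed

section \<open>The bilinear second-moment formula for elementary integrands\<close>

lemma elementary_integral_integrable:
  assumes "elementary_integral \<A> X s v"
  shows "s \<in> borel_measurable m" "integrable m s" "v \<in> borel_measurable P"
    "integrable P (\<lambda>w. (v w)\<^sup>2)"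
proof -
  have "s \<in> borel_measurable m \<and> integrable m s \<and> v \<in> borel_measurable P \<and> integrable P (\<lambda>w. (v w)\<^sup>2)"
    using assms
  proof (induction rule: elementary_integral.induct)
    case zero
    show ?case by simp
  next
    case (add_indicator s v A c)
    note A = add_indicator.hyps(2)
    have [measurable]: "A \<in> sets m" "X A \<in> borel_measurable P" "s \<in> borel_measurable m"
      "v \<in> borel_measurable P"
      using add_indicator sets_A[OF A] random_variable[OF A] by auto
    have sq: "integrable P (\<lambda>w. (X A w)\<^sup>2)" using square_integrable[OF A] .
    have "integrable P (\<lambda>w. v w * X A w)"
      using add_indicator sq by (intro integrable_mult_if_square_integrable) auto
    then have "integrable P (\<lambda>w. (v w)\<^sup>2 + 2 * c * (v w * X A w) + c\<^sup>2 * (X A w)\<^sup>2)"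
      using add_indicator sq by simp
    then have "integrable P (\<lambda>w. (v w + c * X A w)\<^sup>2)"
      by (simp add: power2_sum power_mult_distrib algebra_simps)
    moreover have "integrable m (\<lambda>t. s t + c * indicator A t)"
      using add_indicator fmeasurable_A[OF A] by (auto simp: fmeasurable_def)
    ultimately show ?case by simp
  qed
  then show "s \<in> borel_measurable m" "integrable m s" "v \<in> borel_measurable P"
    "integrable P (\<lambda>w. (v w)\<^sup>2)" by auto
qed

lemma integrable_mult_indicator_A:
  assumes "A \<in> \<A>" "integrable m (s :: 't \<Rightarrow> real)"
  shows "integrable m (\<lambda>t. s t * indicator A t)"
  by (rule integrable_real_mult_indicator[OF sets_A[OF assms(1)] assms(2)])

text \<open>First half of the bilinear extension of \<open>covariance\<close>: the right factor is
  still a single indicator. \<open>elementary_integral_inner\<close> then runs the induction on the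
  right factor.\<close>

lemma elementary_integral_mult_X:
  assumes "elementary_integral \<A> X s v" and B: "B \<in> \<A>"
  shows "expectation (\<lambda>w. v w * X B w) =
    drift\<^sup>2 * ((LINT t|m. s t) * measure m B) + enn2real volatility * (LINT t|m. s t * indicator B t)"
  using assms(1)
proof (induction rule: elementary_integral.induct)
  case zero
  show ?case by simp
next
  case (add_indicator s v A c)
  note A = add_indicator.hyps(2)
  note s = elementary_integral_integrable[OF add_indicator.hyps(1)]
  have i: "integrable P (\<lambda>w. v w * X B w)" "integrable P (\<lambda>w. X A w * X B w)"
    using A B s random_variable square_integrable
    by (auto intro!: integrable_mult_if_square_integrable)
  have ind: "integrable m (indicator D :: _ \<Rightarrow> real)" if "D \<in> \<A>" for D
    using fmeasurable_A[OF that] by (auto simp: fmeasurable_def)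
  have "expectation (\<lambda>w. (v w + c * X A w) * X B w) =
      expectation (\<lambda>w. v w * X B w + c * (X A w * X B w))"
    by (simp add: algebra_simps)
  also have "\<dots> = expectation (\<lambda>w. v w * X B w) + c * expectation (\<lambda>w. X A w * X B w)"
    using i by simp
  finally have 1: "expectation (\<lambda>w. (v w + c * X A w) * X B w) =
    expectation (\<lambda>w. v w * X B w) + c * expectation (\<lambda>w. X A w * X B w)" .
  have 2: "(LINT t|m. s t + c * indicator A t) = (LINT t|m. s t) + c * measure m A"
    using s(2) ind[OF A] sets_A[OF A] by simp
  have "(LINT t|m. (s t + c * indicator A t) * indicator B t) =
      (LINT t|m. s t * indicator B t + c * indicator (A \<inter> B) t)"
    by (simp add: algebra_simps indicator_inter_arith)
  also have "\<dots> = (LINT t|m. s t * indicator B t) + c * measure m (A \<inter> B)"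
    using integrable_mult_indicator_A[OF B s(2)] ind[OF Int_mem[OF A B]] sets_A[OF Int_mem[OF A B]]
    by simp
  finally show ?case
    unfolding 1 2 covariance[OF A B] add_indicator.IH by (simp add: algebra_simps)
qed

lemma elementary_integral_inner:
  assumes "elementary_integral \<A> X s v" "elementary_integral \<A> X s' v'"
  shows "integrable m (\<lambda>t. s t * s' t)"
    and "expectation (\<lambda>w. v w * v' w) =
      drift\<^sup>2 * ((LINT t|m. s t) * (LINT t|m. s' t)) + enn2real volatility * (LINT t|m. s t * s' t)"
proof -
  note s = elementary_integral_integrable[OF assms(1)]
  have "integrable m (\<lambda>t. s t * s' t) \<and> expectation (\<lambda>w. v w * v' w) =
      drift\<^sup>2 * ((LINT t|m. s t) * (LINT t|m. s' t)) + enn2real volatility * (LINT t|m. s t * s' t)"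
    using assms(2)
  proof (induction rule: elementary_integral.induct)
    case zero
    show ?case by simp
  next
    case (add_indicator s' v' A c)
    note A = add_indicator.hyps(2)
    note s' = elementary_integral_integrable[OF add_indicator.hyps(1)]
    note sA = integrable_mult_indicator_A[OF A s(2)]
    have i: "integrable P (\<lambda>w. v w * v' w)" "integrable P (\<lambda>w. v w * X A w)"
      using A s s' random_variable square_integrable
      by (auto intro!: integrable_mult_if_square_integrable)
    have ind: "integrable m (indicator A :: _ \<Rightarrow> real)"
      using fmeasurable_A[OF A] by (auto simp: fmeasurable_def)
    have "expectation (\<lambda>w. v w * (v' w + c * X A w)) =
        expectation (\<lambda>w. v w * v' w + c * (v w * X A w))"
      by (simp add: algebra_simps)
    also have "\<dots> = expectation (\<lambda>w. v w * v' w) + c * expectation (\<lambda>w. v w * X A w)"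
      using i by simp
    finally have 1: "expectation (\<lambda>w. v w * (v' w + c * X A w)) =
      expectation (\<lambda>w. v w * v' w) + c * expectation (\<lambda>w. v w * X A w)" .
    have 2: "(LINT t|m. s' t + c * indicator A t) = (LINT t|m. s' t) + c * measure m A"
      using s'(2) ind sets_A[OF A] by simp
    have 3: "s t * (s' t + c * indicator A t) = s t * s' t + c * (s t * indicator A t)" for t
      by (simp add: algebra_simps)
    have 4: "integrable m (\<lambda>t. s t * (s' t + c * indicator A t))"
      unfolding 3 using add_indicator.IH sA by simp
    have 5: "(LINT t|m. s t * (s' t + c * indicator A t)) =
        (LINT t|m. s t * s' t) + c * (LINT t|m. s t * indicator A t)"
      unfolding 3 using add_indicator.IH sA by simp
    show ?case
      unfolding 1 2 5 elementary_integral_mult_X[OF assms(1) A] conjunct2[OF add_indicator.IH]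
      using 4 by (simp add: algebra_simps)
  qed
  then show "integrable m (\<lambda>t. s t * s' t)"
    and "expectation (\<lambda>w. v w * v' w) =
      drift\<^sup>2 * ((LINT t|m. s t) * (LINT t|m. s' t)) + enn2real volatility * (LINT t|m. s t * s' t)"
    by auto
qed

abbreviation norm_sq :: "('t \<Rightarrow> real) \<Rightarrow> ennreal" where
  "norm_sq \<equiv> LX_norm_sq m b \<sigma>2 \<nu>"

lemma norm_sq_def:
  "norm_sq f = ennreal (drift\<^sup>2) * (\<integral>\<^sup>+t. ennreal \<bar>f t\<bar> \<partial>m)\<^sup>2 +
    volatility * (\<integral>\<^sup>+t. ennreal ((f t)\<^sup>2) \<partial>m)"
  unfolding LX_norm_sq_def drift_def volatility_def ..

text \<open>In general only an inequality, because the drift term has the modulus of an integral on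
  the left and the integral of a modulus in the norm.\<close>

lemma elementary_integral_bound:
  assumes "elementary_integral \<A> X s v"
  shows "(\<integral>\<^sup>+w. ennreal ((v w)\<^sup>2) \<partial>P) \<le> norm_sq s"
proof -
  note s = elementary_integral_integrable[OF assms]
  have sq: "integrable m (\<lambda>t. (s t)\<^sup>2)"
    using elementary_integral_inner(1)[OF assms assms] by (simp add: power2_eq_square)
  have I2: "(\<integral>\<^sup>+t. ennreal ((s t)\<^sup>2) \<partial>m) = ennreal (LINT t|m. (s t)\<^sup>2)"
    using sq by (intro nn_integral_eq_integral) auto
  have I1: "(\<integral>\<^sup>+t. ennreal \<bar>s t\<bar> \<partial>m) = ennreal (LINT t|m. \<bar>s t\<bar>)"
    using s(2) by (intro nn_integral_eq_integral) auto
  \<comment> \<open>\<open>enn2real\<close> sends an infinite value to 0, so the comparison holds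
    without assuming finite volatility.\<close>
  have vol: "ennreal (enn2real volatility) \<le> volatility"
    by (cases volatility) auto
  have "(\<integral>\<^sup>+w. ennreal ((v w)\<^sup>2) \<partial>P) = ennreal (expectation (\<lambda>w. v w * v w))"
    using s(4) by (subst nn_integral_eq_integral) (auto simp: power2_eq_square)
  also have "\<dots> = ennreal (drift\<^sup>2 * (LINT t|m. s t)\<^sup>2 + enn2real volatility * (LINT t|m. (s t)\<^sup>2))"
    unfolding elementary_integral_inner(2)[OF assms assms] by (simp add: power2_eq_square)
  also have "\<dots> \<le> ennreal (drift\<^sup>2 * (LINT t|m. \<bar>s t\<bar>)\<^sup>2 + enn2real volatility * (LINT t|m. (s t)\<^sup>2))"
  proof (intro ennreal_leI add_right_mono mult_left_mono)
    have "\<bar>LINT t|m. s t\<bar> \<le> \<bar>LINT t|m. \<bar>s t\<bar>\<bar>"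
      using integral_norm_bound[of m s] by (simp add: integral_nonneg_AE)
    then show "(LINT t|m. s t)\<^sup>2 \<le> (LINT t|m. \<bar>s t\<bar>)\<^sup>2" by (simp only: abs_le_square_iff)
  qed simp
  also have "\<dots> = ennreal (drift\<^sup>2) * (ennreal (LINT t|m. \<bar>s t\<bar>))\<^sup>2 +
      ennreal (enn2real volatility) * ennreal (LINT t|m. (s t)\<^sup>2)"
    by (simp add: ennreal_mult ennreal_power integral_nonneg_AE)
  also have "\<dots> \<le> norm_sq s"
    unfolding norm_sq_def I1 I2 by (intro add_left_mono mult_right_mono vol) simp
  finally show ?thesis .
qed

end

section \<open>Density of elementary integrands\<close>

lemma ennreal_square_add_le: "(x + y :: ennreal)\<^sup>2 \<le> 2 * x\<^sup>2 + 2 * y\<^sup>2"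
proof (cases "x = top \<or> y = top")
  case True
  then show ?thesis by (auto simp: power_eq_top_ennreal ennreal_mult_eq_top_iff)
next
  case False
  then obtain a b where ab: "x = ennreal a" "0 \<le> a" "y = ennreal b" "0 \<le> b"
    by (metis enn2real_nonneg ennreal_enn2real less_top)
  have "(a + b)\<^sup>2 \<le> 2 * a\<^sup>2 + 2 * b\<^sup>2"
    using sum_squares_bound[of a b] by (simp add: power2_sum)
  then have "ennreal ((a + b)\<^sup>2) \<le> ennreal (2 * a\<^sup>2 + 2 * b\<^sup>2)" by (rule ennreal_leI)
  moreover have "(x + y)\<^sup>2 = ennreal ((a + b)\<^sup>2)"
    using ab by (simp add: ennreal_power flip: ennreal_plus)
  moreover have "2 * x\<^sup>2 + 2 * y\<^sup>2 = ennreal (2 * a\<^sup>2 + 2 * b\<^sup>2)"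
    using ab by (simp add: ennreal_power ennreal_mult)
  ultimately show ?thesis by simp
qed

lemma nn_integral_square_add_le:
  fixes f g :: "'a \<Rightarrow> real"
  assumes [measurable]: "f \<in> borel_measurable M" "g \<in> borel_measurable M"
  shows "(\<integral>\<^sup>+x. ennreal ((f x + g x)\<^sup>2) \<partial>M) \<le>
    2 * (\<integral>\<^sup>+x. ennreal ((f x)\<^sup>2) \<partial>M) + 2 * (\<integral>\<^sup>+x. ennreal ((g x)\<^sup>2) \<partial>M)"
proof -
  have "(f x + g x)\<^sup>2 \<le> 2 * (f x)\<^sup>2 + 2 * (g x)\<^sup>2" for x
    using sum_squares_bound[of "f x" "g x"] by (simp add: power2_sum)
  then have "ennreal ((f x + g x)\<^sup>2) \<le> 2 * ennreal ((f x)\<^sup>2) + 2 * ennreal ((g x)\<^sup>2)" for x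
    using ennreal_leI by (fastforce simp: ennreal_mult)
  then have "(\<integral>\<^sup>+x. ennreal ((f x + g x)\<^sup>2) \<partial>M) \<le>
      (\<integral>\<^sup>+x. 2 * ennreal ((f x)\<^sup>2) + 2 * ennreal ((g x)\<^sup>2) \<partial>M)"
    by (intro nn_integral_mono)
  also have "\<dots> = 2 * (\<integral>\<^sup>+x. ennreal ((f x)\<^sup>2) \<partial>M) + 2 * (\<integral>\<^sup>+x. ennreal ((g x)\<^sup>2) \<partial>M)"
    by (simp add: nn_integral_add nn_integral_cmult)
  finally show ?thesis .
qed

lemma nn_integral_square_diff_le:
  fixes f g h :: "'a \<Rightarrow> real"
  assumes "f \<in> borel_measurable M" "g \<in> borel_measurable M" "h \<in> borel_measurable M"
  shows "(\<integral>\<^sup>+x. ennreal ((f x - h x)\<^sup>2) \<partial>M) \<le>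
    2 * (\<integral>\<^sup>+x. ennreal ((f x - g x)\<^sup>2) \<partial>M) + 2 * (\<integral>\<^sup>+x. ennreal ((g x - h x)\<^sup>2) \<partial>M)"
  using nn_integral_square_add_le[of "\<lambda>x. f x - g x" M "\<lambda>x. g x - h x"] assms by simp

lemma nn_integral_square_commute:
  fixes f g :: "'a \<Rightarrow> real"
  shows "(\<integral>\<^sup>+x. ennreal ((f x - g x)\<^sup>2) \<partial>M) = (\<integral>\<^sup>+x. ennreal ((g x - f x)\<^sup>2) \<partial>M)"
  by (simp add: power2_commute)

lemma ennreal_tendsto_square_zero:
  fixes x :: "nat \<Rightarrow> ennreal"
  assumes "x \<longlonglongrightarrow> 0"
  shows "(\<lambda>n. (x n)\<^sup>2) \<longlonglongrightarrow> 0"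
proof (rule tendsto_sandwich[OF _ _ tendsto_const assms])
  have "\<forall>\<^sub>F n in sequentially. x n < 1" using assms by (rule order_tendstoD) simp
  then show "\<forall>\<^sub>F n in sequentially. (x n)\<^sup>2 \<le> x n"
  proof eventually_elim
    case (elim n)
    then have "x n * x n \<le> x n * 1" by (intro mult_left_mono) auto
    then show ?case by (simp add: power2_eq_square)
  qed
qed simp

context levy_integrator
begin

section \<open>Calculus of the squared norm of L(X) and closure of the elementary integrands\<close>

lemma norm_sq_mono:
  assumes "AE t in m. \<bar>f t\<bar> \<le> \<bar>g t\<bar>"
  shows "norm_sq f \<le> norm_sq g"
proof -
  have "AE t in m. ennreal ((f t)\<^sup>2) \<le> ennreal ((g t)\<^sup>2)"
    using assms by eventually_elim (auto simp: abs_le_square_iff intro: ennreal_leI)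
  moreover have "AE t in m. ennreal \<bar>f t\<bar> \<le> ennreal \<bar>g t\<bar>"
    using assms by eventually_elim (rule ennreal_leI)
  ultimately show ?thesis
    unfolding norm_sq_def
    by (intro add_mono mult_left_mono power_mono nn_integral_mono_AE) auto
qed

lemma norm_sq_cong_AE: "AE t in m. f t = g t \<Longrightarrow> norm_sq f = norm_sq g"
  by (intro antisym norm_sq_mono; elim AE_mp; simp)

lemma norm_sq_null:
  assumes "AE t in m. f t = 0"
  shows "norm_sq f = 0"
proof -
  have "norm_sq f = norm_sq (\<lambda>_. 0)" by (rule norm_sq_cong_AE[OF assms])
  then show ?thesis by (simp add: norm_sq_def)
qed

lemma norm_sq_add:
  assumes [measurable]: "f \<in> borel_measurable m" "g \<in> borel_measurable m"
  shows "norm_sq (\<lambda>t. f t + g t) \<le> 2 * norm_sq f + 2 * norm_sq g"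
proof -
  have "(\<integral>\<^sup>+t. ennreal \<bar>f t + g t\<bar> \<partial>m) \<le> (\<integral>\<^sup>+t. ennreal \<bar>f t\<bar> + ennreal \<bar>g t\<bar> \<partial>m)"
    by (intro nn_integral_mono) (auto simp flip: ennreal_plus intro!: ennreal_leI)
  also have "\<dots> = (\<integral>\<^sup>+t. ennreal \<bar>f t\<bar> \<partial>m) + (\<integral>\<^sup>+t. ennreal \<bar>g t\<bar> \<partial>m)"
    by (intro nn_integral_add) auto
  finally have "(\<integral>\<^sup>+t. ennreal \<bar>f t + g t\<bar> \<partial>m)\<^sup>2 \<le>
      2 * (\<integral>\<^sup>+t. ennreal \<bar>f t\<bar> \<partial>m)\<^sup>2 + 2 * (\<integral>\<^sup>+t. ennreal \<bar>g t\<bar> \<partial>m)\<^sup>2"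
    by (intro order_trans[OF power_mono ennreal_square_add_le]) auto
  moreover note nn_integral_square_add_le[OF assms]
  ultimately have "norm_sq (\<lambda>t. f t + g t) \<le>
      ennreal (drift\<^sup>2) * (2 * (\<integral>\<^sup>+t. ennreal \<bar>f t\<bar> \<partial>m)\<^sup>2 + 2 * (\<integral>\<^sup>+t. ennreal \<bar>g t\<bar> \<partial>m)\<^sup>2) +
      volatility * (2 * (\<integral>\<^sup>+t. ennreal ((f t)\<^sup>2) \<partial>m) + 2 * (\<integral>\<^sup>+t. ennreal ((g t)\<^sup>2) \<partial>m))"
    unfolding norm_sq_def by (intro add_mono mult_left_mono) auto
  also have "\<dots> = 2 * norm_sq f + 2 * norm_sq g"
    unfolding norm_sq_def by (simp add: algebra_simps)
  finally show ?thesis .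
qed

lemma norm_sq_diff:
  assumes "f \<in> borel_measurable m" "g \<in> borel_measurable m" "h \<in> borel_measurable m"
  shows "norm_sq (\<lambda>t. f t - h t) \<le> 2 * norm_sq (\<lambda>t. f t - g t) + 2 * norm_sq (\<lambda>t. g t - h t)"
  using norm_sq_add[of "\<lambda>t. f t - g t" "\<lambda>t. g t - h t"] assms by simp

lemma norm_sq_cmult:
  assumes [measurable]: "f \<in> borel_measurable m"
  shows "norm_sq (\<lambda>t. c * f t) = ennreal (c\<^sup>2) * norm_sq f"
proof -
  have "(\<integral>\<^sup>+t. ennreal \<bar>c * f t\<bar> \<partial>m) = ennreal \<bar>c\<bar> * (\<integral>\<^sup>+t. ennreal \<bar>f t\<bar> \<partial>m)"
    by (subst nn_integral_cmult[symmetric]) (auto simp: abs_mult ennreal_mult)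
  moreover have "(\<integral>\<^sup>+t. ennreal ((c * f t)\<^sup>2) \<partial>m) = ennreal (c\<^sup>2) * (\<integral>\<^sup>+t. ennreal ((f t)\<^sup>2) \<partial>m)"
    by (subst nn_integral_cmult[symmetric]) (auto simp: power_mult_distrib ennreal_mult)
  ultimately show ?thesis
    unfolding norm_sq_def by (simp add: power_mult_distrib ennreal_power algebra_simps)
qed

lemma norm_sq_commute: "norm_sq (\<lambda>t. f t - g t) = norm_sq (\<lambda>t. g t - f t)"
  unfolding norm_sq_def by (simp add: abs_minus_commute power2_commute)

lemma norm_sq_lincomb:
  assumes [measurable]: "f \<in> borel_measurable m" "g \<in> borel_measurable m"
  shows "norm_sq (\<lambda>t. a * f t + c * g t) \<le> 2 * ennreal (a\<^sup>2) * norm_sq f + 2 * ennreal (c\<^sup>2) * norm_sq g"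
  using norm_sq_add[of "\<lambda>t. a * f t" "\<lambda>t. c * g t"] by (simp add: norm_sq_cmult mult.assoc)

text \<open>Sequential closure of the elementary integrands. The values \<open>v n\<close> are
  recorded so that the stochastic integral can later be taken as the limit along the same
  sequence.\<close>

definition approximable :: "('t \<Rightarrow> real) \<Rightarrow> bool" where
  "approximable f \<longleftrightarrow> f \<in> borel_measurable m \<and>
    (\<exists>s v. (\<forall>n::nat. elementary_integral \<A> X (s n) (v n)) \<and>
      (\<lambda>n. norm_sq (\<lambda>t. f t - s n t)) \<longlonglongrightarrow> 0)"

lemma approximable_elementary: "elementary_integral \<A> X s v \<Longrightarrow> approximable s"
  unfolding approximable_def
  by (auto intro!: exI[of _ "\<lambda>_. s"] exI[of _ "\<lambda>_. v"] elementary_integral_integrable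
      simp: norm_sq_null)

lemma approximable_zero: "approximable (\<lambda>_. 0)"
  by (rule approximable_elementary[OF elementary_integral.zero])

lemma approximable_indicator_A: "A \<in> \<A> \<Longrightarrow> approximable (indicator A)"
  by (rule approximable_elementary[OF elementary_integral_indicator])

lemma tendsto_zero_lincomb_bound:
  fixes x y z :: "nat \<Rightarrow> ennreal"
  assumes "\<And>n. z n \<le> a * x n + c * y n" "x \<longlonglongrightarrow> 0" "y \<longlonglongrightarrow> 0" "a < top" "c < top"
  shows "z \<longlonglongrightarrow> 0"
proof (rule tendsto_sandwich[OF _ _ tendsto_const])
  have "(\<lambda>n. a * x n + c * y n) \<longlonglongrightarrow> a * 0 + c * 0"
    using assms by (intro tendsto_add ennreal_tendsto_cmult) auto
  then show "(\<lambda>n. a * x n + c * y n) \<longlonglongrightarrow> 0" by simp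
qed (use assms(1) in auto)

lemma norm_sq_lincomb_tendsto:
  assumes "f \<in> borel_measurable m" "g \<in> borel_measurable m"
    and "\<And>n. s n \<in> borel_measurable m" "\<And>n. s' n \<in> borel_measurable m"
    and "(\<lambda>n. norm_sq (\<lambda>t. f t - s n t)) \<longlonglongrightarrow> 0" "(\<lambda>n. norm_sq (\<lambda>t. g t - s' n t)) \<longlonglongrightarrow> 0"
  shows "(\<lambda>n. norm_sq (\<lambda>t. (a * f t + c * g t) - (a * s n t + c * s' n t))) \<longlonglongrightarrow> 0"
proof (rule tendsto_zero_lincomb_bound[OF _ assms(5,6)])
  show "norm_sq (\<lambda>t. (a * f t + c * g t) - (a * s n t + c * s' n t)) \<le>
      (2 * ennreal (a\<^sup>2)) * norm_sq (\<lambda>t. f t - s n t) + (2 * ennreal (c\<^sup>2)) * norm_sq (\<lambda>t. g t - s' n t)" for n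
    using norm_sq_lincomb[of "\<lambda>t. f t - s n t" "\<lambda>t. g t - s' n t" a c] assms by (simp add: algebra_simps)
qed (auto simp: ennreal_mult_less_top)

lemma approximable_lincomb:
  assumes "approximable f" "approximable g"
  shows "approximable (\<lambda>t. a * f t + c * g t)"
proof -
  obtain s v s' v' where s: "\<And>n::nat. elementary_integral \<A> X (s n) (v n)"
      "(\<lambda>n. norm_sq (\<lambda>t. f t - s n t)) \<longlonglongrightarrow> 0" "f \<in> borel_measurable m"
    and s': "\<And>n::nat. elementary_integral \<A> X (s' n) (v' n)"
      "(\<lambda>n. norm_sq (\<lambda>t. g t - s' n t)) \<longlonglongrightarrow> 0" "g \<in> borel_measurable m"
    using assms unfolding approximable_def by blast
  have "(\<lambda>n. norm_sq (\<lambda>t. (a * f t + c * g t) - (a * s n t + c * s' n t))) \<longlonglongrightarrow> 0"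
    using s s' by (intro norm_sq_lincomb_tendsto) (auto intro: elementary_integral_integrable)
  then show ?thesis
    unfolding approximable_def using s(3) s'(3) elementary_integral_lincomb[OF s(1) s'(1), where a=a and c=c]
    by (intro conjI exI[of _ "\<lambda>n t. a * s n t + c * s' n t"]
        exI[of _ "\<lambda>n w. a * v n w + c * v' n w"]) auto
qed

lemma approximable_add: "approximable f \<Longrightarrow> approximable g \<Longrightarrow> approximable (\<lambda>t. f t + g t)"
  using approximable_lincomb[of f g 1 1] by simp

lemma approximable_diff: "approximable f \<Longrightarrow> approximable g \<Longrightarrow> approximable (\<lambda>t. f t - g t)"
  using approximable_lincomb[of f g 1 "-1"] by simp

text \<open>Diagonal argument: each \<open>g n\<close> is replaced by an elementary integrand at
  squared distance below 1 / (n + 1).\<close>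

lemma approximable_limit:
  assumes f: "f \<in> borel_measurable m" and g: "\<And>n::nat. approximable (g n)"
    and lim: "(\<lambda>n. norm_sq (\<lambda>t. f t - g n t)) \<longlonglongrightarrow> 0"
  shows "approximable f"
proof -
  have "\<exists>s v. elementary_integral \<A> X s v \<and> norm_sq (\<lambda>t. g n t - s t) < ennreal (inverse (Suc n))" for n
  proof -
    obtain s v where s: "\<And>k::nat. elementary_integral \<A> X (s k) (v k)"
      "(\<lambda>k. norm_sq (\<lambda>t. g n t - s k t)) \<longlonglongrightarrow> 0"
      using g[of n] unfolding approximable_def by blast
    have "\<forall>\<^sub>F k in sequentially. norm_sq (\<lambda>t. g n t - s k t) < ennreal (inverse (Suc n))"
      using s(2) by (rule order_tendstoD) simp
    then obtain k where "norm_sq (\<lambda>t. g n t - s k t) < ennreal (inverse (Suc n))"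
      by (auto simp: eventually_sequentially)
    with s(1) show ?thesis by blast
  qed
  then obtain s v where s: "\<And>n. elementary_integral \<A> X (s n) (v n)"
    "\<And>n. norm_sq (\<lambda>t. g n t - s n t) < ennreal (inverse (Suc n))" by metis
  have gm: "g n \<in> borel_measurable m" for n using g unfolding approximable_def by blast
  have gs: "(\<lambda>n. norm_sq (\<lambda>t. g n t - s n t)) \<longlonglongrightarrow> 0"
  proof (rule tendsto_sandwich[OF _ _ tendsto_const])
    show "(\<lambda>n. ennreal (inverse (Suc n))) \<longlonglongrightarrow> 0"
      using tendsto_ennrealI[OF LIMSEQ_inverse_real_of_nat] by simp
    show "\<forall>\<^sub>F n in sequentially. norm_sq (\<lambda>t. g n t - s n t) \<le> ennreal (inverse (Suc n))"
      by (intro always_eventually allI less_imp_le s(2))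
  qed simp
  have "norm_sq (\<lambda>t. f t - s n t) \<le>
      2 * norm_sq (\<lambda>t. f t - g n t) + 2 * norm_sq (\<lambda>t. g n t - s n t)" for n
    by (rule norm_sq_diff[OF f gm elementary_integral_integrable(1)[OF s(1)]])
  then have "(\<lambda>n. norm_sq (\<lambda>t. f t - s n t)) \<longlonglongrightarrow> 0"
    by (rule tendsto_zero_lincomb_bound[OF _ lim gs]) auto
  then show ?thesis unfolding approximable_def using f s(1) by blast
qed

text \<open>Dominated convergence in each of the two terms. Finiteness of \<open>norm_sq f\<close>
  says nothing about an integral whose coefficient is 0, hence the case distinctions; finite
  volatility lets that factor pass through the limit.\<close>

lemma norm_sq_dominated:
  assumes vol: "volatility < \<infinity>"
    and [measurable]: "f \<in> borel_measurable m" "\<And>n. g n \<in> borel_measurable m"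
    and bound: "\<And>n t. t \<in> space m \<Longrightarrow> \<bar>g n t\<bar> \<le> \<bar>f t\<bar>" and fin: "norm_sq f < \<infinity>"
    and lim: "\<And>t. t \<in> space m \<Longrightarrow> (\<lambda>n. g n t) \<longlonglongrightarrow> f t"
  shows "(\<lambda>n. norm_sq (\<lambda>t. f t - g n t)) \<longlonglongrightarrow> 0"
proof -
  have 1: "(\<lambda>n. ennreal (drift\<^sup>2) * (\<integral>\<^sup>+t. ennreal \<bar>f t - g n t\<bar> \<partial>m)\<^sup>2) \<longlonglongrightarrow> 0"
  proof (cases "drift = 0")
    case False
    have "ennreal (drift\<^sup>2) * (\<integral>\<^sup>+t. ennreal \<bar>f t\<bar> \<partial>m)\<^sup>2 < top"
      using fin unfolding norm_sq_def by simp
    moreover have "0 < ennreal (drift\<^sup>2)" using False by simp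
    ultimately have "(\<integral>\<^sup>+t. ennreal \<bar>f t\<bar> \<partial>m) < \<infinity>"
      using False by (auto simp: ennreal_mult_less_top power_less_top_ennreal)
    then have "(\<lambda>n. (\<integral>\<^sup>+t. norm (f t - g n t) \<partial>m)) \<longlonglongrightarrow> 0"
      by (intro nn_integral_dominated_convergence_norm[where w="\<lambda>t. \<bar>f t\<bar>"])
        (auto intro: bound lim)
    then have "(\<lambda>n. (\<integral>\<^sup>+t. ennreal \<bar>f t - g n t\<bar> \<partial>m)\<^sup>2) \<longlonglongrightarrow> 0"
      by (intro ennreal_tendsto_square_zero) simp
    from ennreal_tendsto_cmult[OF _ this, of "ennreal (drift\<^sup>2)"] show ?thesis by simp
  qed simp
  have 2: "(\<lambda>n. volatility * (\<integral>\<^sup>+t. ennreal ((f t - g n t)\<^sup>2) \<partial>m)) \<longlonglongrightarrow> 0"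
  proof (cases "volatility = 0")
    case False
    have "volatility * (\<integral>\<^sup>+t. ennreal ((f t)\<^sup>2) \<partial>m) < top"
      using fin unfolding norm_sq_def by simp
    then have fin2: "(\<integral>\<^sup>+t. ennreal ((f t)\<^sup>2) \<partial>m) < \<infinity>"
      using False by (auto simp: ennreal_mult_less_top)
    \<comment> \<open>The factor 4 in the majorant comes from |f - g n| \<le> 2 |f|.\<close>
    have "(\<lambda>n. (\<integral>\<^sup>+t. ennreal ((f t - g n t)\<^sup>2) \<partial>m)) \<longlonglongrightarrow> (\<integral>\<^sup>+t. 0 \<partial>m)"
    proof (rule nn_integral_dominated_convergence[where w="\<lambda>t. 4 * ennreal ((f t)\<^sup>2)"])
      show "AE t in m. ennreal ((f t - g n t)\<^sup>2) \<le> 4 * ennreal ((f t)\<^sup>2)" for n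
      proof (intro AE_I2)
        fix t assume "t \<in> space m"
        then have "\<bar>f t - g n t\<bar> \<le> \<bar>2 * f t\<bar>" using bound[of t n] by linarith
        then have "(f t - g n t)\<^sup>2 \<le> 4 * (f t)\<^sup>2"
          unfolding abs_le_square_iff by (simp add: power_mult_distrib)
        then show "ennreal ((f t - g n t)\<^sup>2) \<le> 4 * ennreal ((f t)\<^sup>2)"
          using ennreal_leI by (fastforce simp: ennreal_mult)
      qed
      show "(\<integral>\<^sup>+t. 4 * ennreal ((f t)\<^sup>2) \<partial>m) < \<infinity>"
        using fin2 by (simp add: nn_integral_cmult ennreal_mult_less_top)
      show "AE t in m. (\<lambda>n. ennreal ((f t - g n t)\<^sup>2)) \<longlonglongrightarrow> 0"
      proof (intro AE_I2)
        fix t assume "t \<in> space m"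
        then have "(\<lambda>n. (f t - g n t)\<^sup>2) \<longlonglongrightarrow> (f t - f t)\<^sup>2" by (intro tendsto_intros lim)
        from tendsto_ennrealI[OF this] show "(\<lambda>n. ennreal ((f t - g n t)\<^sup>2)) \<longlonglongrightarrow> 0" by simp
      qed
    qed measurable
    from ennreal_tendsto_cmult[OF _ this, of volatility] show ?thesis using vol by simp
  qed simp
  show ?thesis
    unfolding norm_sq_def using tendsto_add[OF 1 2] by simp
qed

lemma norm_sq_indicator_A:
  assumes "volatility < \<infinity>" "A \<in> \<A>"
  shows "norm_sq (indicator A) < \<infinity>"
proof -
  have "(\<lambda>t. ennreal \<bar>indicator A t\<bar>) = indicator A" "(\<lambda>t. ennreal ((indicator A t)\<^sup>2)) = indicator A"
    by (auto simp: indicator_def)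
  then show ?thesis
    unfolding norm_sq_def using assms finite_m[OF assms(2)] sets_A[OF assms(2)]
    by (simp add: ennreal_mult_less_top power_less_top_ennreal)
qed

text \<open>Dynkin induction on \<open>B\<close>, with \<open>\<A>\<close> as the
  intersection-stable generator. Everything is kept inside a fixed \<open>A\<close> because
  \<open>T\<close> may lie outside \<open>\<A>\<close> and have infinite measure: complements are
  taken relative to \<open>A\<close>, and the indicator of \<open>A\<close> bounds the norm in the
  countable union.\<close>

lemma approximable_indicator_Int:
  assumes vol: "volatility < \<infinity>" and A: "A \<in> \<A>" and B: "B \<in> sets m"
  shows "approximable (indicator (A \<inter> B))"
proof -
  have "Int_stable \<A>" using Int_mem by (auto simp: Int_stable_def)
  then show ?thesis
    using subsets B[unfolded sets_m]
  proof (induction rule: sigma_sets_induct_disjoint)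
    case (basic B)
    then show ?case by (intro approximable_indicator_A Int_mem A)
  next
    case empty
    show ?case using approximable_zero by simp
  next
    case (compl B)
    have "indicator (A \<inter> (T - B)) = (\<lambda>t. indicator A t - indicator (A \<inter> B) t :: real)"
    proof
      show "indicator (A \<inter> (T - B)) t = (indicator A t - indicator (A \<inter> B) t :: real)" for t
        using subsetD[OF PowD[OF subsetD[OF subsets A]], of t] by (simp split: split_indicator)
    qed
    then show ?case
      using approximable_diff[OF approximable_indicator_A[OF A] compl.IH] by (simp only:)
  next
    case (union B)
    have Bm: "B i \<in> sets m" for i using union sets_m by auto
    have part: "approximable (indicator (A \<inter> (\<Union>i<n. B i)))" for n
    proof (induction n)
      case 0
      show ?case using approximable_zero by simp
    next
      case (Suc n)
      have "B n \<inter> B i = {}" if "i < n" for i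
        using union(1) that by (intro disjoint_family_onD[where I=UNIV]) auto
      then have "(A \<inter> (\<Union>i<n. B i)) \<inter> (A \<inter> B n) = {}" by blast
      moreover have "A \<inter> (\<Union>i<Suc n. B i) = (A \<inter> (\<Union>i<n. B i)) \<union> (A \<inter> B n)"
        unfolding lessThan_Suc by blast
      ultimately have "indicator (A \<inter> (\<Union>i<Suc n. B i)) t =
          (indicator (A \<inter> (\<Union>i<n. B i)) t + indicator (A \<inter> B n) t :: real)" for t
        by (simp only: indicator_disj_union)
      then have "indicator (A \<inter> (\<Union>i<Suc n. B i)) =
          (\<lambda>t. indicator (A \<inter> (\<Union>i<n. B i)) t + indicator (A \<inter> B n) t :: real)" by (rule ext)
      then show ?case using approximable_add[OF Suc union(3)[of n]] by (simp only:)
    qed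
    let ?f = "indicator (A \<inter> (\<Union>i. B i)) :: 't \<Rightarrow> real"
    let ?g = "\<lambda>n. indicator (A \<inter> (\<Union>i<n. B i)) :: 't \<Rightarrow> real"
    have fm: "?f \<in> borel_measurable m"
      by (intro borel_measurable_indicator sets.countable_UN sets.Int sets_A A image_subsetI Bm)
    have gm: "?g n \<in> borel_measurable m" for n
      by (intro borel_measurable_indicator sets.finite_UN sets.Int sets_A A Bm finite_lessThan)
    have le: "\<bar>?g n t\<bar> \<le> \<bar>?f t\<bar>" for n t
      by (auto split: split_indicator)
    have lim: "(\<lambda>n. ?g n t) \<longlonglongrightarrow> ?f t" for t
      using LIMSEQ_indicator_UN[of "\<lambda>i. A \<inter> B i" t] by (simp only: Int_UN_distrib[symmetric])
    have "\<bar>?f t\<bar> \<le> \<bar>indicator A t\<bar>" for t by (auto split: split_indicator)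
    then have "norm_sq ?f < \<infinity>"
      by (intro le_less_trans[OF norm_sq_mono norm_sq_indicator_A[OF vol A]] AE_I2)
    from norm_sq_dominated[OF vol fm gm le this lim] show ?case
      by (rule approximable_limit[OF fm part])
  qed
qed

text \<open>The countable cover is made disjoint: each step adds the part of \<open>B\<close> in
  \<open>V n\<close> not met before, to which \<open>approximable_indicator_Int\<close> applies. The
  partial unions increase to \<open>B\<close> and are dominated by its indicator.\<close>

lemma approximable_indicator:
  assumes vol: "volatility < \<infinity>" and B: "B \<in> sets m" and fin: "norm_sq (indicator B) < \<infinity>"
  shows "approximable (indicator B)"
proof -
  obtain V :: "nat \<Rightarrow> 't set" where V: "range V \<subseteq> \<A>" "(\<Union>i. V i) = T" using countable_cover by blast
  have VA: "V i \<in> \<A>" for i using V by auto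
  have part: "approximable (indicator (\<Union>i<n. B \<inter> V i))" for n
  proof (induction n)
    case 0
    show ?case using approximable_zero by simp
  next
    case (Suc n)
    have "(\<Union>i<Suc n. B \<inter> V i) = (\<Union>i<n. B \<inter> V i) \<union> (V n \<inter> (B - (\<Union>i<n. V i)))"
      unfolding lessThan_Suc by blast
    moreover have "(\<Union>i<n. B \<inter> V i) \<inter> (V n \<inter> (B - (\<Union>i<n. V i))) = {}" by blast
    ultimately have "indicator (\<Union>i<Suc n. B \<inter> V i) t =
        (indicator (\<Union>i<n. B \<inter> V i) t + indicator (V n \<inter> (B - (\<Union>i<n. V i))) t :: real)" for t
      by (simp only: indicator_disj_union)
    then have "indicator (\<Union>i<Suc n. B \<inter> V i) =
        (\<lambda>t. indicator (\<Union>i<n. B \<inter> V i) t + indicator (V n \<inter> (B - (\<Union>i<n. V i))) t :: real)"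
      by (rule ext)
    moreover have "approximable (indicator (V n \<inter> (B - (\<Union>i<n. V i))))"
      by (intro approximable_indicator_Int vol VA sets.Diff B sets.finite_UN sets_A finite_lessThan)
    ultimately show ?case using approximable_add[OF Suc] by (simp only:)
  qed
  have BT: "(\<Union>i. B \<inter> V i) = B"
  proof -
    have "B \<subseteq> (\<Union>i. V i)" unfolding V(2) using sets.sets_into_space[OF B] by (simp add: space_m)
    then show ?thesis by blast
  qed
  let ?g = "\<lambda>n. indicator (\<Union>i<n. B \<inter> V i) :: 't \<Rightarrow> real"
  have Bm: "(indicator B :: 't \<Rightarrow> real) \<in> borel_measurable m" using B by simp
  have gm: "?g n \<in> borel_measurable m" for n
    by (intro borel_measurable_indicator sets.finite_UN sets.Int B VA sets_A finite_lessThan)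
  have le: "\<bar>?g n t\<bar> \<le> \<bar>indicator B t\<bar>" for n t
    by (auto simp: indicator_def)
  have "(\<lambda>n. ?g n t) \<longlonglongrightarrow> indicator B t" for t
    using LIMSEQ_indicator_UN[of "\<lambda>i. B \<inter> V i" t] by (simp only: BT)
  from norm_sq_dominated[OF vol Bm gm le fin this] show ?thesis
    by (rule approximable_limit[OF Bm part])
qed

lemma approximable_nonneg:
  assumes vol: "volatility < \<infinity>" and f: "f \<in> borel_measurable m" "\<And>t. 0 \<le> f t"
  shows "norm_sq f < \<infinity> \<Longrightarrow> approximable f"
  using f
proof (induction rule: borel_measurable_induct_real)
  case (set A)
  then show ?case by (intro approximable_indicator vol)
next
  case (mult u c)
  show ?case
  proof (cases "c = 0")
    case True
    then show ?thesis
      using approximable_zero by simp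
  next
    case False
    then have "norm_sq u < \<infinity>"
      using mult.prems unfolding norm_sq_cmult[OF mult.hyps(2)] by (auto simp: ennreal_mult_less_top norm_sq_null)
    then have u: "approximable u" by (rule mult.IH)
    show ?thesis using approximable_lincomb[OF u u, of c 0] by simp
  qed
next
  case (add u v)
  have "norm_sq u \<le> norm_sq (\<lambda>x. v x + u x)" "norm_sq v \<le> norm_sq (\<lambda>x. v x + u x)"
    using add.hyps by (auto intro!: norm_sq_mono)
  then have "norm_sq u < \<infinity>" "norm_sq v < \<infinity>" using add.prems by (simp_all only: le_less_trans)
  then show ?case by (intro approximable_add add.IH)
next
  case (seq U)
  have le: "U i t \<le> f t" if "t \<in> space m" for i t
  proof (rule incseq_le[OF _ seq.hyps(4)[OF that]])
    show "incseq (\<lambda>i. U i t)" using seq.hyps(3) by (simp add: mono_def le_fun_def)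
  qed
  have abs_le: "\<bar>U i t\<bar> \<le> \<bar>f t\<bar>" if "t \<in> space m" for i t
    using le[OF that, of i] seq.hyps(2)[of i t] by simp
  have "norm_sq (U i) < \<infinity>" for i
    by (rule le_less_trans[OF norm_sq_mono[OF AE_I2[OF abs_le]] seq.prems])
  then have U: "approximable (U i)" for i by (rule seq.IH)
  show ?case
    by (rule approximable_limit[OF f(1) U norm_sq_dominated[OF vol f(1) seq.hyps(1) abs_le
          seq.prems seq.hyps(4)]])
qed

text \<open>Positive and negative parts reduce this to \<open>approximable_nonneg\<close>, which
  needs finite volatility. If \<open>m\<close> is null that may fail, but then the zero integrand
  approximates every function.\<close>

lemma approximable_if_norm_finite:
  assumes f[measurable]: "f \<in> borel_measurable m" and fin: "norm_sq f < \<infinity>"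
  shows "approximable f"
proof (cases "emeasure m T = 0")
  case True
  then have "AE t in m. f t - 0 = 0"
    by (intro AE_I[of _ _ T]) (auto simp: space_m[symmetric])
  then have "norm_sq (\<lambda>t. f t - 0) = 0" by (rule norm_sq_null)
  then show ?thesis
    unfolding approximable_def using elementary_integral.zero[of \<A> X] f
    by (intro conjI exI[of _ "\<lambda>_ _. 0"]) auto
next
  case False
  then have vol: "volatility < \<infinity>" using null_or_finite_volatility by blast
  have *: "approximable (\<lambda>t. max 0 (g t))"
    if [measurable]: "g \<in> borel_measurable m" and g: "norm_sq g < \<infinity>" for g
  proof (rule approximable_nonneg[OF vol])
    have "norm_sq (\<lambda>t. max 0 (g t)) \<le> norm_sq g" by (intro norm_sq_mono AE_I2) auto
    then show "norm_sq (\<lambda>t. max 0 (g t)) < \<infinity>" using g by (rule le_less_trans)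
  qed auto
  have "norm_sq (\<lambda>t. - f t) = norm_sq f" using norm_sq_cmult[OF f, of "-1"] by simp
  then have "approximable (\<lambda>t. max 0 (f t) - max 0 (- f t))"
    using fin by (intro approximable_diff *) auto
  moreover have "(\<lambda>t. max 0 (f t) - max 0 (- f t)) = f" by (auto simp: max_def)
  ultimately show ?thesis by simp
qed

end

section \<open>Extension to the whole of L(X)\<close>

text \<open>The embedding of L^2 into L^1 on a probability space, from 2 e |u| \<le> e^2 +
  u^2.\<close>

lemma (in prob_space) expectation_abs_less:
  fixes u :: "'a \<Rightarrow> real"
  assumes u: "u \<in> borel_measurable M" and sq: "integrable M (\<lambda>x. (u x)\<^sup>2)"
    and e: "0 < e" "expectation (\<lambda>x. (u x)\<^sup>2) < e\<^sup>2"
  shows "expectation (\<lambda>x. \<bar>u x\<bar>) < e"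
proof -
  have int: "integrable M u" by (rule square_integrable_imp_integrable[OF u sq])
  have "\<bar>u x\<bar> \<le> e / 2 + (u x)\<^sup>2 / (2 * e)" for x
  proof -
    have "2 * e * \<bar>u x\<bar> \<le> e\<^sup>2 + \<bar>u x\<bar>\<^sup>2" by (rule sum_squares_bound)
    then show ?thesis using e(1) by (simp add: field_simps power2_eq_square)
  qed
  then have "expectation (\<lambda>x. \<bar>u x\<bar>) \<le> expectation (\<lambda>x. e / 2 + (u x)\<^sup>2 / (2 * e))"
    using int sq by (intro integral_mono) auto
  also have "\<dots> = e / 2 + expectation (\<lambda>x. (u x)\<^sup>2) / (2 * e)"
    using sq by (simp add: prob_space)
  also have "\<dots> < e / 2 + e\<^sup>2 / (2 * e)"
    using e by (intro add_strict_left_mono divide_strict_right_mono) auto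
  also have "\<dots> = e" using e(1) by (simp add: power2_eq_square)
  finally show ?thesis .
qed

text \<open>Riesz-Fischer by way of L^1: an L^2-Cauchy sequence is L^1-Cauchy and has an almost
  everywhere convergent subsequence, along which Fatou's lemma carries the Cauchy bound to the
  limit.\<close>

lemma (in prob_space) L2_complete:
  fixes v :: "nat \<Rightarrow> 'a \<Rightarrow> real"
  assumes v[measurable]: "\<And>n. v n \<in> borel_measurable M" and sq: "\<And>n. integrable M (\<lambda>x. (v n x)\<^sup>2)"
    and cauchy: "\<And>e. 0 < e \<Longrightarrow>
      \<exists>N. \<forall>i\<ge>N. \<forall>j\<ge>N. (\<integral>\<^sup>+x. ennreal ((v i x - v j x)\<^sup>2) \<partial>M) \<le> ennreal e"
  shows "\<exists>u \<in> borel_measurable M. (\<lambda>n. \<integral>\<^sup>+x. ennreal ((u x - v n x)\<^sup>2) \<partial>M) \<longlonglongrightarrow> 0"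
proof -
  have dsq: "integrable M (\<lambda>x. (v i x - v j x)\<^sup>2)" for i j
  proof -
    have "integrable M (\<lambda>x. (v i x)\<^sup>2 + (v j x)\<^sup>2 - 2 * (v i x * v j x))"
      using integrable_mult_if_square_integrable[OF v v sq sq] sq by simp
    then show ?thesis by (simp add: power2_diff mult.assoc)
  qed
  have "\<exists>N. \<forall>i\<ge>N. \<forall>j\<ge>N. expectation (\<lambda>x. norm (v i x - v j x)) < e" if e: "0 < e" for e
  proof -
    \<comment> \<open>Half of \<open>e\<^sup>2\<close> leaves room for the strict inequality that
      \<open>expectation_abs_less\<close> requires.\<close>
    obtain N where N: "\<And>i j. i \<ge> N \<Longrightarrow> j \<ge> N \<Longrightarrow>
        (\<integral>\<^sup>+x. ennreal ((v i x - v j x)\<^sup>2) \<partial>M) \<le> ennreal (e\<^sup>2 / 2)"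
      using cauchy[of "e\<^sup>2 / 2"] e by auto
    have "expectation (\<lambda>x. \<bar>v i x - v j x\<bar>) < e" if "i \<ge> N" "j \<ge> N" for i j
    proof (rule expectation_abs_less[OF _ dsq e])
      have "ennreal (expectation (\<lambda>x. (v i x - v j x)\<^sup>2)) \<le> ennreal (e\<^sup>2 / 2)"
        using N[OF that] nn_integral_eq_integral[OF dsq[of i j]] by simp
      then have "expectation (\<lambda>x. (v i x - v j x)\<^sup>2) \<le> e\<^sup>2 / 2" by (simp add: ennreal_le_iff)
      also have "\<dots> < e\<^sup>2" using e by simp
      finally show "expectation (\<lambda>x. (v i x - v j x)\<^sup>2) < e\<^sup>2" .
    qed measurable
    then show ?thesis unfolding real_norm_def by blast
  qed
  from cauchy_L1_AE_cauchy_subseq[OF square_integrable_imp_integrable[OF v sq] this]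
  obtain r where r: "strict_mono r" "AE x in M. Cauchy (\<lambda>i. v (r i) x)" by blast
  define u where "u x = lim (\<lambda>i. v (r i) x)" for x
  have u[measurable]: "u \<in> borel_measurable M" unfolding u_def by measurable
  have lim: "AE x in M. (\<lambda>i. v (r i) x) \<longlonglongrightarrow> u x"
    using r(2) by eventually_elim (simp add: u_def Cauchy_convergent_iff convergent_LIMSEQ_iff)
  have "\<forall>\<^sub>F n in sequentially. (\<integral>\<^sup>+x. ennreal ((u x - v n x)\<^sup>2) \<partial>M) < e" if "0 < e" for e
  proof -
    \<comment> \<open>\<open>e\<close> is an extended real and may be infinite, whereas
      \<open>cauchy\<close> is stated for real bounds.\<close>
    obtain e' where e': "0 < e'" "ennreal e' < e"
    proof (cases e)
      case (real r)
      with \<open>0 < e\<close> show ?thesis by (intro that[of "r / 2"]) (auto simp: ennreal_lessI)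
    qed (use that[of 1] in auto)
    obtain N where N: "\<And>i j. i \<ge> N \<Longrightarrow> j \<ge> N \<Longrightarrow>
        (\<integral>\<^sup>+x. ennreal ((v i x - v j x)\<^sup>2) \<partial>M) \<le> ennreal e'"
      using cauchy[OF e'(1)] by auto
    have "(\<integral>\<^sup>+x. ennreal ((u x - v n x)\<^sup>2) \<partial>M) \<le> ennreal e'" if n: "n \<ge> N" for n
    proof -
      have "(\<integral>\<^sup>+x. ennreal ((u x - v n x)\<^sup>2) \<partial>M) =
          (\<integral>\<^sup>+x. liminf (\<lambda>k. ennreal ((v (r k) x - v n x)\<^sup>2)) \<partial>M)"
      proof (rule nn_integral_cong_AE)
        show "AE x in M. ennreal ((u x - v n x)\<^sup>2) = liminf (\<lambda>k. ennreal ((v (r k) x - v n x)\<^sup>2))"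
          using lim
        proof eventually_elim
          case (elim x)
          then have "(\<lambda>k. ennreal ((v (r k) x - v n x)\<^sup>2)) \<longlonglongrightarrow> ennreal ((u x - v n x)\<^sup>2)"
            by (intro tendsto_intros)
          then show ?case by (rule lim_imp_Liminf[OF sequentially_bot, symmetric])
        qed
      qed
      also have "\<dots> \<le> liminf (\<lambda>k. \<integral>\<^sup>+x. ennreal ((v (r k) x - v n x)\<^sup>2) \<partial>M)"
        by (intro nn_integral_liminf) measurable
      also have "\<dots> \<le> liminf (\<lambda>k::nat. ennreal e')"
      proof (rule Liminf_mono)
        show "\<forall>\<^sub>F k in sequentially. (\<integral>\<^sup>+x. ennreal ((v (r k) x - v n x)\<^sup>2) \<partial>M) \<le> ennreal e'"
          using eventually_ge_at_top[of N]
        proof eventually_elim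
          case (elim k)
          then have "N \<le> r k" using seq_suble[OF r(1), of k] by simp
          then show ?case using n by (rule N)
        qed
      qed
      also have "\<dots> = ennreal e'" by (simp add: Liminf_const)
      finally show ?thesis .
    qed
    then show ?thesis using e'(2) by (auto simp: eventually_sequentially intro: le_less_trans)
  qed
  then have "(\<lambda>n. \<integral>\<^sup>+x. ennreal ((u x - v n x)\<^sup>2) \<partial>M) \<longlonglongrightarrow> 0"
    by (intro order_tendstoI) auto
  with u show ?thesis by blast
qed

section \<open>Classes modulo almost everywhere equality\<close>

lemma ae_class_eq_iff:
  assumes "f \<in> borel_measurable M" "g \<in> borel_measurable M"
  shows "ae_class M f = ae_class M g \<longleftrightarrow> (AE x in M. f x = g x)"
proof
  assume "ae_class M f = ae_class M g"
  moreover have "f \<in> ae_class M f" using assms by (simp add: ae_class_def)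
  ultimately have "f \<in> ae_class M g" by simp
  then show "AE x in M. f x = g x" by (simp add: ae_class_def)
next
  assume *: "AE x in M. f x = g x"
  have "(AE x in M. h x = f x) \<longleftrightarrow> (AE x in M. h x = g x)" for h
    using * by (intro iffI; elim AE_mp) auto
  then show "ae_class M f = ae_class M g" unfolding ae_class_def by simp
qed

lemma ae_class_self: "f \<in> borel_measurable M \<Longrightarrow> f \<in> ae_class M f"
  by (simp add: ae_class_def)

lemma class_lincomb_ae_class:
  assumes [measurable]: "f \<in> borel_measurable M" "g \<in> borel_measurable M"
  shows "class_lincomb M a (ae_class M f) c (ae_class M g) = ae_class M (\<lambda>x. a * f x + c * g x)"
proof (intro set_eqI iffI)
  fix h assume "h \<in> class_lincomb M a (ae_class M f) c (ae_class M g)"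
  then obtain f' g' where *: "h \<in> borel_measurable M" "AE x in M. f' x = f x" "AE x in M. g' x = g x"
    "AE x in M. h x = a * f' x + c * g' x" unfolding class_lincomb_def ae_class_def by blast
  have "AE x in M. h x = a * f x + c * g x" using *(2-4) by eventually_elim simp
  with *(1) show "h \<in> ae_class M (\<lambda>x. a * f x + c * g x)" by (simp add: ae_class_def)
next
  fix h assume "h \<in> ae_class M (\<lambda>x. a * f x + c * g x)"
  then show "h \<in> class_lincomb M a (ae_class M f) c (ae_class M g)"
    unfolding class_lincomb_def using ae_class_self[OF assms(1)] ae_class_self[OF assms(2)]
    by (intro CollectI conjI bexI[of _ f] bexI[of _ g]) (simp_all add: ae_class_def)
qed

lemma L2_norm_eq:
  assumes "u \<in> borel_measurable M"
  shows "L2_norm M u = sqrt (enn2real (\<integral>\<^sup>+x. ennreal ((u x)\<^sup>2) \<partial>M))"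
  unfolding L2_norm_def using assms by (subst integral_eq_nn_integral) auto

lemma nn_integral_square_eq_0:
  fixes u v :: "'a \<Rightarrow> real"
  assumes [measurable]: "u \<in> borel_measurable M" "v \<in> borel_measurable M"
    and "(\<integral>\<^sup>+x. ennreal ((u x - v x)\<^sup>2) \<partial>M) = 0"
  shows "AE x in M. u x = v x"
proof -
  have "AE x in M. ennreal ((u x - v x)\<^sup>2) = 0"
    using assms(3) by (subst (asm) nn_integral_0_iff_AE) auto
  then show ?thesis by eventually_elim (simp add: ennreal_eq_0_iff)
qed

context levy_integrator
begin

text \<open>The closure of the graph of the elementary integral: one sequence has to converge in
  both coordinates. Uniqueness of \<open>u\<close> up to null sets is left to
  \<open>integral_rel_bound\<close>.\<close>

definition integral_rel :: "('t \<Rightarrow> real) \<Rightarrow> ('w \<Rightarrow> real) \<Rightarrow> bool" where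
  "integral_rel f u \<longleftrightarrow> f \<in> borel_measurable m \<and> u \<in> borel_measurable P \<and>
    (\<exists>s v. (\<forall>n::nat. elementary_integral \<A> X (s n) (v n)) \<and>
      (\<lambda>n. norm_sq (\<lambda>t. f t - s n t)) \<longlonglongrightarrow> 0 \<and>
      (\<lambda>n. \<integral>\<^sup>+w. ennreal ((u w - v n w)\<^sup>2) \<partial>P) \<longlonglongrightarrow> 0)"

lemma integral_rel_exists:
  assumes f: "f \<in> borel_measurable m" and fin: "norm_sq f < \<infinity>"
  shows "\<exists>u. integral_rel f u"
proof -
  obtain s v where s: "\<And>n::nat. elementary_integral \<A> X (s n) (v n)"
    "(\<lambda>n. norm_sq (\<lambda>t. f t - s n t)) \<longlonglongrightarrow> 0"
    using approximable_if_norm_finite[OF f fin] unfolding approximable_def by blast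
  note ei = elementary_integral_integrable[OF s(1)]
  have "\<exists>N. \<forall>i\<ge>N. \<forall>j\<ge>N. (\<integral>\<^sup>+w. ennreal ((v i w - v j w)\<^sup>2) \<partial>P) \<le> ennreal e" if "0 < e" for e
  proof -
    \<comment> \<open>The threshold \<open>e / 4\<close> compensates for the doubling of each of the
      two terms in \<open>norm_sq_diff\<close>.\<close>
    have "\<forall>\<^sub>F n in sequentially. norm_sq (\<lambda>t. f t - s n t) < ennreal (e / 4)"
      using s(2) that by (intro order_tendstoD(2)) auto
    then obtain N where N: "\<And>n. n \<ge> N \<Longrightarrow> norm_sq (\<lambda>t. f t - s n t) < ennreal (e / 4)"
      by (auto simp: eventually_sequentially)
    have "(\<integral>\<^sup>+w. ennreal ((v i w - v j w)\<^sup>2) \<partial>P) \<le> ennreal e" if "i \<ge> N" "j \<ge> N" for i j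
    proof -
      have "(\<integral>\<^sup>+w. ennreal ((v i w - v j w)\<^sup>2) \<partial>P) \<le> norm_sq (\<lambda>t. s i t - s j t)"
        by (rule elementary_integral_bound[OF elementary_integral_diff[OF s(1) s(1)]])
      also have "\<dots> \<le> 2 * norm_sq (\<lambda>t. s i t - f t) + 2 * norm_sq (\<lambda>t. f t - s j t)"
        by (rule norm_sq_diff[OF ei(1) f ei(1)])
      also have "\<dots> \<le> 2 * ennreal (e / 4) + 2 * ennreal (e / 4)"
        unfolding norm_sq_commute[of "s i" f]
        by (intro add_mono mult_left_mono less_imp_le N that) auto
      also have "2 * ennreal (e / 4) = ennreal (e / 2)"
        using \<open>0 < e\<close> ennreal_mult[of 2 "e / 4"] by simp
      also have "ennreal (e / 2) + ennreal (e / 2) = ennreal e"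
        using \<open>0 < e\<close> by (subst ennreal_plus[symmetric]) auto
      finally show ?thesis .
    qed
    then show ?thesis by blast
  qed
  from L2_complete[OF ei(3,4) this] obtain u where "u \<in> borel_measurable P"
    "(\<lambda>n. \<integral>\<^sup>+w. ennreal ((u w - v n w)\<^sup>2) \<partial>P) \<longlonglongrightarrow> 0" by blast
  then show ?thesis unfolding integral_rel_def using f s by blast
qed

lemma integral_rel_lincomb:
  assumes "integral_rel f u" "integral_rel g v"
  shows "integral_rel (\<lambda>t. a * f t + c * g t) (\<lambda>w. a * u w + c * v w)"
proof -
  obtain s p where s: "f \<in> borel_measurable m" "u \<in> borel_measurable P"
    "\<And>n::nat. elementary_integral \<A> X (s n) (p n)"
    "(\<lambda>n. norm_sq (\<lambda>t. f t - s n t)) \<longlonglongrightarrow> 0"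
    "(\<lambda>n. \<integral>\<^sup>+w. ennreal ((u w - p n w)\<^sup>2) \<partial>P) \<longlonglongrightarrow> 0"
    using assms(1) unfolding integral_rel_def by blast
  obtain s' p' where s': "g \<in> borel_measurable m" "v \<in> borel_measurable P"
    "\<And>n::nat. elementary_integral \<A> X (s' n) (p' n)"
    "(\<lambda>n. norm_sq (\<lambda>t. g t - s' n t)) \<longlonglongrightarrow> 0"
    "(\<lambda>n. \<integral>\<^sup>+w. ennreal ((v w - p' n w)\<^sup>2) \<partial>P) \<longlonglongrightarrow> 0"
    using assms(2) unfolding integral_rel_def by blast
  note ei = elementary_integral_integrable[OF s(3)] elementary_integral_integrable[OF s'(3)]
  have 1: "(\<lambda>n. norm_sq (\<lambda>t. (a * f t + c * g t) - (a * s n t + c * s' n t))) \<longlonglongrightarrow> 0"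
    by (rule norm_sq_lincomb_tendsto[OF s(1) s'(1) ei(1,5) s(4) s'(4)])
  have "(\<integral>\<^sup>+w. ennreal (((a * u w + c * v w) - (a * p n w + c * p' n w))\<^sup>2) \<partial>P) \<le>
      (2 * ennreal (a\<^sup>2)) * (\<integral>\<^sup>+w. ennreal ((u w - p n w)\<^sup>2) \<partial>P) +
      (2 * ennreal (c\<^sup>2)) * (\<integral>\<^sup>+w. ennreal ((v w - p' n w)\<^sup>2) \<partial>P)" for n
  proof -
    have scale: "(\<integral>\<^sup>+w. ennreal ((k * h w)\<^sup>2) \<partial>P) = ennreal (k\<^sup>2) * (\<integral>\<^sup>+w. ennreal ((h w)\<^sup>2) \<partial>P)"
      if [measurable]: "h \<in> borel_measurable P" for k and h :: "'w \<Rightarrow> real"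
      by (subst nn_integral_cmult[symmetric]) (auto simp: power_mult_distrib ennreal_mult)
    have meas: "(\<lambda>w. u w - p n w) \<in> borel_measurable P" "(\<lambda>w. v w - p' n w) \<in> borel_measurable P"
      using s s' ei by auto
    have "(\<integral>\<^sup>+w. ennreal (((a * u w + c * v w) - (a * p n w + c * p' n w))\<^sup>2) \<partial>P) =
        (\<integral>\<^sup>+w. ennreal ((a * (u w - p n w) + c * (v w - p' n w))\<^sup>2) \<partial>P)"
      by (simp add: algebra_simps)
    also have "\<dots> \<le> 2 * (\<integral>\<^sup>+w. ennreal ((a * (u w - p n w))\<^sup>2) \<partial>P) +
        2 * (\<integral>\<^sup>+w. ennreal ((c * (v w - p' n w))\<^sup>2) \<partial>P)"
      using meas by (intro nn_integral_square_add_le) auto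
    finally show ?thesis unfolding scale[OF meas(1)] scale[OF meas(2)] by (simp only: mult.assoc)
  qed
  then have 2: "(\<lambda>n. \<integral>\<^sup>+w. ennreal (((a * u w + c * v w) - (a * p n w + c * p' n w))\<^sup>2) \<partial>P) \<longlonglongrightarrow> 0"
    by (rule tendsto_zero_lincomb_bound[OF _ s(5) s'(5)]) (auto simp: ennreal_mult_less_top)
  have 3: "elementary_integral \<A> X (\<lambda>t. a * s n t + c * s' n t) (\<lambda>w. a * p n w + c * p' n w)" for n
    by (rule elementary_integral_lincomb[OF s(3) s'(3)])
  have "(\<lambda>t. a * f t + c * g t) \<in> borel_measurable m" "(\<lambda>w. a * u w + c * v w) \<in> borel_measurable P"
    using s s' by auto
  then show ?thesis
    unfolding integral_rel_def
    using 1 2 3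
    by (intro conjI exI[of _ "\<lambda>n t. a * s n t + c * s' n t"]
        exI[of _ "\<lambda>n w. a * p n w + c * p' n w"] allI)
qed

lemma integral_rel_X: "A \<in> \<A> \<Longrightarrow> integral_rel (indicator A) (X A)"
  unfolding integral_rel_def
  by (intro conjI exI[of _ "\<lambda>_. indicator A"] exI[of _ "\<lambda>_. X A"] allI)
    (auto intro: borel_measurable_indicator
      simp: sets_A random_variable norm_sq_null elementary_integral_indicator)

lemma integral_rel_cong_AE:
  assumes "integral_rel f u" "f' \<in> borel_measurable m" "AE t in m. f' t = f t"
    "u' \<in> borel_measurable P" "AE w in P. u' w = u w"
  shows "integral_rel f' u'"
proof -
  obtain s v where s: "\<And>n::nat. elementary_integral \<A> X (s n) (v n)"
    "(\<lambda>n. norm_sq (\<lambda>t. f t - s n t)) \<longlonglongrightarrow> 0"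
    "(\<lambda>n. \<integral>\<^sup>+w. ennreal ((u w - v n w)\<^sup>2) \<partial>P) \<longlonglongrightarrow> 0"
    using assms(1) unfolding integral_rel_def by blast
  have "norm_sq (\<lambda>t. f' t - s n t) = norm_sq (\<lambda>t. f t - s n t)" for n
    using assms(3) by (intro norm_sq_cong_AE) (auto elim: AE_mp)
  moreover have "(\<integral>\<^sup>+w. ennreal ((u' w - v n w)\<^sup>2) \<partial>P) = (\<integral>\<^sup>+w. ennreal ((u w - v n w)\<^sup>2) \<partial>P)" for n
    using assms(5) by (intro nn_integral_cong_AE) (auto elim: AE_mp)
  ultimately show ?thesis
    unfolding integral_rel_def using assms(2,4) s
    by (intro conjI exI[of _ s] exI[of _ v]) auto
qed

text \<open>
  The constant 16 comes from using \<open>(x + y)\<^sup>2 \<le> 2 x\<^sup>2 + 2 y\<^sup>2\<close> in place of Minkowski's inequality.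
\<close>

lemma integral_rel_bound:
  assumes "integral_rel f u" "integral_rel g v"
  shows "(\<integral>\<^sup>+w. ennreal ((u w - v w)\<^sup>2) \<partial>P) \<le> 16 * norm_sq (\<lambda>t. f t - g t)"
proof -
  obtain s p where s: "f \<in> borel_measurable m" "u \<in> borel_measurable P"
    "\<And>n::nat. elementary_integral \<A> X (s n) (p n)"
    "(\<lambda>n. norm_sq (\<lambda>t. f t - s n t)) \<longlonglongrightarrow> 0"
    "(\<lambda>n. \<integral>\<^sup>+w. ennreal ((u w - p n w)\<^sup>2) \<partial>P) \<longlonglongrightarrow> 0"
    using assms(1) unfolding integral_rel_def by blast
  obtain s' p' where s': "g \<in> borel_measurable m" "v \<in> borel_measurable P"
    "\<And>n::nat. elementary_integral \<A> X (s' n) (p' n)"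
    "(\<lambda>n. norm_sq (\<lambda>t. g t - s' n t)) \<longlonglongrightarrow> 0"
    "(\<lambda>n. \<integral>\<^sup>+w. ennreal ((v w - p' n w)\<^sup>2) \<partial>P) \<longlonglongrightarrow> 0"
    using assms(2) unfolding integral_rel_def by blast
  note ei = elementary_integral_integrable[OF s(3)] elementary_integral_integrable[OF s'(3)]
  let ?N = "norm_sq (\<lambda>t. f t - g t)"
  \<comment> \<open>\<open>u - v\<close> is split at \<open>p n\<close> and \<open>p' n\<close>, and
    \<open>s n - s' n\<close> at \<open>f\<close> and \<open>g\<close>. Each of the four splittings
    doubles what follows it, which produces the coefficients here.\<close>
  let ?r = "\<lambda>n. 2 * (\<integral>\<^sup>+w. ennreal ((u w - p n w)\<^sup>2) \<partial>P) + 4 * (\<integral>\<^sup>+w. ennreal ((v w - p' n w)\<^sup>2) \<partial>P) +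
      (8 * norm_sq (\<lambda>t. f t - s n t) + 16 * norm_sq (\<lambda>t. g t - s' n t))"
  have "(\<integral>\<^sup>+w. ennreal ((u w - v w)\<^sup>2) \<partial>P) \<le> 16 * ?N + ?r n" for n
  proof -
    have "norm_sq (\<lambda>t. s n t - s' n t) \<le> 2 * norm_sq (\<lambda>t. s n t - f t) + 2 * norm_sq (\<lambda>t. f t - s' n t)"
      by (rule norm_sq_diff[OF ei(1) s(1) ei(5)])
    also have "norm_sq (\<lambda>t. f t - s' n t) \<le> 2 * ?N + 2 * norm_sq (\<lambda>t. g t - s' n t)"
      by (rule norm_sq_diff[OF s(1) s'(1) ei(5)])
    finally have a: "norm_sq (\<lambda>t. s n t - s' n t) \<le>
        2 * norm_sq (\<lambda>t. f t - s n t) + 2 * (2 * ?N + 2 * norm_sq (\<lambda>t. g t - s' n t))"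
      unfolding norm_sq_commute[of "s n" f] by (simp add: add_left_mono mult_left_mono)
    have "(\<integral>\<^sup>+w. ennreal ((u w - v w)\<^sup>2) \<partial>P) \<le>
        2 * (\<integral>\<^sup>+w. ennreal ((u w - p n w)\<^sup>2) \<partial>P) + 2 * (\<integral>\<^sup>+w. ennreal ((p n w - v w)\<^sup>2) \<partial>P)"
      by (rule nn_integral_square_diff_le[OF s(2) ei(3) s'(2)])
    also have "(\<integral>\<^sup>+w. ennreal ((p n w - v w)\<^sup>2) \<partial>P) \<le>
        2 * (\<integral>\<^sup>+w. ennreal ((p n w - p' n w)\<^sup>2) \<partial>P) + 2 * (\<integral>\<^sup>+w. ennreal ((p' n w - v w)\<^sup>2) \<partial>P)"
      by (rule nn_integral_square_diff_le[OF ei(3) ei(7) s'(2)])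
    also have "(\<integral>\<^sup>+w. ennreal ((p n w - p' n w)\<^sup>2) \<partial>P) \<le> norm_sq (\<lambda>t. s n t - s' n t)"
      by (rule elementary_integral_bound[OF elementary_integral_diff[OF s(3) s'(3)]])
    also note a
    finally have "(\<integral>\<^sup>+w. ennreal ((u w - v w)\<^sup>2) \<partial>P) \<le> 2 * (\<integral>\<^sup>+w. ennreal ((u w - p n w)\<^sup>2) \<partial>P) +
        2 * (2 * (2 * norm_sq (\<lambda>t. f t - s n t) + 2 * (2 * ?N + 2 * norm_sq (\<lambda>t. g t - s' n t))) +
          2 * (\<integral>\<^sup>+w. ennreal ((p' n w - v w)\<^sup>2) \<partial>P))"
      by (simp add: add_left_mono mult_left_mono add_right_mono)
    also have "\<dots> = 16 * ?N + ?r n"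
      unfolding nn_integral_square_commute[where f="p' n" and g=v] by (simp add: algebra_simps)
    finally show ?thesis .
  qed
  moreover have "(\<lambda>n. 16 * ?N + ?r n) \<longlonglongrightarrow> 16 * ?N + 0"
  proof (intro tendsto_add tendsto_const)
    have "?r \<longlonglongrightarrow> (2 * 0 + 4 * 0) + (8 * 0 + 16 * 0)"
      by (intro tendsto_add ennreal_tendsto_cmult s s') auto
    then show "?r \<longlonglongrightarrow> 0" by simp
  qed
  ultimately show ?thesis by (intro LIMSEQ_le_const[of "\<lambda>n. 16 * ?N + ?r n"]) auto
qed

lemma integral_rel_square_integrable:
  assumes "integral_rel f u"
  shows "integrable P (\<lambda>w. (u w)\<^sup>2)"
proof -
  obtain s v where s: "u \<in> borel_measurable P" "\<And>n::nat. elementary_integral \<A> X (s n) (v n)"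
    "(\<lambda>n. \<integral>\<^sup>+w. ennreal ((u w - v n w)\<^sup>2) \<partial>P) \<longlonglongrightarrow> 0"
    using assms unfolding integral_rel_def by blast
  have "\<forall>\<^sub>F n in sequentially. (\<integral>\<^sup>+w. ennreal ((u w - v n w)\<^sup>2) \<partial>P) < 1"
    using s(3) by (rule order_tendstoD) simp
  then obtain n where n: "(\<integral>\<^sup>+w. ennreal ((u w - v n w)\<^sup>2) \<partial>P) < 1"
    by (auto simp: eventually_sequentially)
  note ei = elementary_integral_integrable[OF s(2)]
  have "(\<integral>\<^sup>+w. ennreal ((u w)\<^sup>2) \<partial>P) \<le>
      2 * (\<integral>\<^sup>+w. ennreal ((u w - v n w)\<^sup>2) \<partial>P) + 2 * (\<integral>\<^sup>+w. ennreal ((v n w)\<^sup>2) \<partial>P)"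
    using nn_integral_square_diff_le[OF s(1) ei(3), of "\<lambda>_. 0" n] by simp
  also have "\<dots> < \<infinity>"
  proof -
    have "(\<integral>\<^sup>+w. ennreal ((u w - v n w)\<^sup>2) \<partial>P) < top" using n by (rule less_trans) simp
    moreover have "(\<integral>\<^sup>+w. ennreal ((v n w)\<^sup>2) \<partial>P) < top"
      using nn_integral_eq_integral[OF ei(4)[of n]] by simp
    ultimately show ?thesis by (simp add: ennreal_mult_less_top)
  qed
  finally have "(\<integral>\<^sup>+w. ennreal ((u w)\<^sup>2) \<partial>P) < \<infinity>" .
  then show ?thesis using s(1) by (intro integrableI_bounded) auto
qed

text \<open>Collecting all related variables avoids choosing one. The restriction to
  \<open>LX_space\<close> makes the map extensional, without which it could not be unique as a
  function.\<close>

definition integral_class :: "('t \<Rightarrow> real) set \<Rightarrow> ('w \<Rightarrow> real) set" where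
  "integral_class = (\<lambda>F\<in>LX_space m b \<sigma>2 \<nu>. {u. \<exists>f\<in>F. integral_rel f u})"

lemma LX_spaceE:
  assumes "F \<in> LX_space m b \<sigma>2 \<nu>"
  obtains f where "f \<in> borel_measurable m" "norm_sq f < \<infinity>" "F = ae_class m f"
  using assms unfolding LX_space_def by blast

lemma LX_spaceI: "f \<in> borel_measurable m \<Longrightarrow> norm_sq f < \<infinity> \<Longrightarrow> ae_class m f \<in> LX_space m b \<sigma>2 \<nu>"
  unfolding LX_space_def by blast

lemma norm_sq_lincomb_finite:
  assumes "f \<in> borel_measurable m" "g \<in> borel_measurable m" "norm_sq f < \<infinity>" "norm_sq g < \<infinity>"
  shows "norm_sq (\<lambda>t. a * f t + c * g t) < \<infinity>"
  using assms by (intro le_less_trans[OF norm_sq_lincomb]) (auto simp: ennreal_mult_less_top)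

lemma norm_sq_elementary_finite:
  assumes "elementary_integral \<A> X s v"
  shows "norm_sq s < \<infinity>"
proof (cases "emeasure m T = 0")
  case True
  then have "AE t in m. s t = 0"
    by (intro AE_I[of _ _ T]) (auto simp: space_m[symmetric])
  then show ?thesis by (simp add: norm_sq_null)
next
  case False
  then have vol: "volatility < \<infinity>" using null_or_finite_volatility by blast
  from assms show ?thesis
  proof (induction rule: elementary_integral.induct)
    case zero
    show ?case by (simp add: norm_sq_null)
  next
    case (add_indicator s v A c)
    note A = add_indicator.hyps(2)
    have "norm_sq (\<lambda>t. 1 * s t + c * indicator A t) < \<infinity>"
      using sets_A[OF A]
      by (intro norm_sq_lincomb_finite add_indicator.IH norm_sq_indicator_A[OF vol A]
          elementary_integral_integrable[OF add_indicator.hyps(1)]) simp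
    then show ?case by simp
  qed
qed

text \<open>By \<open>integral_rel_bound\<close> with a null difference on the right, variables
  related to almost everywhere equal integrands agree almost surely;
  \<open>integral_rel_cong_AE\<close> gives the converse inclusion.\<close>

lemma integral_class_eq:
  assumes "integral_rel f u" "norm_sq f < \<infinity>"
  shows "integral_class (ae_class m f) = ae_class P u"
proof -
  have f: "f \<in> borel_measurable m" and u: "u \<in> borel_measurable P"
    using assms(1) unfolding integral_rel_def by auto
  have "(\<exists>f'\<in>ae_class m f. integral_rel f' u') \<longleftrightarrow> u' \<in> ae_class P u" for u'
  proof
    assume "\<exists>f'\<in>ae_class m f. integral_rel f' u'"
    then obtain f' where f': "AE t in m. f' t = f t" "integral_rel f' u'"
      unfolding ae_class_def by blast
    have u': "u' \<in> borel_measurable P" using f'(2) unfolding integral_rel_def by auto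
    have "AE t in m. f' t - f t = 0" using f'(1) by eventually_elim simp
    then have "norm_sq (\<lambda>t. f' t - f t) = 0" by (rule norm_sq_null)
    then have "(\<integral>\<^sup>+w. ennreal ((u' w - u w)\<^sup>2) \<partial>P) = 0"
      using integral_rel_bound[OF f'(2) assms(1)] by simp
    then show "u' \<in> ae_class P u"
      using nn_integral_square_eq_0[OF u' u] u' by (simp add: ae_class_def)
  next
    assume "u' \<in> ae_class P u"
    then show "\<exists>f'\<in>ae_class m f. integral_rel f' u'"
      using integral_rel_cong_AE[OF assms(1) f] ae_class_self[OF f] by (auto simp: ae_class_def)
  qed
  then show ?thesis
    unfolding integral_class_def using LX_spaceI[OF f assms(2)] by auto
qed

text \<open>Membership in the class provides only some representative related to \<open>u\<close>,
  while continuity quantifies over all pairs of representatives.\<close>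

lemma integral_class_rel:
  assumes "F \<in> LX_space m b \<sigma>2 \<nu>" "f \<in> F" "u \<in> integral_class F"
  shows "integral_rel f u" "norm_sq f < \<infinity>"
proof -
  obtain h where h: "h \<in> borel_measurable m" "norm_sq h < \<infinity>" "F = ae_class m h"
    by (rule LX_spaceE[OF assms(1)])
  obtain f' where f': "f' \<in> F" "integral_rel f' u"
    using assms(1,3) unfolding integral_class_def by auto
  have f: "f \<in> borel_measurable m" "AE t in m. f t = h t" "AE t in m. f' t = h t"
    using assms(2) f'(1) unfolding h(3) ae_class_def by auto
  have "AE t in m. f t = f' t" using f(2,3) by eventually_elim simp
  then show "integral_rel f u"
    using f' by (intro integral_rel_cong_AE[OF f'(2) f(1)]) (auto simp: integral_rel_def)
  show "norm_sq f < \<infinity>" using norm_sq_cong_AE[OF f(2)] h(2) by simp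
qed

lemma LX_norm_eq: "LX_norm m b \<sigma>2 \<nu> f = sqrt (enn2real (norm_sq f))"
  by (rule LX_norm_def)

lemma integral_class_is_stochastic_integral:
  "is_stochastic_integral \<A> m P X b \<sigma>2 \<nu> integral_class"
  unfolding is_stochastic_integral_def
proof (intro conjI ballI)
  show "integral_class \<in> LX_space m b \<sigma>2 \<nu> \<rightarrow>\<^sub>E L2_space P"
  proof (rule PiE_I)
    fix F assume "F \<in> LX_space m b \<sigma>2 \<nu>"
    then obtain f where f: "f \<in> borel_measurable m" "norm_sq f < \<infinity>" "F = ae_class m f"
      by (rule LX_spaceE)
    obtain u where u: "integral_rel f u" using integral_rel_exists[OF f(1,2)] by blast
    have "u \<in> borel_measurable P" using u unfolding integral_rel_def by simp
    then show "integral_class F \<in> L2_space P"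
      unfolding f(3) integral_class_eq[OF u f(2)] L2_space_def
      using integral_rel_square_integrable[OF u] by blast
  qed (simp add: integral_class_def)
  show "linear_map_classes m (LX_space m b \<sigma>2 \<nu>) P integral_class"
    unfolding linear_map_classes_def
  proof (intro ballI allI)
    fix F G a c assume "F \<in> LX_space m b \<sigma>2 \<nu>" "G \<in> LX_space m b \<sigma>2 \<nu>"
    then obtain f g where f: "f \<in> borel_measurable m" "norm_sq f < \<infinity>" "F = ae_class m f"
      and g: "g \<in> borel_measurable m" "norm_sq g < \<infinity>" "G = ae_class m g"
      by (elim LX_spaceE)
    obtain u v where u: "integral_rel f u" and v: "integral_rel g v"
      using integral_rel_exists[OF f(1,2)] integral_rel_exists[OF g(1,2)] by blast
    have m: "u \<in> borel_measurable P" "v \<in> borel_measurable P"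
      using u v unfolding integral_rel_def by auto
    show "integral_class (class_lincomb m a F c G) =
        class_lincomb P a (integral_class F) c (integral_class G)"
      unfolding f(3) g(3) class_lincomb_ae_class[OF f(1) g(1)]
        integral_class_eq[OF u f(2)] integral_class_eq[OF v g(2)] class_lincomb_ae_class[OF m]
      by (intro integral_class_eq integral_rel_lincomb u v norm_sq_lincomb_finite f g)
  qed
  show "continuous_map_classes (LX_space m b \<sigma>2 \<nu>)
       (\<lambda>f g. LX_norm m b \<sigma>2 \<nu> (\<lambda>t. f t - g t)) (\<lambda>u v. L2_norm P (\<lambda>w. u w - v w)) integral_class"
    unfolding continuous_map_classes_def
  proof (intro ballI allI impI)
    fix F :: "('t \<Rightarrow> real) set" and e :: real
    assume F: "F \<in> LX_space m b \<sigma>2 \<nu>" and e: "0 < e"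
    \<comment> \<open>The radius \<open>e / 4\<close> inverts the Lipschitz constant 4 = sqrt 16
      coming from \<open>integral_rel_bound\<close>.\<close>
    have "L2_norm P (\<lambda>w. u w - v w) < e"
      if G: "G \<in> LX_space m b \<sigma>2 \<nu>" and fg: "f \<in> F" "g \<in> G"
        and less: "LX_norm m b \<sigma>2 \<nu> (\<lambda>t. f t - g t) < e / 4"
        and uv: "u \<in> integral_class F" "v \<in> integral_class G" for G f g u v
    proof -
      note u = integral_class_rel[OF F fg(1) uv(1)] and v = integral_class_rel[OF G fg(2) uv(2)]
      have m: "f \<in> borel_measurable m" "g \<in> borel_measurable m"
        "u \<in> borel_measurable P" "v \<in> borel_measurable P"
        using u(1) v(1) unfolding integral_rel_def by auto
      have fin: "norm_sq (\<lambda>t. f t - g t) < \<infinity>"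
        using norm_sq_lincomb_finite[OF m(1,2) u(2) v(2), of 1 "-1"] by simp
      have "L2_norm P (\<lambda>w. u w - v w) \<le> sqrt (enn2real (16 * norm_sq (\<lambda>t. f t - g t)))"
        using m fin integral_rel_bound[OF u(1) v(1)]
        by (subst L2_norm_eq) (auto intro!: enn2real_mono simp: ennreal_mult_less_top)
      also have "\<dots> = 4 * LX_norm m b \<sigma>2 \<nu> (\<lambda>t. f t - g t)"
        by (simp add: LX_norm_eq enn2real_mult real_sqrt_mult)
      also have "\<dots> < e" using less by simp
      finally show ?thesis .
    qed
    then show "\<exists>r>0. \<forall>G\<in>LX_space m b \<sigma>2 \<nu>. \<forall>f\<in>F. \<forall>g\<in>G.
        LX_norm m b \<sigma>2 \<nu> (\<lambda>t. f t - g t) < r \<longrightarrow>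
        (\<forall>u\<in>integral_class F. \<forall>v\<in>integral_class G. L2_norm P (\<lambda>w. u w - v w) < e)"
      using e by (intro exI[of _ "e / 4"] conjI ballI impI) auto
  qed
  show "integral_class (ae_class m (indicator A)) = ae_class P (X A)" if "A \<in> \<A>" for A
    by (intro integral_class_eq integral_rel_X that
        norm_sq_elementary_finite[OF elementary_integral_indicator])
qed

section \<open>Uniqueness of the continuous linear map\<close>

lemma stochastic_integral_elementary:
  assumes \<Phi>: "is_stochastic_integral \<A> m P X b \<sigma>2 \<nu> \<Phi>" and "elementary_integral \<A> X s v"
  shows "\<Phi> (ae_class m s) = ae_class P v"
proof -
  have lin: "\<Phi> (ae_class m (\<lambda>t. a * f t + c * g t)) = ae_class P (\<lambda>w. a * u w + c * v w)"
    if "f \<in> borel_measurable m" "g \<in> borel_measurable m" "norm_sq f < \<infinity>" "norm_sq g < \<infinity>"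
      "u \<in> borel_measurable P" "v \<in> borel_measurable P"
      "\<Phi> (ae_class m f) = ae_class P u" "\<Phi> (ae_class m g) = ae_class P v" for a c f g u v
  proof -
    have "\<Phi> (class_lincomb m a (ae_class m f) c (ae_class m g)) =
        class_lincomb P a (\<Phi> (ae_class m f)) c (\<Phi> (ae_class m g))"
      using \<Phi> LX_spaceI that unfolding is_stochastic_integral_def linear_map_classes_def by blast
    then show ?thesis using that by (simp only: class_lincomb_ae_class)
  qed
  have ind: "\<Phi> (ae_class m (indicator A)) = ae_class P (X A)" if "A \<in> \<A>" for A
    using \<Phi> that unfolding is_stochastic_integral_def by blast
  have indm: "(indicator A :: 't \<Rightarrow> real) \<in> borel_measurable m" "norm_sq (indicator A) < \<infinity>"
    if "A \<in> \<A>" for A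
    using elementary_integral_integrable(1) norm_sq_elementary_finite
      elementary_integral_indicator[OF that] by blast+
  from assms(2) show ?thesis
  proof (induction rule: elementary_integral.induct)
    case zero
    \<comment> \<open>Linearity is stated only for combinations of two classes, so the value at zero
      is obtained from a trivial combination of indicators of the empty set.\<close>
    have "\<Phi> (ae_class m (\<lambda>t. 0 * indicator {} t + 0 * indicator {} t)) =
        ae_class P (\<lambda>w. 0 * X {} w + 0 * X {} w)"
      by (intro lin ind indm random_variable empty_mem)
    then show ?case by simp
  next
    case (add_indicator s v A c)
    note A = add_indicator.hyps(2)
    note s = elementary_integral_integrable[OF add_indicator.hyps(1)]
    have "\<Phi> (ae_class m (\<lambda>t. 1 * s t + c * indicator A t)) = ae_class P (\<lambda>w. 1 * v w + c * X A w)"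
      by (intro lin s indm A ind random_variable add_indicator.IH
          norm_sq_elementary_finite[OF add_indicator.hyps(1)])
    then show ?case by simp
  qed
qed

text \<open>Along an approximating sequence \<open>\<Phi>\<close> takes the elementary values
  \<open>v n\<close>. Continuity at \<open>F\<close> makes them converge in L^2 to a representative
  of \<open>\<Phi> F\<close>, while by construction they converge to \<open>u\<close>.\<close>

lemma stochastic_integral_unique:
  assumes \<Phi>: "is_stochastic_integral \<A> m P X b \<sigma>2 \<nu> \<Phi>"
  shows "\<Phi> = integral_class"
proof (rule extensionalityI[of _ "LX_space m b \<sigma>2 \<nu>"])
  show "\<Phi> \<in> extensional (LX_space m b \<sigma>2 \<nu>)"
    using \<Phi> unfolding is_stochastic_integral_def PiE_def by blast
  show "integral_class \<in> extensional (LX_space m b \<sigma>2 \<nu>)" unfolding integral_class_def by simp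
  fix F assume F: "F \<in> LX_space m b \<sigma>2 \<nu>"
  obtain f where f: "f \<in> borel_measurable m" "norm_sq f < \<infinity>" "F = ae_class m f"
    by (rule LX_spaceE[OF F])
  obtain u where u: "integral_rel f u" using integral_rel_exists[OF f(1,2)] by blast
  obtain s v where s: "u \<in> borel_measurable P" "\<And>n::nat. elementary_integral \<A> X (s n) (v n)"
    "(\<lambda>n. norm_sq (\<lambda>t. f t - s n t)) \<longlonglongrightarrow> 0"
    "(\<lambda>n. \<integral>\<^sup>+w. ennreal ((u w - v n w)\<^sup>2) \<partial>P) \<longlonglongrightarrow> 0"
    using u unfolding integral_rel_def by blast
  note ei = elementary_integral_integrable[OF s(2)]
  have "\<Phi> F \<in> L2_space P" using \<Phi> F unfolding is_stochastic_integral_def PiE_def by blast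
  then obtain u' where u': "u' \<in> borel_measurable P" "integrable P (\<lambda>w. (u' w)\<^sup>2)" "\<Phi> F = ae_class P u'"
    unfolding L2_space_def by blast
  have cont: "continuous_map_classes (LX_space m b \<sigma>2 \<nu>)
      (\<lambda>f g. LX_norm m b \<sigma>2 \<nu> (\<lambda>t. f t - g t)) (\<lambda>u v. L2_norm P (\<lambda>w. u w - v w)) \<Phi>"
    using \<Phi> unfolding is_stochastic_integral_def by blast
  have "(\<lambda>n. L2_norm P (\<lambda>w. u' w - v n w)) \<longlonglongrightarrow> 0"
  proof (rule LIMSEQ_I)
    fix e :: real assume "0 < e"
    have "\<exists>r>0. \<forall>G\<in>LX_space m b \<sigma>2 \<nu>. \<forall>f\<in>F. \<forall>g\<in>G.
        LX_norm m b \<sigma>2 \<nu> (\<lambda>t. f t - g t) < r \<longrightarrow> (\<forall>u\<in>\<Phi> F. \<forall>v\<in>\<Phi> G. L2_norm P (\<lambda>w. u w - v w) < e)"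
      by (rule bspec[OF cont[unfolded continuous_map_classes_def] F, THEN spec, THEN mp, OF \<open>0 < e\<close>])
    then obtain r where r: "0 < r" "\<forall>G\<in>LX_space m b \<sigma>2 \<nu>. \<forall>f\<in>F. \<forall>g\<in>G.
        LX_norm m b \<sigma>2 \<nu> (\<lambda>t. f t - g t) < r \<longrightarrow> (\<forall>u\<in>\<Phi> F. \<forall>v\<in>\<Phi> G. L2_norm P (\<lambda>w. u w - v w) < e)"
      by (elim exE conjE)
    have "(\<lambda>n. enn2real (norm_sq (\<lambda>t. f t - s n t))) \<longlonglongrightarrow> 0"
      using s(3) by (intro tendsto_enn2real) auto
    then have "(\<lambda>n. LX_norm m b \<sigma>2 \<nu> (\<lambda>t. f t - s n t)) \<longlonglongrightarrow> sqrt 0"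
      unfolding LX_norm_eq by (intro tendsto_real_sqrt)
    then have "\<forall>\<^sub>F n in sequentially. LX_norm m b \<sigma>2 \<nu> (\<lambda>t. f t - s n t) < r"
      using r(1) by (intro order_tendstoD(2)[where y="sqrt 0"]) simp_all
    then obtain N where N: "\<And>n. n \<ge> N \<Longrightarrow> LX_norm m b \<sigma>2 \<nu> (\<lambda>t. f t - s n t) < r"
      by (auto simp: eventually_sequentially)
    have "norm (L2_norm P (\<lambda>w. u' w - v n w) - 0) < e" if "n \<ge> N" for n
    proof -
      have "L2_norm P (\<lambda>w. u' w - v n w) < e"
      proof (rule r(2)[rule_format, OF LX_spaceI[OF ei(1) norm_sq_elementary_finite[OF s(2)]] _ _ N[OF that]])
        show "f \<in> F" unfolding f(3) by (rule ae_class_self[OF f(1)])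
        show "s n \<in> ae_class m (s n)" by (rule ae_class_self[OF ei(1)])
        show "u' \<in> \<Phi> F" unfolding u'(3) by (rule ae_class_self[OF u'(1)])
        show "v n \<in> \<Phi> (ae_class m (s n))"
          unfolding stochastic_integral_elementary[OF \<Phi> s(2)] by (rule ae_class_self[OF ei(3)])
      qed
      moreover have "0 \<le> L2_norm P (\<lambda>w. u' w - v n w)" unfolding L2_norm_def by simp
      ultimately show ?thesis by simp
    qed
    then show "\<exists>N. \<forall>n\<ge>N. norm (L2_norm P (\<lambda>w. u' w - v n w) - 0) < e" by blast
  qed
  then have "(\<lambda>n. ennreal ((L2_norm P (\<lambda>w. u' w - v n w))\<^sup>2)) \<longlonglongrightarrow> ennreal (0\<^sup>2)"
    by (intro tendsto_ennrealI tendsto_power)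
  moreover have "(\<integral>\<^sup>+w. ennreal ((u' w - v n w)\<^sup>2) \<partial>P) = ennreal ((L2_norm P (\<lambda>w. u' w - v n w))\<^sup>2)" for n
  proof -
    have "integrable P (\<lambda>w. (u' w)\<^sup>2 + (v n w)\<^sup>2 - 2 * (u' w * v n w))"
      using integrable_mult_if_square_integrable[OF u'(1) ei(3) u'(2) ei(4)] u'(2) ei(4) by simp
    then have "integrable P (\<lambda>w. (u' w - v n w)\<^sup>2)" by (simp add: power2_diff mult.assoc)
    then show ?thesis
      unfolding L2_norm_def by (subst nn_integral_eq_integral) (auto simp: integral_nonneg_AE)
  qed
  ultimately have lim: "(\<lambda>n. \<integral>\<^sup>+w. ennreal ((u' w - v n w)\<^sup>2) \<partial>P) \<longlonglongrightarrow> 0" by simp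
  \<comment> \<open>The sequence is constant, so tending to 0 means being 0.\<close>
  have "(\<lambda>n::nat. \<integral>\<^sup>+w. ennreal ((u' w - u w)\<^sup>2) \<partial>P) \<longlonglongrightarrow> 0"
  proof (rule tendsto_zero_lincomb_bound[OF _ lim s(4)])
    show "(\<integral>\<^sup>+w. ennreal ((u' w - u w)\<^sup>2) \<partial>P) \<le>
        2 * (\<integral>\<^sup>+w. ennreal ((u' w - v n w)\<^sup>2) \<partial>P) + 2 * (\<integral>\<^sup>+w. ennreal ((u w - v n w)\<^sup>2) \<partial>P)" for n
      using nn_integral_square_diff_le[OF u'(1) ei(3) s(1), of n]
      unfolding nn_integral_square_commute[where f="v n" and g=u] .
  qed auto
  then have "(\<integral>\<^sup>+w. ennreal ((u' w - u w)\<^sup>2) \<partial>P) = 0" by (simp add: LIMSEQ_const_iff)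
  then have "AE w in P. u' w = u w" by (rule nn_integral_square_eq_0[OF u'(1) s(1)])
  then have "\<Phi> F = ae_class P u" unfolding u'(3) ae_class_eq_iff[OF u'(1) s(1)] .
  then show "\<Phi> F = integral_class F" unfolding f(3) integral_class_eq[OF u f(2)] .
qed

end

theorem theorem2p9:
  fixes T :: "'t set" and \<A> :: "'t set set" and \<A>n :: "nat \<Rightarrow> 't set set"
    and m :: "'t measure" and P :: "'w measure" and X :: "'t set \<Rightarrow> 'w \<Rightarrow> real"
    and b \<sigma>2 :: real and \<nu> :: "real measure"
  assumes "indexing_collection T \<A> \<A>n"
    and "space m = T" and "sets m = sigma_sets T \<A>"
    and "\<And>A. A \<in> \<A> \<Longrightarrow> emeasure m A < \<infinity>"
    and "compatible_metric T \<A> \<A>n (measure_dist m)"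
    and "L2_levy_process \<A> m P X"
    and "levy_triplet \<A> m P X b \<sigma>2 \<nu>"
  shows "\<exists>!\<Phi>. is_stochastic_integral \<A> m P X b \<sigma>2 \<nu> \<Phi>"
proof -
  interpret levy_integrator T \<A> \<A>n m P X b \<sigma>2 \<nu>
    using assms by (intro levy_integrator.intro levy_integrator_axioms.intro)
  show ?thesis
    using integral_class_is_stochastic_integral stochastic_integral_unique by (rule ex1I)
qed

end
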